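(* Let $q$ be a prime power and $f_1=t-1$. For each $\Phi^*$-colored partition $\tilde{\boldsymbol\lambda}\in\mathcal P_n^{\Phi^*}$ and each partition $\mu=(\mu_1,\dots,\mu_r)\vdash n$, the value of the irreducible character $\chi^{\tilde{\boldsymbol\lambda}}$ of $\mathrm{GL}_n(\mathbb F_q)$ on the unipotent class $\mu(f_1)$ is $$\chi^{\tilde{\boldsymbol\lambda}}_{\mu(f_1)}=(-1)^{\mu_1}q^{|\mu|}\sum_{\tilde{\boldsymbol\tau}\subset\underline{\tilde{\boldsymbol\lambda}}}\mathcal B(q;\tilde{\boldsymbol\tau})\sum_{\tilde{\boldsymbol\rho}}\chi^{\tilde{\boldsymbol\rho}'}_{\mu^{[1]}(f_1)}.$$ Here the outer sum is over all $\Phi^*$-colored compositions $\tilde{\boldsymbol\tau}$ such that, for each $\phi$, $\tilde{\boldsymbol\tau}(\phi)$ has exactly $l(\tilde{\boldsymbol\lambda}(\phi))$ parts, all positive, and $\tilde{\boldsymbol\tau}(\phi)\subset\underline{\tilde{\boldsymbol\lambda}(\phi)}$; the inner sum is over all $\tilde{\boldsymbol\rho}\in\mathcal P^{\Phi^*}_{\|\tilde{\boldsymbol\tau}\|-\mu_1}$ with $l(\tilde{\boldsymbol\rho}(\phi))\le1$ for each $\phi\in\Phi^*$ (empty sum if $\|\tilde{\boldsymbol\tau}\|<\mu_1$); $\tilde{\boldsymbol\rho}'$ is the $\Phi^*$-colored integer sequence given by concatenation, $$\tilde{\boldsymbol\rho}'(\phi)=[\tilde{\boldsymbol\lambda}(\phi)-\tilde{\boldsymbol\tau}(\phi),\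 \tilde{\boldsymbol\rho}(\phi)];$$ $\mu^{[1]}=(\mu_2,\dots,\mu_r)$; and $$\mathcal B(q;\tilde{\boldsymbol\tau})=\prod_{\phi\in\Phi^*}\prod_{i=1}^{l(\tilde{\boldsymbol\tau}(\phi))}B(q^{|\phi|};\tilde{\boldsymbol\tau}(\phi)_i),\qquad B(q^{|\phi|};j)=\begin{cases}-1,& j=1,\\ q^{-|\phi|}-1,& j>1.\end{cases}$$
   Context: $M_n=\mathbb F_{q^n}^\times\subset M=\overline{\mathbb F}_q^\times$; $M_n^*$ is the group of complex characters of $M_n$, with $M_m^*\subset M_n^*$ for $m\mid n$ (via the norm map); $M^*=\bigcup_n M_n^*$. The Frobenius $x\mapsto x^q$ acts on $M$ and $M^*$; $\Phi$ and $\Phi^*$ are the sets of its orbits in $M$ and $M^*$. Elements of $\Phi$ are identified with monic irreducible polynomials $f\ne t$ over $\mathbb F_q$, $|f|=\deg f$; $|\phi|$ is the size of $\phi\in\Phi^*$. $\mathcal F_G=\bigotimes_{\phi\in\Phi^*}\mathbb C[p_n(\phi):n\ge1]$ is the polynomial algebra on independent generators $p_n(\phi)$, with inner product in which the monomials $p_{\tilde{\boldsymbol\lambda}}=\prod_\phi p_{\tilde{\boldsymbol\lambda}(\phi)}(\phi)$ are orthogonal with $\langle p_{\tilde{\boldsymbol\lambda}},p_{\tilde{\boldsymbol\lambda}}\rangle=\prod_\phi z_{\tilde{\boldsymbol\lambda}(\phi)}$ ($z_\lambda=\prod_i i^{m_i}m_i!$ for $\lambda=(1^{m_1}2^{m_2}\cdots)$).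 For $f\in\Phi$ with root $x$, $$p_n(f)=\frac{(-1)^{n|f|-1}}{q^{n|f|}-1}\sum_{\xi\in M^*_{n|f|}}\overline{\xi(x)}\,p_{n|f|/|\phi_\xi|}(\phi_\xi),$$ where $\phi_\xi$ is the orbit of $\xi$; the $p_n(f)$ ($n\ge1$, $f\in\Phi$) are also algebraically independent generators of $\mathcal F_G$. In particular $p_n(f_1)=\frac{(-1)^{n-1}}{q^n-1}\sum_{|\phi|\,\mid\, n}|\phi|\,p_{n/|\phi|}(\phi)$. Here $\partial/\partial p_n(\phi)$ is taken with respect to the generators indexed by $\Phi^*$ and $\partial/\partial p_n(f)$ with respect to those indexed by $\Phi$. The operators $S_n(\phi)$, $Q_n(f_1)\in\mathrm{End}(\mathcal F_G)$, $n\in\mathbb Z$, are defined by $$\sum_{n\in\mathbb Z}S_n(\phi)z^n=\exp\Big(\sum_{n\ge1}\tfrac1n p_n(\phi)z^n\Big)\exp\Big(-\sum_{n\ge1}\tfrac{\partial}{\partial p_n(\phi)}z^{-n}\Big),$$ $$\sum_{n\in\mathbb Z}Q_n(f_1)z^{n}=\exp\Big(\sum_{n\ge1}\tfrac{q^{n}-1}{n}p_n(f_1)z^n\Big)\exp\Big(-\sum_{n\ge1}q^{-n}\tfrac{\partial}{\partial p_n(f_1)}z^{-n}\Big).$$ For an integer sequence $\alpha=(\alpha_1,\dots,\alpha_l)$, $S_\alpha(\phi)=S_{\alpha_1}(\phi)\cdots S_{\alpha_l}(\phi)$ (identity if $l=0$); operators of different colors commute; "$X.1$" is the operator $X$ applied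 to $1\in\mathcal F_G$. Colored partitions/compositions: maps from $\Phi^*$ to partitions/compositions with finite weight $\|\tilde{\boldsymbol\lambda}\|=\sum_\phi|\phi||\tilde{\boldsymbol\lambda}(\phi)|$; $\mathcal P_n^{\Phi^*}$ is the set of colored partitions of weight $n$. $l(\lambda)$ is the number of nonzero parts. For $\lambda=(\lambda_1,\dots,\lambda_l)$, $l=l(\lambda)$, $\underline\lambda=(\lambda_1+l,\lambda_2+l-1,\dots,\lambda_l+1)$ and $\underline{\tilde{\boldsymbol\lambda}}(\phi)=\underline{\tilde{\boldsymbol\lambda}(\phi)}$; $\tau\subset\mu$ means $\tau_i\le\mu_i$ for all $i$; $[\alpha,\beta]$ is concatenation of sequences. Characters: the irreducible characters of $\mathrm{GL}_n(\mathbb F_q)$ are parametrized (Green) by $\tilde{\boldsymbol\lambda}\in\mathcal P_n^{\Phi^*}$, unipotent classes by partitions $\mu\vdash n$ (Jordan type), denoted $\mu(f_1)$, and the character values on them are given by the known formula $$\chi^{\tilde{\boldsymbol\lambda}}_{\mu(f_1)}=q^{n(\mu)}\Big\langle\prod_{\phi\in\Phi^*}S_{\tilde{\boldsymbol\lambda}(\phi)}(\phi).1,\ Q_{\mu_1}(f_1)\cdots Q_{\mu_r}(f_1).1\Big\rangle,\qquad n(\mu)=\sum_i(i-1)\mu_i,$$ which may be taken as the definition. For a colored integer sequence $\tilde{\boldsymbol\alpha}$ that need not consist of partitions, $\chi^{\tilde{\boldsymbol\alpha}}_{\mu(f_1)}$ is defined by the same formula; by the relations $S_m(\phi)S_n(\phi)=-S_{n-1}(\phi)S_{m+1}(\phi)$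 and $S_{-n}(\phi).1=\delta_{n,0}$ ($n\ge0$) it equals $0$ or $\pm$ a genuine irreducible character value. *)

theory Defs
  imports Complex_Main "HOL-Library.Poly_Mapping" "HOL-Library.Cardinality"
    "HOL-Algebra.Algebraic_Closure_Type"
begin

text \<open>
  Throughout, \<open>'a\<close> is the finite field with \<open>q = CARD('a)\<close> elements and \<open>'a alg_closure\<close> its
  algebraic closure.
\<close>

section \<open>The groups \<open>M\<close> and \<open>M*\<close> and their Frobenius orbits\<close>

text \<open>\<open>M_lev n\<close> is the multiplicative group of the subfield with \<open>q ^ n\<close> elements.\<close>

definition M_lev :: "nat \<Rightarrow> 'a::{finite,field} alg_closure set" where
  "M_lev n = {x. x \<noteq> 0 \<and> x ^ (CARD('a) ^ n) = x}"

text \<open>Complex characters of \<open>M_lev n\<close>, extended by \<open>0\<close> so that equality of functions is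
  equality of characters.\<close>

definition M_chars :: "nat \<Rightarrow> ('a::{finite,field} alg_closure \<Rightarrow> complex) set" where
  "M_chars n = {\<xi>. (\<forall>x\<in>M_lev n. \<xi> x \<noteq> 0) \<and> (\<forall>x\<in>M_lev n. \<forall>y\<in>M_lev n. \<xi> (x * y) = \<xi> x * \<xi> y)
                 \<and> (\<forall>x. x \<notin> M_lev n \<longrightarrow> \<xi> x = 0)}"

text \<open>\<open>field_norm n m\<close> is the norm from \<open>M_lev n\<close> to \<open>M_lev m\<close>, for \<open>m\<close> dividing \<open>n\<close>;
  \<open>inflate m n\<close> is the resulting embedding of \<open>M_chars m\<close> into \<open>M_chars n\<close>.\<close>

definition field_norm :: "nat \<Rightarrow> nat \<Rightarrow> 'a::{finite,field} alg_closure \<Rightarrow> 'a alg_closure" where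
  "field_norm n m x = (\<Prod>i<n div m. x ^ (CARD('a) ^ (m * i)))"

definition inflate :: "nat \<Rightarrow> nat \<Rightarrow> ('a::{finite,field} alg_closure \<Rightarrow> complex) \<Rightarrow> ('a alg_closure \<Rightarrow> complex)" where
  "inflate m n \<xi> = (\<lambda>x. if x \<in> M_lev n then \<xi> (field_norm n m x) else 0)"

lemma field_norm_in:
  fixes x :: "'a::{finite,field} alg_closure"
  assumes "n dvd N" "n > 0" "N > 0" "x \<in> M_lev N"
  shows "field_norm N n x \<in> M_lev n"
proof -
  let ?q = "CARD('a)"
  obtain b where N: "N = n * b" using assms(1) by blast
  have b0: "b > 0" using assms(3) N by simp
  have x0: "x \<noteq> 0" and xN: "x ^ (?q ^ N) = x" using assms(4) by (auto simp: M_lev_def)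
  have fn: "field_norm N n x = (\<Prod>i<b. x ^ (?q ^ (n * i)))"
    using assms(2) by (simp add: field_norm_def N)
  define g where "g i = x ^ (?q ^ (n * i))" for i
  have g0: "g 0 = x" and gb: "g b = x" using xN by (simp_all add: g_def N)
  have "(field_norm N n x) ^ (?q ^ n) = (\<Prod>i<b. g (Suc i))"
    unfolding fn g_def prod_power_distrib
    by (rule prod.cong) (simp_all add: power_add mult.commute flip: power_mult)
  also have "\<dots> = (\<Prod>i<b. g i)"
  proof -
    have "g 0 * (\<Prod>i<b. g (Suc i)) = (\<Prod>i<Suc b. g i)"
      by (simp only: prod.lessThan_Suc_shift)
    also have "\<dots> = (\<Prod>i<b. g i) * g b" by (simp add: mult.commute)
    finally show ?thesis using x0 by (simp add: g0 gb)
  qed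
  finally have "(field_norm N n x) ^ (?q ^ n) = field_norm N n x" by (simp add: fn g_def)
  moreover have "field_norm N n x \<noteq> 0" using x0 by (simp add: fn)
  ultimately show ?thesis by (simp add: M_lev_def)
qed

lemma field_norm_trans:
  fixes x :: "'a::{finite,field} alg_closure"
  assumes "m dvd n" "n dvd N" "m > 0" "n > 0"
  shows "field_norm n m (field_norm N n x) = field_norm N m x"
proof -
  let ?q = "CARD('a)"
  obtain a where n: "n = m * a" using assms(1) by blast
  obtain b where N: "N = m * a * b" using assms(2) n by blast
  have a0: "a > 0" using assms(4) n by simp
  have d1: "n div m = a" using assms(3) n by simp
  have d2: "N div n = b" using assms(4) n N by simp
  have d3: "N div m = b * a" using assms(3) by (simp add: N mult.assoc)
  define g where "g i = x ^ (?q ^ (m * i))" for i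
  have "field_norm n m (field_norm N n x) = (\<Prod>j<a. \<Prod>i<b. g (i * a + j))"
    unfolding field_norm_def d1 d2 prod_power_distrib g_def
  proof (intro prod.cong refl)
    fix i j
    have "m * (i * a + j) = n * i + m * j" by (simp add: n distrib_left mult_ac)
    then show "(x ^ ?q ^ (n * i)) ^ ?q ^ (m * j) = x ^ ?q ^ (m * (i * a + j))"
      by (simp only: power_add power_mult)
  qed
  also have "\<dots> = (\<Prod>i<b. \<Prod>j<a. g (i * a + j))" by (rule prod.swap)
  also have "\<dots> = (\<Prod>i<b. prod g {i * a..<i * a + a})"
  proof (rule prod.cong)
    fix i
    have "prod g {i * a..<i * a + a} = (\<Prod>j=0..<a. g (j + i * a))"
      using prod.shift_bounds_nat_ivl[of g 0 "i * a" a] by (simp add: add.commute)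
    then show "(\<Prod>j<a. g (i * a + j)) = prod g {i * a..<i * a + a}"
      by (simp add: atLeast0LessThan add.commute)
  qed simp
  also have "\<dots> = prod g {..<b * a}" by (rule prod.nat_group)
  finally show ?thesis by (simp add: field_norm_def d3 g_def)
qed

lemma inflate_trans:
  assumes "m dvd n" "n dvd N" "m > 0" "n > 0" "N > 0"
  shows "inflate n N (inflate m n \<xi>) = inflate m N \<xi>"
  unfolding inflate_def
  by (rule ext) (simp add: field_norm_in[OF assms(2,4,5)] field_norm_trans[OF assms(1-4)])

text \<open>\<open>M*\<close> is the direct limit of the groups \<open>M_chars n\<close> along the maps \<open>inflate\<close>.\<close>

definition M_star_rel ::
  "nat \<times> ('a::{finite,field} alg_closure \<Rightarrow> complex) \<Rightarrow> nat \<times> ('a alg_closure \<Rightarrow> complex) \<Rightarrow> bool" where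
  "M_star_rel = (\<lambda>(m, \<xi>) (n, \<eta>). m > 0 \<and> n > 0 \<and> \<xi> \<in> M_chars m \<and> \<eta> \<in> M_chars n
     \<and> (\<exists>N>0. m dvd N \<and> n dvd N \<and> inflate m N \<xi> = inflate n N \<eta>))"

lemma part_equivp_M_star_rel:
  "part_equivp (M_star_rel :: nat \<times> ('a::{finite,field} alg_closure \<Rightarrow> complex) \<Rightarrow> _)"
proof (rule part_equivpI)
  let ?\<xi> = "\<lambda>x :: 'a alg_closure. if x \<in> M_lev 1 then 1 else 0 :: complex"
  have "?\<xi> \<in> M_chars 1" by (auto simp: M_chars_def M_lev_def power_mult_distrib)
  then have "M_star_rel (1, ?\<xi>) (1, ?\<xi>)" by (auto simp: M_star_rel_def)
  then show "\<exists>x :: nat \<times> ('a alg_closure \<Rightarrow> complex). M_star_rel x x" by blast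
  show "symp (M_star_rel :: nat \<times> ('a alg_closure \<Rightarrow> complex) \<Rightarrow> _)"
    unfolding M_star_rel_def by (rule sympI) (auto 0 3 dest: sym)
  show "transp (M_star_rel :: nat \<times> ('a alg_closure \<Rightarrow> complex) \<Rightarrow> _)"
  proof (rule transpI)
    fix x y z :: "nat \<times> ('a alg_closure \<Rightarrow> complex)"
    assume xy: "M_star_rel x y" and yz: "M_star_rel y z"
    obtain l \<xi> m \<eta> n \<zeta> where e: "x = (l, \<xi>)" "y = (m, \<eta>)" "z = (n, \<zeta>)"
      by (metis surj_pair)
    obtain A where A: "A > 0" "l dvd A" "m dvd A" "inflate l A \<xi> = inflate m A \<eta>"
      using xy by (auto simp: M_star_rel_def e)
    obtain B where B: "B > 0" "m dvd B" "n dvd B" "inflate m B \<eta> = inflate n B \<zeta>"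
      using yz by (auto simp: M_star_rel_def e)
    have p: "l > 0" "m > 0" "n > 0" using xy yz by (auto simp: M_star_rel_def e)
    have AB: "A * B > 0" "A dvd A * B" "B dvd A * B" using A B by auto
    have "inflate l (A * B) \<xi> = inflate A (A * B) (inflate l A \<xi>)"
      by (rule inflate_trans[OF A(2) AB(2) p(1) A(1) AB(1), symmetric])
    also have "\<dots> = inflate m (A * B) \<eta>"
      unfolding A(4) by (rule inflate_trans[OF A(3) AB(2) p(2) A(1) AB(1)])
    also have "\<dots> = inflate B (A * B) (inflate m B \<eta>)"
      by (rule inflate_trans[OF B(2) AB(3) p(2) B(1) AB(1), symmetric])
    also have "\<dots> = inflate n (A * B) \<zeta>"
      unfolding B(4) by (rule inflate_trans[OF B(3) AB(3) p(3) B(1) AB(1)])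
    finally have "inflate l (A * B) \<xi> = inflate n (A * B) \<zeta>" .
    moreover have "l dvd A * B" "n dvd A * B" using A(2) B(3) by auto
    ultimately show "M_star_rel x z"
      using xy yz AB(1) by (auto simp: M_star_rel_def e intro!: exI[of _ "A * B"])
  qed
qed

quotient_type (overloaded) 'a M_star =
  "nat \<times> ('a::{finite,field} alg_closure \<Rightarrow> complex)" / partial: M_star_rel
  by (rule part_equivp_M_star_rel)

text \<open>The Frobenius of \<open>M*\<close> is \<open>\<xi> \<mapsto> \<xi> ^ q\<close>, the power being taken pointwise.\<close>

lift_definition frob_star :: "'a::{finite,field} M_star \<Rightarrow> 'a M_star" is
  "\<lambda>(n, \<xi>). (n, \<lambda>x. \<xi> x ^ CARD('a))"
proof -
  fix a b :: "nat \<times> ('a alg_closure \<Rightarrow> complex)"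
  assume ab: "M_star_rel a b"
  have [simp]: "(\<lambda>x. \<xi> x ^ CARD('a)) \<in> M_chars n"
    if "\<xi> \<in> M_chars n" for n and \<xi> :: "'a alg_closure \<Rightarrow> complex"
    using that by (auto simp: M_chars_def power_mult_distrib)
  have [simp]: "inflate m N (\<lambda>x. \<xi> x ^ CARD('a)) = (\<lambda>x. inflate m N \<xi> x ^ CARD('a))"
    for m N and \<xi> :: "'a alg_closure \<Rightarrow> complex"
    by (auto simp: inflate_def)
  show "M_star_rel (case a of (n, \<xi>) \<Rightarrow> (n, \<lambda>x. \<xi> x ^ CARD('a)))
                   (case b of (n, \<xi>) \<Rightarrow> (n, \<lambda>x. \<xi> x ^ CARD('a)))"
    using ab unfolding M_star_rel_def
    by (cases a; cases b) (simp, metis)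
qed

typedef (overloaded) 'a Phi_star =
  "{A :: 'a::{finite,field} M_star set. \<exists>\<xi>. A = range (\<lambda>k. (frob_star ^^ k) \<xi>)}"
  by blast

definition orbit_star :: "'a::{finite,field} M_star \<Rightarrow> 'a Phi_star" where
  "orbit_star \<xi> = Abs_Phi_star (range (\<lambda>k. (frob_star ^^ k) \<xi>))"

definition size_star :: "'a::{finite,field} Phi_star \<Rightarrow> nat" where
  "size_star \<phi> = card (Rep_Phi_star \<phi>)"

typedef (overloaded) 'a Phi =
  "{A :: 'a::{finite,field} alg_closure set. \<exists>x. x \<noteq> 0 \<and> A = range (\<lambda>k. x ^ (CARD('a) ^ k))}"
  by (rule exI[of _ "range (\<lambda>k. 1 ^ (CARD('a) ^ k))"], rule CollectI, rule exI[of _ 1]) simp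

definition size_Phi :: "'a::{finite,field} Phi \<Rightarrow> nat" where
  "size_Phi f = card (Rep_Phi f)"

text \<open>The irreducible polynomial with which an orbit is identified, over the algebraic closure.\<close>

definition Phi_poly :: "'a::{finite,field} Phi \<Rightarrow> 'a alg_closure poly" where
  "Phi_poly f = (\<Prod>x\<in>Rep_Phi f. [:- x, 1:])"

definition f1 :: "'a::{finite,field} Phi" where
  "f1 = Abs_Phi {1}"

lemma Rep_f1: "Rep_Phi f1 = {1}"
proof -
  have "{1} = range (\<lambda>k. (1 :: 'a alg_closure) ^ (CARD('a) ^ k))" by auto
  then show ?thesis unfolding f1_def by (intro Abs_Phi_inverse CollectI exI[of _ 1]) auto
qed

lemma Phi_poly_f1: "Phi_poly f1 = [:- 1, 1:]"
  by (simp add: Phi_poly_def Rep_f1)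

section \<open>The polynomial algebra and its inner product\<close>

text \<open>
  The indeterminate with index \<open>(\<phi>, k)\<close> is \<open>p_(k+1)(\<phi>)\<close>; the shift makes \<open>nat\<close> range
  exactly over the generators with positive subscript.
\<close>

type_synonym 'a FG = "('a Phi_star \<times> nat \<Rightarrow>\<^sub>0 nat) \<Rightarrow>\<^sub>0 complex"

definition FG_scale :: "complex \<Rightarrow> 'a::{finite,field} FG \<Rightarrow> 'a FG" where
  "FG_scale c F = Poly_Mapping.single 0 c * F"

definition p_star :: "nat \<Rightarrow> 'a::{finite,field} Phi_star \<Rightarrow> 'a FG" where
  "p_star n \<phi> = Poly_Mapping.single (Poly_Mapping.single (\<phi>, n - 1) 1) 1"

definition z_mono :: "('a::{finite,field} Phi_star \<times> nat \<Rightarrow>\<^sub>0 nat) \<Rightarrow> nat" where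
  "z_mono m = (\<Prod>(\<phi>, k)\<in>Poly_Mapping.keys m.
     (k + 1) ^ Poly_Mapping.lookup m (\<phi>, k) * fact (Poly_Mapping.lookup m (\<phi>, k)))"

text \<open>The Hermitian inner product, linear in the first argument.\<close>

definition FG_inner :: "'a::{finite,field} FG \<Rightarrow> 'a FG \<Rightarrow> complex" where
  "FG_inner F G = (\<Sum>m\<in>Poly_Mapping.keys F.
     Poly_Mapping.lookup F m * cnj (Poly_Mapping.lookup G m) * of_nat (z_mono m))"

text \<open>The choice of the root \<open>x\<close> of \<open>f\<close> is immaterial.\<close>

definition p_Phi :: "nat \<Rightarrow> 'a::{finite,field} Phi \<Rightarrow> 'a FG" where
  "p_Phi n f =
     (let N = n * size_Phi f; x = (SOME x. x \<in> Rep_Phi f) in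
      FG_scale ((-1) ^ (N - 1) / (of_nat CARD('a) ^ N - 1))
        (\<Sum>\<xi>\<in>M_chars N. let \<phi> = orbit_star (abs_M_star (N, \<xi>)) in
           FG_scale (cnj (\<xi> x)) (p_star (N div size_star \<phi>) \<phi>)))"

definition FG_derivation :: "('a::{finite,field} FG \<Rightarrow> 'a FG) \<Rightarrow> bool" where
  "FG_derivation D \<longleftrightarrow> (\<forall>F G. D (F + G) = D F + D G) \<and> (\<forall>c F. D (FG_scale c F) = FG_scale c (D F))
     \<and> (\<forall>F G. D (F * G) = D F * G + F * D G)"

text \<open>Partial derivative with respect to \<open>g i\<close>, where \<open>(g j)\<close>, \<open>j \<in> I\<close>, are algebraically
  independent generators; for such a family the derivation below exists and is unique.\<close>

definition FG_partial :: "('i \<Rightarrow> 'a::{finite,field} FG) \<Rightarrow> 'i set \<Rightarrow> 'i \<Rightarrow> 'a FG \<Rightarrow> 'a FG" where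
  "FG_partial g I i = (THE D. FG_derivation D \<and> (\<forall>j\<in>I. D (g j) = (if j = i then 1 else 0)))"

definition d_star :: "nat \<Rightarrow> 'a::{finite,field} Phi_star \<Rightarrow> 'a FG \<Rightarrow> 'a FG" where
  "d_star n \<phi> = FG_partial (\<lambda>(k, \<psi>). p_star k \<psi>) {(k, \<psi>). k \<ge> 1} (n, \<phi>)"

definition d_Phi :: "nat \<Rightarrow> 'a::{finite,field} Phi \<Rightarrow> 'a FG \<Rightarrow> 'a FG" where
  "d_Phi n f = FG_partial (\<lambda>(k, g). p_Phi k g) {(k, g). k \<ge> 1} (n, f)"

section \<open>Vertex operators\<close>

text \<open>\<open>exp_coeff A n\<close> is the coefficient of \<open>w ^ n\<close> in
  \<open>exp (A 1 w + A 2 w^2 + \<dots>) = (\<Sum>k. (A 1 w + A 2 w^2 + \<dots>)^k / k!)\<close>; expanding the \<open>k\<close>-th power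
  gives one composite for each composition of \<open>n\<close> into \<open>k\<close> positive parts.\<close>

definition exp_coeff :: "(nat \<Rightarrow> 'a::{finite,field} FG \<Rightarrow> 'a FG) \<Rightarrow> nat \<Rightarrow> 'a FG \<Rightarrow> 'a FG" where
  "exp_coeff A n F = (\<Sum>js\<in>{js. 0 \<notin> set js \<and> sum_list js = n}.
     FG_scale (1 / fact (length js)) (foldr A js F))"

text \<open>The coefficient of \<open>z ^ n\<close> in
  \<open>exp (A 1 z + A 2 z^2 + \<dots>) exp (B 1 z^(-1) + B 2 z^(-2) + \<dots>)\<close>. The sum is finite
  whenever \<open>B\<close> consists of lowering operators, as it does below.\<close>

definition vertex_coeff ::
  "(nat \<Rightarrow> 'a::{finite,field} FG \<Rightarrow> 'a FG) \<Rightarrow> (nat \<Rightarrow> 'a FG \<Rightarrow> 'a FG) \<Rightarrow> int \<Rightarrow> 'a FG \<Rightarrow> 'a FG" where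
  "vertex_coeff A B n F = Sum_any (\<lambda>j :: nat.
     if n + int j < 0 then 0 else exp_coeff A (nat (n + int j)) (exp_coeff B j F))"

definition S_op :: "'a::{finite,field} Phi_star \<Rightarrow> int \<Rightarrow> 'a FG \<Rightarrow> 'a FG" where
  "S_op \<phi> = vertex_coeff (\<lambda>k F. FG_scale (1 / of_nat k) (p_star k \<phi>) * F) (\<lambda>k F. - d_star k \<phi> F)"

definition Q_op :: "int \<Rightarrow> 'a::{finite,field} FG \<Rightarrow> 'a FG" where
  "Q_op = vertex_coeff
     (\<lambda>k F. FG_scale ((of_nat CARD('a) ^ k - 1) / of_nat k) (p_Phi k f1) * F)
     (\<lambda>k F. - FG_scale (1 / of_nat CARD('a) ^ k) (d_Phi k f1 F))"

definition S_seq :: "'a::{finite,field} Phi_star \<Rightarrow> int list \<Rightarrow> 'a FG \<Rightarrow> 'a FG" where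
  "S_seq \<phi> \<alpha> = foldr (S_op \<phi>) \<alpha>"

text \<open>The product of the operators \<open>S_seq \<phi> (\<alpha> \<phi>)\<close> over all colours, applied to \<open>1\<close>; the
  order is immaterial because operators of different colours commute.\<close>

definition S_colored :: "('a::{finite,field} Phi_star \<Rightarrow> int list) \<Rightarrow> 'a FG" where
  "S_colored \<alpha> = Finite_Set.fold (\<lambda>\<phi>. S_seq \<phi> (\<alpha> \<phi>)) 1 {\<phi>. \<alpha> \<phi> \<noteq> []}"

section \<open>Partitions and character values\<close>

definition is_partition :: "nat list \<Rightarrow> bool" where
  "is_partition l \<longleftrightarrow> sorted_wrt (\<ge>) l \<and> 0 \<notin> set l"

definition colored_weight :: "('a::{finite,field} Phi_star \<Rightarrow> nat list) \<Rightarrow> nat" where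
  "colored_weight l = (\<Sum>\<phi>\<in>{\<phi>. l \<phi> \<noteq> []}. size_star \<phi> * sum_list (l \<phi>))"

definition colored_partitions :: "nat \<Rightarrow> ('a::{finite,field} Phi_star \<Rightarrow> nat list) set" where
  "colored_partitions n =
     {l. finite {\<phi>. l \<phi> \<noteq> []} \<and> (\<forall>\<phi>. is_partition (l \<phi>)) \<and> colored_weight l = n}"

definition n_stat :: "nat list \<Rightarrow> nat" where
  "n_stat \<mu> = (\<Sum>i<length \<mu>. i * \<mu> ! i)"

text \<open>\<open>unip_char \<alpha> \<mu>\<close> is the value at the unipotent class of Jordan type \<open>\<mu>\<close> of the
  irreducible character labelled by \<open>\<alpha>\<close>, extended by the same formula to arbitrary coloured integer
  sequences \<open>\<alpha>\<close>.\<close>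

definition unip_char :: "('a::{finite,field} Phi_star \<Rightarrow> int list) \<Rightarrow> nat list \<Rightarrow> complex" where
  "unip_char \<alpha> \<mu> = of_nat CARD('a) ^ n_stat \<mu>
     * FG_inner (S_colored \<alpha>) (foldr Q_op (map int \<mu>) 1)"

definition add_staircase :: "nat list \<Rightarrow> nat list" where
  "add_staircase l = map (\<lambda>i. l ! i + (length l - i)) [0..<length l]"

text \<open>The coloured compositions \<open>\<tau>\<close> contained in \<open>add_staircase \<circ> l\<close> with as many parts as \<open>l\<close> in each
  colour, all of them positive.\<close>

definition sub_compositions ::
  "('a::{finite,field} Phi_star \<Rightarrow> nat list) \<Rightarrow> ('a Phi_star \<Rightarrow> nat list) set" where
  "sub_compositions l = {\<tau>. \<forall>\<phi>. length (\<tau> \<phi>) = length (l \<phi>)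
     \<and> (\<forall>i<length (l \<phi>). 0 < \<tau> \<phi> ! i \<and> \<tau> \<phi> ! i \<le> add_staircase (l \<phi>) ! i)}"

definition B_coeff :: "complex \<Rightarrow> nat \<Rightarrow> complex" where
  "B_coeff Q j = (if j = 1 then - 1 else inverse Q - 1)"

definition B_colored :: "nat \<Rightarrow> ('a::{finite,field} Phi_star \<Rightarrow> nat list) \<Rightarrow> complex" where
  "B_colored q \<tau> = (\<Prod>\<phi>\<in>{\<phi>. \<tau> \<phi> \<noteq> []}. \<Prod>i<length (\<tau> \<phi>). B_coeff (of_nat q ^ size_star \<phi>) (\<tau> \<phi> ! i))"

definition rho_prime ::
  "('a::{finite,field} Phi_star \<Rightarrow> nat list) \<Rightarrow> ('a Phi_star \<Rightarrow> nat list) \<Rightarrow> ('a Phi_star \<Rightarrow> nat list)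
     \<Rightarrow> 'a Phi_star \<Rightarrow> int list" where
  "rho_prime l \<tau> \<rho> = (\<lambda>\<phi>. map2 (\<lambda>a b. int a - int b) (l \<phi>) (\<tau> \<phi>) @ map int (\<rho> \<phi>))"

text \<open>The largest part, with the convention that it is \<open>0\<close> for the empty partition.\<close>

definition first_part :: "nat list \<Rightarrow> nat" where
  "first_part \<mu> = (case \<mu> of [] \<Rightarrow> 0 | m # _ \<Rightarrow> m)"

end

theory Submission
  imports Defs "HOL-Number_Theory.Residues"
begin

text \<open>For nonempty \<open>\<mu>\<close> the character value is \<open>\<langle>S_l.1, Q_m F\<rangle>\<close> up to a
power of \<open>q\<close>, where \<open>m\<close> is the first part of \<open>\<mu>\<close> and \<open>F\<close> is
the product of the remaining operators \<open>Q\<close> applied to \<open>1\<close>. The recursion is obtained by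
moving \<open>Q_m\<close> to the left and commuting its adjoint through all the operators \<open>S\<close>. Below,
\<open>d = size_star \<phi>\<close>, and \<open>D_k(\<phi>)\<close> is the derivative with respect to
\<open>p_k(\<phi>)\<close>.

The adjoint is computed from two sums over colours, \<open>f1_sum k\<close>, which is \<open>1/k\<close> times the
sum of \<open>d p_(k/d)(\<phi>)\<close> over the \<open>\<phi>\<close> with \<open>d\<close> dividing
\<open>k\<close>, and \<open>f1_deriv k\<close>, the sum of \<open>D_(k/d)(\<phi>)\<close> over the same
\<open>\<phi>\<close>; they are adjoint to each other. The generators \<open>p_k(f)\<close> are a finite Fourier
transform of the \<open>p_k(\<phi>)\<close>, and orthogonality of the characters of the cyclic groups
\<open>M_lev n\<close> identifies both \<open>p_k(f1)\<close> and the derivative in \<open>p_k(f1)\<close>, up to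
scalars, with these two sums (\<open>p_Phi_f1\<close>, \<open>d_Phi_f1\<close>). Consequently \<open>(-1)^m\<close>
times the adjoint of \<open>Q_m\<close> is the coefficient of \<open>w^m\<close> in
\<open>V(w) = exp(\<Sum> f1_sum k (q w)^(-k)) exp(- \<Sum> f1_deriv k w^k)\<close> (\<open>Q_adj\<close>,
\<open>FG_inner_Q_op\<close>).

Commuting exponentials of Heisenberg generators gives, with \<open>x = w^d u\<close>,
\<open>V(w) S(\<phi>;u) = (1 - x) / (1 - 1/(q^d x)) S(\<phi>;u) V(w)\<close>. The commutation relations produce
this factor as a series in \<open>1/x\<close>, but the claim is about its expansion in positive powers, which is
\<open>\<Sum>i\<ge>1. q^(d i) B(q^d;i) x^i\<close>. The two expansions differ as formal series; they agree as
operators on suitable vectors, because \<open>S_b(\<phi>)\<close> vanishes for \<open>b < -k\<close> on every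
vector on which \<open>exp(- \<Sum> D_i(\<phi>) z^(-i))\<close> has no term beyond \<open>z^(-k)\<close>
(\<open>lower_le\<close>, \<open>S_op_eq_0\<close>), and a product of \<open>k\<close> operators
\<open>S(\<phi>)\<close> applied to \<open>1\<close> is such a vector. This truncation is exactly the bound
\<open>\<tau>_i \<le> \<lambda>_i + r - i + 1\<close> of the theorem, for a partition \<open>\<lambda>\<close> with
\<open>r\<close> parts in the colour \<open>\<phi>\<close>. The resulting formula for one operator is
\<open>Q_adj_S_op\<close>; it is iterated over the rows of one colour (\<open>Q_adj_S_seq\<close>) and over the
colours (\<open>Q_adj_S_prod\<close>).

What remains is \<open>V(w).1\<close>, whose coefficients are those of \<open>exp(\<Sum> f1_sum k z^k)\<close>.
This exponential is the product over all \<open>\<phi>\<close> of the series of complete symmetric functions in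
\<open>z^d\<close>, and expanding the product gives the sum over coloured partitions with at most one row in each
colour (\<open>h_all_one_row\<close>).\<close>

section \<open>Roots of unity and the groups \<open>M_lev n\<close>\<close>

lemma card_gt_1: "CARD('a::{finite,field}) > 1"
proof -
  have "card {0, 1 :: 'a} \<le> CARD('a)" by (intro card_mono) auto
  thus ?thesis by simp
qed

lemma of_nat_card_0: "of_nat CARD('a::{finite,field}) = (0 :: 'a alg_closure)"
  using CHAR_dvd_CARD[where 'a='a]
  by (metis CHAR_alg_closure of_nat_eq_0_iff_char_dvd)

lemma card_pow_gt_1: "n > 0 \<Longrightarrow> CARD('a::{finite,field}) ^ n > 1"
  using card_gt_1[where 'a='a] one_less_power by blast

text \<open>The exponent \<open>q ^ n\<close> in the definition is more convenient for Frobenius arguments, the exponent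
\<open>q ^ n - 1\<close> exhibits the group as the full group of roots of unity of that order.\<close>

lemma M_lev_iff:
  fixes x :: "'a::{finite,field} alg_closure"
  assumes "n > 0"
  shows "x \<in> M_lev n \<longleftrightarrow> x ^ (CARD('a) ^ n - 1) = 1"
proof -
  obtain N where N: "CARD('a) ^ n = Suc N" "N > 0"
    using card_pow_gt_1[OF assms, where 'a='a] by (metis One_nat_def Suc_lessE)
  show ?thesis using N by (auto simp: M_lev_def power_0_left)
qed

lemma finite_card_roots_of_unity_le:
  fixes d :: nat
  assumes "d > 0"
  shows "finite {x :: 'b::field. x ^ d = 1}" and "card {x :: 'b. x ^ d = 1} \<le> d"
proof -
  define p :: "'b poly" where "p = monom 1 d - 1"
  have "coeff p d = 1" using assms by (simp add: p_def)
  hence p0: "p \<noteq> 0" by auto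
  have roots: "{x. poly p x = 0} = {x. x ^ d = 1}" by (simp add: p_def poly_monom)
  show "finite {x :: 'b. x ^ d = 1}" using poly_roots_finite[OF p0] roots by simp
  have "degree p \<le> d" unfolding p_def by (rule degree_diff_le) (auto simp: degree_monom_le)
  thus "card {x :: 'b. x ^ d = 1} \<le> d" using card_poly_roots_bound[OF p0] roots by simp
qed

text \<open>The polynomial \<open>X^N - 1\<close> has no common root with its derivative \<open>N X^(N-1)\<close>, so its roots
in an algebraically closed field are simple.\<close>

lemma card_roots_of_unity_alg_closed:
  fixes N :: nat
  assumes "of_nat N \<noteq> (0 :: 'b::alg_closed_field)"
  shows "card {x :: 'b. x ^ N = 1} = N"
proof -
  have N0: "N > 0" using assms by (cases N) auto
  define p :: "'b poly" where "p = monom 1 N - 1"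
  have c: "coeff p N = 1" using N0 by (simp add: p_def)
  hence p0: "p \<noteq> 0" by auto
  have "degree p \<le> N" unfolding p_def by (rule degree_diff_le) (auto simp: degree_monom_le)
  hence deg: "degree p = N" using c le_degree[of p N] by simp
  have roots: "{x. poly p x = 0} = {x. x ^ N = 1}" by (simp add: p_def poly_monom)
  have simple: "\<not> (poly p a = 0 \<and> poly (pderiv p) a = 0)" for a
    using assms N0 by (auto simp: p_def poly_monom pderiv_diff pderiv_monom power_0_left)
  obtain A where A: "size A = degree p" "p = smult (lead_coeff p) (\<Prod>x\<in>#A. [:-x, 1:])"
    using alg_closed_imp_factorization[OF p0] by blast
  have l0: "lead_coeff p \<noteq> 0" using p0 by simp
  have rootsA: "{x. poly p x = 0} = set_mset A"
    by (subst A(2)) (use p0 in \<open>auto simp: poly_prod_mset prod_mset_zero_iff\<close>)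
  have cnt: "count A x \<le> 1" for x
  proof (rule ccontr)
    assume "\<not> count A x \<le> 1"
    hence "{#x, x#} \<subseteq># A" by (auto simp: subseteq_mset_def)
    then obtain B where B: "A = {#x, x#} + B" by (metis subset_mset.add_diff_inverse)
    have "p = smult (lead_coeff p) ([:-x, 1:]^2 * (\<Prod>x\<in>#B. [:-x, 1:]))"
      by (subst A(2), subst B) (simp add: power2_eq_square mult.assoc del: mult_pCons_left mult_pCons_right)
    then obtain r where "p = [:-x, 1:]^2 * r" by (metis mult_smult_right)
    hence "poly p x = 0 \<and> poly (pderiv p) x = 0"
      by (simp add: pderiv_mult power2_eq_square del: mult_pCons_left mult_pCons_right)
    with simple show False by blast
  qed
  have "A = mset_set (set_mset A)"
    by (rule multiset_eqI) (metis One_nat_def cnt count_mset_set(1) count_mset_set(3) count_eq_zero_iff finite_set_mset le_Suc_eq le_zero_eq)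
  hence "size A = card (set_mset A)" by (metis size_mset_set)
  thus ?thesis using A(1) deg roots rootsA by simp
qed

text \<open>For each prime \<open>p\<close> dividing \<open>N\<close>, the equation \<open>x^(N/p) = 1\<close> has fewer than
\<open>N\<close> solutions, which yields an element of order equal to the full \<open>p\<close>-part of
\<open>N\<close>; the product of these elements has order \<open>N\<close>.\<close>

lemma roots_of_unity_cyclic:
  fixes N :: nat
  assumes N0: "N > 0" and card: "card {x :: 'b::field. x ^ N = 1} = N"
  shows "\<exists>g :: 'b. g ^ N = 1 \<and> (\<forall>k. g ^ k = 1 \<longrightarrow> N dvd k)"
proof -
  let ?P = "prime_factors N"
  define a where "a p = multiplicity p N" for p
  have ex: "\<exists>x :: 'b. x ^ N = 1 \<and> x ^ (N div p) \<noteq> 1" if p: "p \<in> ?P" for p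
  proof (rule ccontr)
    assume "\<not> ?thesis"
    hence sub: "{x :: 'b. x ^ N = 1} \<subseteq> {x. x ^ (N div p) = 1}" by auto
    have FG_pd: "p dvd N" "p > 1" using p using prime_gt_1_nat[of p] by (auto simp: in_prime_factors_iff)
    have "N div p > 0" using FG_pd N0 by (auto simp: dvd_div_eq_0_iff)
    from finite_card_roots_of_unity_le[OF this, where 'b='b] card_mono[OF _ sub]
    have "N \<le> N div p" unfolding card by linarith
    moreover have "N div p < N" using FG_pd N0 by simp
    ultimately show False by simp
  qed
  define x where "x p = (SOME x :: 'b. x ^ N = 1 \<and> x ^ (N div p) \<noteq> 1)" for p
  have x: "x p ^ N = 1" "x p ^ (N div p) \<noteq> 1" if "p \<in> ?P" for p
    using someI_ex[OF ex[OF that]] unfolding x_def by auto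
  define y where "y p = x p ^ (N div p ^ a p)" for p
  have pa: "p ^ a p dvd N" for p unfolding a_def by (rule multiplicity_dvd)
  have y1: "y p ^ (p ^ a p) = 1" if "p \<in> ?P" for p
    using x(1)[OF that] pa[of p] by (simp add: y_def flip: power_mult)
  define g where "g = (\<Prod>p\<in>?P. y p)"
  have gN: "g ^ N = 1"
  proof -
    have "y p ^ N = 1" if "p \<in> ?P" for p
      using y1[OF that] pa[of p] by (metis dvd_div_mult_self mult.commute power_mult power_one)
    thus ?thesis by (simp add: g_def prod_power_distrib)
  qed
  have gp: "g ^ (N div p) \<noteq> 1" if p: "p \<in> ?P" for p
  proof -
    have pr: "prime p" "p dvd N" using p by (auto simp: in_prime_factors_iff)
    have ap: "a p > 0" using pr N0 unfolding a_def by (simp add: prime_multiplicity_gt_zero_iff)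
    have other: "y r ^ (N div p) = 1" if r: "r \<in> ?P" "r \<noteq> p" for r
    proof -
      have "prime r" using r by (auto simp: in_prime_factors_iff)
      hence "coprime (r ^ a r) p" using pr r by (simp add: primes_coprime)
      hence "r ^ a r dvd N div p" using pa[of r] pr
        by (metis coprime_dvd_mult_left_iff dvd_div_mult_self)
      thus ?thesis using y1[OF r(1)] by (metis dvd_div_mult_self mult.commute power_mult power_one)
    qed
    have "g ^ (N div p) = (\<Prod>r\<in>?P. y r ^ (N div p))" by (simp add: g_def prod_power_distrib)
    also have "\<dots> = y p ^ (N div p) * (\<Prod>r\<in>?P - {p}. y r ^ (N div p))"
      by (rule prod.remove) (use p in auto)
    also have "(\<Prod>r\<in>?P - {p}. y r ^ (N div p)) = 1" by (rule prod.neutral) (use other in auto)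
    finally have g: "g ^ (N div p) = y p ^ (N div p)" by simp
    show ?thesis
    proof
      assume "g ^ (N div p) = 1"
      hence yp: "y p ^ (N div p) = 1" using g by simp
      \<comment> \<open>If \<open>x p ^ (N div p)\<close> were killed by \<open>M\<close>, the part of \<open>N\<close> prime to \<open>p\<close>, it would be \<open>1\<close>, since \<open>p\<close> kills it too.\<close>
      obtain M where M: "N = p ^ a p * M" using pa[of p] by blast
      have pM: "\<not> p dvd M"
        using M N0 pr unfolding a_def
        by (metis dvd_mult_cancel_left mult.commute multiplicity_decompose' mult_cancel_left nonzero_mult_div_cancel_left not_prime_unit not_gr_zero power_eq_0_iff prime_gt_0_nat dvd_triv_left nat_dvd_1_iff_1 not_prime_1)
      have p0: "p > 0" using pr by (simp add: prime_gt_0_nat)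
      obtain b where b: "a p = Suc b" using ap by (cases "a p") auto
      have Np: "N div p = p ^ b * M" using M b p0 by simp
      have yM: "y p = x p ^ M" using M p0 by (simp add: y_def)
      have e: "(x p ^ M) ^ (p ^ b * M) = 1" using yp by (simp add: Np yM)
      define z where "z = x p ^ (p ^ b * M)"
      have z1: "z ^ M = 1" using e by (simp add: z_def mult_ac flip: power_mult)
      have z2: "z ^ p = 1" using x(1)[OF p] M b by (simp add: z_def mult_ac flip: power_mult)
      have zn: "z \<noteq> 1" using x(2)[OF p] Np by (simp add: z_def)
      have "coprime p M" using pr pM by (simp add: prime_imp_coprime)
      then obtain u v where uv: "p * u = M * v + 1"
        using bezout_nat[of p M] p0 by (auto simp: coprime_iff_gcd_eq_1)
      have "z ^ (p * u) = z" by (simp add: uv power_add power_mult z1)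
      moreover have "z ^ (p * u) = 1" by (simp add: power_mult z2)
      ultimately show False using zn by simp
    qed
  qed
  have "N dvd k" if k: "g ^ k = 1" for k
  proof (rule ccontr)
    assume nd: "\<not> N dvd k"
    have g0: "g \<noteq> 0" using gN N0 by (metis power_0_left zero_neq_one less_numeral_extra(3))
    define d where "d = gcd k N"
    have k0: "k > 0" using nd by (cases k) auto
    obtain u v where uv: "k * u = N * v + d" unfolding d_def using bezout_nat[of k N] k0 by auto
    have "g ^ (k * u) = 1" using k by (simp add: power_mult)
    hence gd: "g ^ d = 1" using gN by (simp add: uv power_add power_mult)
    have dN: "d dvd N" "d \<noteq> N" using nd unfolding d_def by (auto, metis gcd_dvd1)
    then obtain e where e: "N = d * e" by blast
    have "e \<noteq> 1" using dN e by auto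
    then obtain p where p: "prime p" "p dvd e" by (metis prime_factor_nat)
    then obtain e' where e': "e = p * e'" by blast
    have "p \<in> ?P" using p e N0 by (auto simp: in_prime_factors_iff)
    moreover have "N div p = d * e'" using e e' p by (simp add: prime_gt_0_nat)
    hence "g ^ (N div p) = 1" using gd by (simp add: power_mult)
    ultimately show False using gp by blast
  qed
  thus ?thesis using gN by blast
qed

lemma card_M_lev:
  assumes "n > 0"
  shows "finite (M_lev n :: 'a::{finite,field} alg_closure set)"
    and "card (M_lev n :: 'a alg_closure set) = CARD('a) ^ n - 1"
proof -
  let ?N = "CARD('a) ^ n - 1"
  have gt: "CARD('a) ^ n > 1" by (rule card_pow_gt_1[OF assms])
  have eq: "(M_lev n :: 'a alg_closure set) = {x. x ^ ?N = 1}" using M_lev_iff[OF assms] by blast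
  have "of_nat (CARD('a) ^ n) = (0 :: 'a alg_closure)"
    using of_nat_card_0[where 'a='a] assms by simp
  moreover have "of_nat (CARD('a) ^ n) = of_nat ?N + (1 :: 'a alg_closure)"
    using gt by (metis Suc_eq_plus1 Suc_pred' less_trans of_nat_1 of_nat_add zero_less_one)
  ultimately have nz: "of_nat ?N \<noteq> (0 :: 'a alg_closure)" by (metis add_0 zero_neq_one)
  show "finite (M_lev n :: 'a alg_closure set)" unfolding eq
    using finite_card_roots_of_unity_le(1)[of ?N, where 'b="'a alg_closure"] gt by simp
  show "card (M_lev n :: 'a alg_closure set) = ?N" unfolding eq
    by (rule card_roots_of_unity_alg_closed[OF nz])
qed

lemma one_in_M_lev: "1 \<in> M_lev n"
  by (simp add: M_lev_def)

lemma mult_in_M_lev: "x \<in> M_lev n \<Longrightarrow> y \<in> M_lev n \<Longrightarrow> x * y \<in> M_lev n"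
  by (simp add: M_lev_def power_mult_distrib)

lemma power_in_M_lev: "x \<in> M_lev n \<Longrightarrow> x ^ k \<in> M_lev n"
  by (induct k) (auto simp: one_in_M_lev mult_in_M_lev)

lemma M_lev_power_eq_1: "n > 0 \<Longrightarrow> x \<in> M_lev n \<Longrightarrow> x ^ (CARD('a) ^ n - 1) = 1"
  for x :: "'a::{finite,field} alg_closure"
  by (simp add: M_lev_iff)

text \<open>An element of exact order \<open>q ^ n - 1\<close>, hence a generator. All facts about characters below are read
off from the value at a generator.\<close>

definition M_generator :: "nat \<Rightarrow> 'a::{finite,field} alg_closure \<Rightarrow> bool" where
  "M_generator n g \<longleftrightarrow> g \<in> M_lev n \<and> (\<forall>k. g ^ k = 1 \<longleftrightarrow> (CARD('a) ^ n - 1) dvd k)"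

lemma power_eq_power_iff_of_order:
  fixes g :: "'b::field"
  assumes "\<And>k. g ^ k = 1 \<longleftrightarrow> N dvd k" and "N > 0"
  shows "g ^ i = g ^ j \<longleftrightarrow> i mod N = j mod N"
proof -
  have gN: "g ^ N = 1" using assms(1)[of N] by simp
  hence g0: "g \<noteq> 0" using assms(2) by (auto simp: power_0_left)
  have red: "g ^ i = g ^ (i mod N)" for i
  proof -
    have "g ^ i = g ^ (N * (i div N) + i mod N)" by (simp only: mult_div_mod_eq)
    thus ?thesis by (simp only: power_add power_mult gN power_one mult_1)
  qed
  have eq: "i = j" if "i \<le> j" "j < N" "g ^ i = g ^ j" for i j
  proof -
    have "g ^ j = g ^ i * g ^ (j - i)" using that(1) by (simp flip: power_add)
    hence "g ^ (j - i) = 1" using that(3) g0 by simp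
    hence "N dvd j - i" using assms(1)[of "j - i"] by simp
    moreover have "j - i < N" using that(2) by simp
    ultimately have "j - i = 0" using nat_dvd_not_less by blast
    thus ?thesis using that(1) by simp
  qed
  show ?thesis
  proof
    assume "g ^ i = g ^ j"
    hence h: "g ^ (i mod N) = g ^ (j mod N)" using red[of i] red[of j] by argo
    show "i mod N = j mod N"
      using eq[of "i mod N" "j mod N"] eq[of "j mod N" "i mod N"] assms(2) h
      by (cases "i mod N \<le> j mod N") auto
  next
    assume "i mod N = j mod N" thus "g ^ i = g ^ j" using red[of i] red[of j] by argo
  qed
qed

lemma M_generator_exists:
  assumes "n > 0"
  shows "\<exists>g :: 'a::{finite,field} alg_closure. M_generator n g"
proof -
  let ?N = "CARD('a) ^ n - 1"
  have N0: "?N > 0" using card_pow_gt_1[OF assms, where 'a='a] by simp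
  have eq: "(M_lev n :: 'a alg_closure set) = {x. x ^ ?N = 1}" using M_lev_iff[OF assms] by blast
  obtain g :: "'a alg_closure" where g: "g ^ ?N = 1" "\<And>k. g ^ k = 1 \<Longrightarrow> ?N dvd k"
    using roots_of_unity_cyclic[OF N0, where 'b="'a alg_closure"]
      card_M_lev(2)[OF assms, where 'a='a] unfolding eq by blast
  have "g ^ k = 1" if "?N dvd k" for k using that g(1) by (auto simp: power_mult)
  thus ?thesis using g eq unfolding M_generator_def by blast
qed

lemma M_generator_powers:
  fixes g :: "'a::{finite,field} alg_closure"
  assumes "n > 0" and g: "M_generator n g" and x: "x \<in> M_lev n"
  obtains i where "i < CARD('a) ^ n - 1" and "x = g ^ i"
proof -
  let ?N = "CARD('a) ^ n - 1"
  have N0: "?N > 0" using card_pow_gt_1[OF assms(1), where 'a='a] by simp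
  have inj: "inj_on (\<lambda>i. g ^ i) {..<?N}"
    using power_eq_power_iff_of_order[of g ?N] g N0 unfolding M_generator_def
    by (intro inj_onI) (metis lessThan_iff mod_less)
  have "(\<lambda>i. g ^ i) ` {..<?N} \<subseteq> M_lev n"
    using g power_in_M_lev unfolding M_generator_def by blast
  moreover have "card ((\<lambda>i. g ^ i) ` {..<?N}) = card (M_lev n :: 'a alg_closure set)"
    unfolding card_image[OF inj] card_M_lev(2)[OF assms(1)] by simp
  ultimately have "(\<lambda>i. g ^ i) ` {..<?N} = M_lev n"
    using card_M_lev(1)[OF assms(1)] by (metis card_subset_eq)
  thus ?thesis using x that by auto
qed

section \<open>Characters of \<open>M_lev n\<close> and their orthogonality\<close>

lemma M_chars_mult: "\<xi> \<in> M_chars n \<Longrightarrow> x \<in> M_lev n \<Longrightarrow> y \<in> M_lev n \<Longrightarrow> \<xi> (x * y) = \<xi> x * \<xi> y"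
  by (simp add: M_chars_def)

lemma M_chars_nz: "\<xi> \<in> M_chars n \<Longrightarrow> x \<in> M_lev n \<Longrightarrow> \<xi> x \<noteq> 0"
  by (simp add: M_chars_def)

lemma M_chars_outside: "\<xi> \<in> M_chars n \<Longrightarrow> x \<notin> M_lev n \<Longrightarrow> \<xi> x = 0"
  by (simp add: M_chars_def)

lemma M_chars_one: "\<xi> \<in> M_chars n \<Longrightarrow> \<xi> 1 = 1"
  using M_chars_mult[of \<xi> n 1 1] M_chars_nz[of \<xi> n 1] by (simp add: one_in_M_lev)

lemma M_chars_power: "\<xi> \<in> M_chars n \<Longrightarrow> x \<in> M_lev n \<Longrightarrow> \<xi> (x ^ k) = \<xi> x ^ k"
  by (induct k) (auto simp: M_chars_one M_chars_mult power_in_M_lev)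

lemma M_chars_root_of_unity:
  fixes \<xi> :: "'a::{finite,field} alg_closure \<Rightarrow> complex"
  assumes "n > 0" "\<xi> \<in> M_chars n" "x \<in> M_lev n"
  shows "\<xi> x ^ (CARD('a) ^ n - 1) = 1"
  using assms by (metis M_chars_one M_chars_power M_lev_power_eq_1)

lemma M_chars_cnj:
  fixes \<xi> :: "'a::{finite,field} alg_closure \<Rightarrow> complex"
  assumes "n > 0" "\<xi> \<in> M_chars n" "x \<in> M_lev n"
  shows "\<xi> x * cnj (\<xi> x) = 1"
proof -
  have "norm (\<xi> x) ^ (CARD('a) ^ n - 1) = 1"
    using M_chars_root_of_unity[OF assms] by (metis norm_one norm_power)
  hence "norm (\<xi> x) = 1"
    using card_pow_gt_1[OF assms(1), where 'a='a]
    using power_eq_1_iff[of "norm (\<xi> x)" "CARD('a) ^ n - 1"] by simp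
  thus ?thesis by (simp add: complex_norm_square[symmetric] flip: complex_norm_square)
qed

lemma M_chars_eqI:
  fixes g :: "'a::{finite,field} alg_closure"
  assumes "n > 0" "M_generator n g" "\<xi> \<in> M_chars n" "\<eta> \<in> M_chars n" "\<xi> g = \<eta> g"
  shows "\<xi> = \<eta>"
proof
  fix x
  show "\<xi> x = \<eta> x"
  proof (cases "x \<in> M_lev n")
    case True
    then obtain i where "x = g ^ i" using M_generator_powers[OF assms(1,2)] by blast
    thus ?thesis using assms by (simp add: M_chars_power M_generator_def)
  qed (use assms M_chars_outside in metis)
qed

lemma M_chars_exists:
  fixes g :: "'a::{finite,field} alg_closure"
  assumes n: "n > 0" and g: "M_generator n g" and c: "c ^ (CARD('a) ^ n - 1) = 1"
  shows "\<exists>\<xi>\<in>M_chars n. \<xi> g = c"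
proof -
  let ?N = "CARD('a) ^ n - 1"
  have N0: "?N > 0" using card_pow_gt_1[OF n, where 'a='a] by simp
  have c0: "c \<noteq> 0" using c N0 by (auto simp: power_0_left)
  have red: "c ^ i = c ^ (i mod ?N)" for i
  proof -
    have "c ^ i = c ^ (?N * (i div ?N) + i mod ?N)" by (simp only: mult_div_mod_eq)
    thus ?thesis by (simp only: power_add power_mult c power_one mult_1)
  qed
  have wd: "c ^ i = c ^ j" if "g ^ i = g ^ j" for i j
  proof -
    have "i mod ?N = j mod ?N"
      using power_eq_power_iff_of_order[of g ?N i j] g N0 that unfolding M_generator_def by blast
    thus ?thesis using red[of i] red[of j] by argo
  qed
  define \<xi> where "\<xi> x = (if x \<in> M_lev n then c ^ (SOME i. x = g ^ i) else 0)" for x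
  have gM: "g ^ i \<in> M_lev n" for i using g power_in_M_lev unfolding M_generator_def by blast
  have \<xi>g: "\<xi> (g ^ i) = c ^ i" for i
  proof -
    have "g ^ i = g ^ (SOME j. g ^ i = g ^ j)" by (rule someI) simp
    from wd[OF this] show ?thesis using gM by (simp add: \<xi>_def)
  qed
  have "\<xi> \<in> M_chars n"
    unfolding M_chars_def
  proof (intro CollectI conjI ballI allI impI)
    fix x :: "'a alg_closure"
    assume x: "x \<in> M_lev n"
    thus "\<xi> x \<noteq> 0" using c0 by (simp add: \<xi>_def)
    fix y :: "'a alg_closure"
    assume y: "y \<in> M_lev n"
    obtain i j where "x = g ^ i" "y = g ^ j" using M_generator_powers[OF n g] x y by metis
    thus "\<xi> (x * y) = \<xi> x * \<xi> y" by (simp add: \<xi>g flip: power_add)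
  next
    fix x :: "'a alg_closure"
    assume "x \<notin> M_lev n"
    thus "\<xi> x = 0" by (simp add: \<xi>_def)
  qed
  moreover have "\<xi> g = c" using \<xi>g[of 1] by simp
  ultimately show ?thesis by blast
qed

lemma card_M_chars:
  assumes n: "n > 0"
  shows "finite (M_chars n :: ('a::{finite,field} alg_closure \<Rightarrow> complex) set)"
    and "card (M_chars n :: ('a alg_closure \<Rightarrow> complex) set) = CARD('a) ^ n - 1"
proof -
  let ?N = "CARD('a) ^ n - 1"
  have N0: "?N > 0" using card_pow_gt_1[OF n, where 'a='a] by simp
  obtain g :: "'a alg_closure" where g: "M_generator n g" using M_generator_exists[OF n] by blast
  have gM: "g \<in> M_lev n" using g by (simp add: M_generator_def)
  have "inj_on (\<lambda>\<xi>. \<xi> g) (M_chars n)" using M_chars_eqI[OF n g] by (rule inj_onI)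
  moreover have "(\<lambda>\<xi>. \<xi> g) ` M_chars n = {c :: complex. c ^ ?N = 1}"
    using M_chars_exists[OF n g] M_chars_root_of_unity[OF n _ gM] by blast
  ultimately have "bij_betw (\<lambda>\<xi>. \<xi> g) (M_chars n) {c. c ^ ?N = 1}"
    by (simp add: bij_betw_def)
  moreover have "finite {c :: complex. c ^ ?N = 1}" by (rule finite_card_roots_of_unity_le(1)[OF N0])
  moreover have "card {c :: complex. c ^ ?N = 1} = ?N"
    using N0 by (intro card_roots_of_unity_alg_closed) (metis less_irrefl of_nat_eq_0_iff)
  ultimately show "finite (M_chars n :: ('a alg_closure \<Rightarrow> complex) set)"
      "card (M_chars n :: ('a alg_closure \<Rightarrow> complex) set) = ?N"
    using bij_betw_finite bij_betw_same_card by metis+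
qed

lemma mult_M_chars: "\<xi> \<in> M_chars n \<Longrightarrow> \<eta> \<in> M_chars n \<Longrightarrow> (\<lambda>x. \<xi> x * \<eta> x) \<in> M_chars n"
  by (simp add: M_chars_def)

text \<open>A character that is nontrivial at \<open>x\<close> exists by cyclicity, and multiplication by it permutes
\<open>M_chars n\<close>. Outside \<open>M_lev n\<close> all the extended characters vanish.\<close>

lemma sum_cnj_M_chars:
  fixes x :: "'a::{finite,field} alg_closure"
  assumes n: "n > 0"
  shows "(\<Sum>\<xi>\<in>M_chars n. cnj (\<xi> x)) = (if x = 1 then of_nat (CARD('a) ^ n - 1) else 0)"
proof (cases "x = 1")
  case True
  hence "(\<Sum>\<xi>\<in>M_chars n. cnj (\<xi> x)) = (\<Sum>\<xi>\<in>(M_chars n :: ('a alg_closure \<Rightarrow> complex) set). 1)"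
    by (intro sum.cong) (auto simp: M_chars_one)
  thus ?thesis using True card_M_chars(2)[OF n, where 'a='a] by simp
next
  case False
  show ?thesis
  proof (cases "x \<in> M_lev n")
    case out: False
    thus ?thesis using False by (simp add: M_chars_outside)
  next
    case True
    let ?N = "CARD('a) ^ n - 1"
    have N0: "?N > 0" using card_pow_gt_1[OF n, where 'a='a] by simp
    obtain g :: "'a alg_closure" where g: "M_generator n g" using M_generator_exists[OF n] by blast
    obtain i where i: "i < ?N" "x = g ^ i" using M_generator_powers[OF n g True] by blast
    have "card {c :: complex. c ^ ?N = 1} = ?N"
      using N0 by (intro card_roots_of_unity_alg_closed) (metis less_irrefl of_nat_eq_0_iff)
    then obtain w :: complex where w: "w ^ ?N = 1" "\<And>k. w ^ k = 1 \<Longrightarrow> ?N dvd k"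
      using roots_of_unity_cyclic[OF N0, where 'b=complex] by blast
    obtain \<eta> where \<eta>: "\<eta> \<in> M_chars n" "\<eta> g = w" using M_chars_exists[OF n g w(1)] by blast
    have gM: "g \<in> M_lev n" using g by (simp add: M_generator_def)
    have "i \<noteq> 0" using False i by (metis power_0)
    hence "\<not> ?N dvd i" using i(1) nat_dvd_not_less by blast
    hence "\<eta> x \<noteq> 1" using w(2)[of i] i \<eta> gM by (auto simp: M_chars_power)
    let ?S = "\<Sum>\<xi>\<in>M_chars n. cnj (\<xi> x)"
    have bij: "bij_betw (\<lambda>\<xi> x. \<eta> x * \<xi> x) (M_chars n) (M_chars n)"
    proof -
      have inj: "inj_on (\<lambda>\<xi> x. \<eta> x * \<xi> x) (M_chars n)"
      proof (rule inj_onI)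
        fix \<xi> \<zeta> assume h: "\<xi> \<in> M_chars n" "\<zeta> \<in> M_chars n"
          and "(\<lambda>x. \<eta> x * \<xi> x) = (\<lambda>x. \<eta> x * \<zeta> x)"
        hence "\<eta> g * \<xi> g = \<eta> g * \<zeta> g" by meson
        hence "\<xi> g = \<zeta> g" using M_chars_nz[OF \<eta>(1) gM] by simp
        thus "\<xi> = \<zeta>" using M_chars_eqI[OF n g h] by blast
      qed
      moreover have "(\<lambda>\<xi> x. \<eta> x * \<xi> x) ` M_chars n \<subseteq> M_chars n"
        using mult_M_chars[OF \<eta>(1)] by auto
      ultimately show ?thesis
        using card_M_chars(1)[OF n, where 'a='a]
        by (simp add: bij_betw_def endo_inj_surj)
    qed
    have "?S = (\<Sum>\<xi>\<in>M_chars n. cnj (\<eta> x * \<xi> x))"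
      by (rule sum.reindex_bij_betw[OF bij, symmetric])
    also have "\<dots> = cnj (\<eta> x) * ?S" by (simp add: sum_distrib_left)
    finally have "(1 - cnj (\<eta> x)) * ?S = 0" by (simp add: algebra_simps)
    moreover have "1 - cnj (\<eta> x) \<noteq> 0" using \<open>\<eta> x \<noteq> 1\<close>
      by (metis complex_cnj_cancel_iff complex_cnj_one eq_iff_diff_eq_0)
    ultimately show ?thesis using False by simp
  qed
qed

text \<open>Translation by an element at which the two characters differ multiplies the sum by a number other than
\<open>1\<close>.\<close>

lemma sum_M_lev_chars:
  fixes \<xi> \<eta> :: "'a::{finite,field} alg_closure \<Rightarrow> complex"
  assumes n: "n > 0" and \<xi>: "\<xi> \<in> M_chars n" and \<eta>: "\<eta> \<in> M_chars n"
  shows "(\<Sum>x\<in>M_lev n. \<eta> x * cnj (\<xi> x)) = (if \<xi> = \<eta> then of_nat (CARD('a) ^ n - 1) else 0)"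
proof (cases "\<xi> = \<eta>")
  case True
  hence "(\<Sum>x\<in>M_lev n. \<eta> x * cnj (\<xi> x)) = (\<Sum>x\<in>(M_lev n :: 'a alg_closure set). 1)"
    using \<xi> by (intro sum.cong) (auto simp: M_chars_cnj[OF n])
  thus ?thesis using True card_M_lev(2)[OF n, where 'a='a] by simp
next
  case False
  then obtain y where y: "\<eta> y \<noteq> \<xi> y" by (metis ext)
  hence yM: "y \<in> M_lev n" using M_chars_outside \<xi> \<eta> by metis
  let ?S = "\<Sum>x\<in>M_lev n. \<eta> x * cnj (\<xi> x)"
  have y0: "y \<noteq> 0" using yM by (simp add: M_lev_def)
  have bij: "bij_betw (\<lambda>x. y * x) (M_lev n) (M_lev n)"
  proof -
    have inj: "inj_on (\<lambda>x. y * x) (M_lev n)" using y0 by (intro inj_onI) simp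
    moreover have "(\<lambda>x. y * x) ` M_lev n \<subseteq> M_lev n" using mult_in_M_lev[OF yM] by auto
    ultimately show ?thesis using card_M_lev(1)[OF n, where 'a='a]
      by (simp add: bij_betw_def endo_inj_surj)
  qed
  have "?S = (\<Sum>x\<in>M_lev n. \<eta> (y * x) * cnj (\<xi> (y * x)))"
    by (rule sum.reindex_bij_betw[OF bij, symmetric])
  also have "\<dots> = (\<Sum>x\<in>M_lev n. (\<eta> y * cnj (\<xi> y)) * (\<eta> x * cnj (\<xi> x)))"
    by (intro sum.cong refl) (simp add: M_chars_mult[OF \<xi> yM] M_chars_mult[OF \<eta> yM])
  also have "\<dots> = (\<eta> y * cnj (\<xi> y)) * ?S" by (simp add: sum_distrib_left)
  finally have "(1 - \<eta> y * cnj (\<xi> y)) * ?S = 0" by (simp add: algebra_simps)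
  moreover have "\<eta> y * cnj (\<xi> y) \<noteq> 1"
  proof
    assume "\<eta> y * cnj (\<xi> y) = 1"
    hence "\<eta> y * (\<xi> y * cnj (\<xi> y)) = \<xi> y" by (simp add: algebra_simps)
    thus False using M_chars_cnj[OF n \<xi> yM] y by simp
  qed
  ultimately show ?thesis using False by simp
qed

section \<open>Inflation of characters along norm maps\<close>

text \<open>On \<open>M_lev n\<close> the norm to \<open>M_lev m\<close> is the power map with exponent
\<open>(q^n - 1) / (q^m - 1)\<close>, by the geometric series.\<close>

lemma field_norm_power:
  fixes x :: "'a::{finite,field} alg_closure"
  assumes "m dvd n" "m > 0"
  obtains e where "e * (CARD('a) ^ m - 1) = CARD('a) ^ n - 1"
    and "\<And>x :: 'a alg_closure. field_norm n m x = x ^ e"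
proof
  let ?Q = "CARD('a) ^ m"
  let ?e = "\<Sum>i<n div m. ?Q ^ i"
  obtain k where k: "n = m * k" using assms(1) by blast
  have km: "n div m = k" using k assms by simp
  have Q: "?Q > 1" by (rule card_pow_gt_1[OF assms(2)])
  have tel: "(\<Sum>i<k. ?Q ^ i) * (?Q - 1) + 1 = ?Q ^ k"
  proof (induct k)
    case (Suc k)
    have "(\<Sum>i<Suc k. ?Q ^ i) * (?Q - 1) + 1 = ((\<Sum>i<k. ?Q ^ i) * (?Q - 1) + 1) + ?Q ^ k * (?Q - 1)"
      by (simp add: algebra_simps)
    also have "\<dots> = ?Q ^ k * (1 + (?Q - 1))" by (simp only: Suc) (simp only: distrib_left mult_1_right)
    also have "1 + (?Q - 1) = ?Q" using Q by linarith
    finally show ?case by (simp add: mult.commute)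
  qed simp
  show "?e * (?Q - 1) = CARD('a) ^ n - 1" unfolding km using tel by (simp only: k power_mult)
  show "field_norm n m x = x ^ ?e" for x :: "'a alg_closure"
    by (simp add: field_norm_def power_sum power_mult)
qed

text \<open>This is surjectivity of the norm, the reason why inflation is injective.\<close>

lemma M_generator_norm:
  fixes g :: "'a::{finite,field} alg_closure"
  assumes "m dvd n" "m > 0" "n > 0" "M_generator n g"
  shows "M_generator m (field_norm n m g)"
proof -
  obtain e where e: "e * (CARD('a) ^ m - 1) = CARD('a) ^ n - 1"
      "\<And>x :: 'a alg_closure. field_norm n m x = x ^ e"
    using field_norm_power[OF assms(1,2)] by blast
  have e0: "e \<noteq> 0" using e(1) card_pow_gt_1[OF assms(3), where 'a='a] by (cases e) auto
  have "(CARD('a) ^ n - 1) dvd e * k \<longleftrightarrow> (CARD('a) ^ m - 1) dvd k" for k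
    unfolding e(1)[symmetric] using e0 by (rule dvd_times_left_cancel_iff)
  moreover have "g ^ (e * k) = 1 \<longleftrightarrow> (CARD('a) ^ n - 1) dvd e * k" for k
    using assms(4) by (simp add: M_generator_def)
  ultimately have "(field_norm n m g) ^ k = 1 \<longleftrightarrow> (CARD('a) ^ m - 1) dvd k" for k
    by (simp only: e(2) power_mult[symmetric])
  moreover have "field_norm n m g \<in> M_lev m"
    using field_norm_in[OF assms(1,2,3), of g] assms(4) by (simp add: M_generator_def)
  ultimately show ?thesis by (simp add: M_generator_def)
qed

lemma inflate_in:
  assumes "m dvd n" "m > 0" "n > 0" "\<xi> \<in> M_chars m"
  shows "inflate m n \<xi> \<in> M_chars n"
proof -
  have mult: "field_norm n m (x * y) = field_norm n m x * field_norm n m y" for x y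
    by (simp add: field_norm_def power_mult_distrib prod.distrib)
  show ?thesis
    using assms(4) field_norm_in[OF assms(1-3)]
    by (auto simp: M_chars_def inflate_def mult mult_in_M_lev)
qed

lemma inflate_inj:
  fixes \<xi> \<eta> :: "'a::{finite,field} alg_closure \<Rightarrow> complex"
  assumes "m dvd n" "m > 0" "n > 0" "\<xi> \<in> M_chars m" "\<eta> \<in> M_chars m"
    and eq: "inflate m n \<xi> = inflate m n \<eta>"
  shows "\<xi> = \<eta>"
proof -
  obtain g :: "'a alg_closure" where g: "M_generator n g" using M_generator_exists[OF assms(3)] by blast
  have "\<xi> (field_norm n m g) = \<eta> (field_norm n m g)"
    using fun_cong[OF eq, of g] g by (simp add: inflate_def M_generator_def)
  thus ?thesis using M_chars_eqI[OF assms(2) M_generator_norm[OF assms(1-3) g] assms(4,5)] by blast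
qed

text \<open>At a generator, a character fixed by the \<open>m\<close>-th Frobenius power takes as value a root of unity of
order dividing \<open>q^m - 1\<close>, and so there is a character of level \<open>m\<close> with this value at the
norm of that generator.\<close>

lemma inflate_surj_on_fixed:
  fixes \<xi> :: "'a::{finite,field} alg_closure \<Rightarrow> complex"
  assumes "m dvd n" "m > 0" "n > 0" "\<xi> \<in> M_chars n" and inv: "(\<lambda>x. \<xi> x ^ (CARD('a) ^ m)) = \<xi>"
  obtains \<eta> where "\<eta> \<in> M_chars m" "inflate m n \<eta> = \<xi>"
proof -
  obtain g :: "'a alg_closure" where g: "M_generator n g" using M_generator_exists[OF assms(3)] by blast
  have gM: "g \<in> M_lev n" using g by (simp add: M_generator_def)
  have "\<xi> g ^ (CARD('a) ^ m) = \<xi> g" using fun_cong[OF inv, of g] by simp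
  moreover have "CARD('a) ^ m = Suc (CARD('a) ^ m - 1)"
    using card_pow_gt_1[OF assms(2), where 'a='a] by simp
  ultimately have "\<xi> g * \<xi> g ^ (CARD('a) ^ m - 1) = \<xi> g * 1" by (metis mult_1_right power_Suc)
  hence "\<xi> g ^ (CARD('a) ^ m - 1) = 1" using M_chars_nz[OF assms(4) gM] by simp
  then obtain \<eta> where \<eta>: "\<eta> \<in> M_chars m" "\<eta> (field_norm n m g) = \<xi> g"
    using M_chars_exists[OF assms(2) M_generator_norm[OF assms(1-3) g]] by blast
  have "inflate m n \<eta> = \<xi>"
    by (rule M_chars_eqI[OF assms(3) g inflate_in[OF assms(1-3) \<eta>(1)] assms(4)])
      (simp add: inflate_def gM \<eta>(2))
  thus ?thesis using \<eta>(1) that by blast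
qed

section \<open>Frobenius orbits in the direct limit\<close>

text \<open>The orbit of a periodic point is listed without repetition by the first \<open>d\<close> iterates, where
\<open>d\<close> is the least period.\<close>

lemma orbit_of_periodic:
  fixes f :: "'b \<Rightarrow> 'b"
  assumes n: "n > 0" and per: "(f ^^ n) x = x"
  defines "O' \<equiv> \<lambda>y. range (\<lambda>k. (f ^^ k) y)"
  shows "finite (O' x)" and "card (O' x) > 0" and "(f ^^ k) x = x \<longleftrightarrow> card (O' x) dvd k"
    and "y \<in> O' x \<Longrightarrow> O' y = O' x"
proof -
  define d where "d = (LEAST d. d > 0 \<and> (f ^^ d) x = x)"
  have d: "d > 0" "(f ^^ d) x = x"
    using LeastI[of "\<lambda>d. d > 0 \<and> (f ^^ d) x = x" n] n per unfolding d_def by auto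
  have least: "d \<le> k" if "k > 0" "(f ^^ k) x = x" for k
    unfolding d_def using that by (intro Least_le) auto
  have mult: "(f ^^ (d * j)) x = x" for j
    by (induct j) (auto simp: funpow_add d(2))
  have red: "(f ^^ k) x = (f ^^ (k mod d)) x" for k
  proof -
    have "(f ^^ k) x = (f ^^ (k mod d + d * (k div d))) x" by (simp only: mod_mult_div_eq)
    thus ?thesis by (simp only: funpow_add o_apply mult)
  qed
  have inj: "inj_on (\<lambda>k. (f ^^ k) x) {..<d}"
  proof -
    have "i = j" if h: "i \<le> j" "j < d" "(f ^^ i) x = (f ^^ j) x" for i j
    proof -
      have "(f ^^ (d - j + i)) x = (f ^^ (d - j + j)) x"
        by (simp only: funpow_add o_apply h(3))
      hence "(f ^^ (d - j + i)) x = x" using h(2) d(2) by simp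
      hence "d \<le> d - j + i" using least h by simp
      thus ?thesis using h by simp
    qed
    thus ?thesis by (intro inj_onI) (metis lessThan_iff nle_le)
  qed
  have orb: "O' x = (\<lambda>k. (f ^^ k) x) ` {..<d}"
  proof
    show "O' x \<subseteq> (\<lambda>k. (f ^^ k) x) ` {..<d}"
    proof
      fix y assume "y \<in> O' x"
      then obtain k where "y = (f ^^ k) x" by (auto simp: O'_def)
      hence "y = (f ^^ (k mod d)) x" using red by simp
      thus "y \<in> (\<lambda>k. (f ^^ k) x) ` {..<d}" using d(1) by auto
    qed
  qed (auto simp: O'_def)
  hence card: "card (O' x) = d" by (simp add: card_image[OF inj])
  show "finite (O' x)" "card (O' x) > 0" using orb card d(1) by auto
  show "(f ^^ k) x = x \<longleftrightarrow> card (O' x) dvd k"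
  proof
    assume "(f ^^ k) x = x"
    hence "(f ^^ (k mod d)) x = x" using red[of k] by simp
    hence "k mod d = 0" using least[of "k mod d"] mod_less_divisor[OF d(1), of k] by linarith
    thus "card (O' x) dvd k" by (simp add: card mod_0_imp_dvd)
  next
    assume "card (O' x) dvd k" thus "(f ^^ k) x = x" using mult card by auto
  qed
  assume "y \<in> O' x"
  then obtain k where k: "y = (f ^^ k) x" by (auto simp: O'_def)
  have "k \<le> d * k" using d(1) by simp
  hence ret: "(f ^^ (d * k - k)) y = x"
    using mult[of k] unfolding k by (metis comp_apply funpow_add le_add_diff_inverse2)
  show "O' y = O' x"
  proof
    show "O' y \<subseteq> O' x"
    proof
      fix z assume "z \<in> O' y"
      then obtain j where "z = (f ^^ j) y" by (auto simp: O'_def)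
      hence "z = (f ^^ (j + k)) x" by (simp add: k funpow_add)
      thus "z \<in> O' x" by (auto simp: O'_def)
    qed
    show "O' x \<subseteq> O' y"
    proof
      fix z assume "z \<in> O' x"
      then obtain j where "z = (f ^^ j) x" by (auto simp: O'_def)
      hence "z = (f ^^ (j + (d * k - k))) y" using ret by (simp add: funpow_add)
      thus "z \<in> O' y" by (auto simp: O'_def)
    qed
  qed
qed

abbreviation star_of :: "nat \<Rightarrow> ('a::{finite,field} alg_closure \<Rightarrow> complex) \<Rightarrow> 'a M_star" where
  "star_of n \<xi> \<equiv> abs_M_star (n, \<xi>)"

lemma M_star_rel_refl: "n > 0 \<Longrightarrow> \<xi> \<in> M_chars n \<Longrightarrow> M_star_rel (n, \<xi>) (n, \<xi>)"
  by (auto simp: M_star_rel_def)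

lemma star_of_eq_iff:
  assumes "m > 0" "n > 0" "\<xi> \<in> M_chars m" "\<eta> \<in> M_chars n"
  shows "star_of m \<xi> = star_of n \<eta> \<longleftrightarrow> (\<exists>N>0. m dvd N \<and> n dvd N \<and> inflate m N \<xi> = inflate n N \<eta>)"
proof -
  have "star_of m \<xi> = star_of n \<eta> \<longleftrightarrow> M_star_rel (m, \<xi>) (n, \<eta>)"
    using Quotient_rel[OF Quotient_M_star, of "(m, \<xi>)" "(n, \<eta>)"]
      M_star_rel_refl[OF assms(1,3)] M_star_rel_refl[OF assms(2,4)] by blast
  thus ?thesis using assms by (auto simp: M_star_rel_def)
qed

text \<open>Injectivity of inflation embeds each level into the limit.\<close>

lemma star_of_inj:
  assumes "n > 0" "\<xi> \<in> M_chars n" "\<eta> \<in> M_chars n" "star_of n \<xi> = star_of n \<eta>"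
  shows "\<xi> = \<eta>"
proof -
  obtain N where "N > 0" "n dvd N" "inflate n N \<xi> = inflate n N \<eta>"
    using star_of_eq_iff[OF assms(1,1,2,3)] assms(4) by blast
  thus ?thesis using inflate_inj[OF _ assms(1) _ assms(2,3)] by blast
qed

lemma star_of_cases:
  obtains n \<xi> where "n > 0" "\<xi> \<in> M_chars n" "x = star_of n \<xi>"
proof -
  obtain n \<xi> where r: "rep_M_star x = (n, \<xi>)" by fastforce
  have "M_star_rel (n, \<xi>) (n, \<xi>)" using Quotient_rep_reflp[OF Quotient_M_star, of x] r by simp
  moreover have "x = star_of n \<xi>" using Quotient_abs_rep[OF Quotient_M_star, of x] r by simp
  ultimately show ?thesis using that by (auto simp: M_star_rel_def)
qed

lemma star_of_inflate:
  assumes "m dvd n" "m > 0" "n > 0" "\<xi> \<in> M_chars m"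
  shows "star_of n (inflate m n \<xi>) = star_of m \<xi>"
proof -
  have "inflate n n (inflate m n \<xi>) = inflate m n \<xi>"
    using inflate_trans[OF assms(1) dvd_refl assms(2,3,3)] .
  thus ?thesis using star_of_eq_iff[OF assms(3,2) inflate_in[OF assms] assms(4)] assms by auto
qed

lemma power_M_chars: "\<xi> \<in> M_chars n \<Longrightarrow> (\<lambda>x. \<xi> x ^ k) \<in> M_chars n"
  if "k > 0" for k using that by (auto simp: M_chars_def power_mult_distrib)

lemma frob_star_funpow:
  fixes \<xi> :: "'a::{finite,field} alg_closure \<Rightarrow> complex"
  assumes "n > 0" "\<xi> \<in> M_chars n"
  shows "(frob_star ^^ k) (star_of n \<xi>) = star_of n (\<lambda>x. \<xi> x ^ (CARD('a) ^ k))"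
proof (induct k)
  case (Suc k)
  have c: "CARD('a) ^ k > 0" by simp
  have "frob_star (star_of n (\<lambda>x. \<xi> x ^ (CARD('a) ^ k))) = star_of n (\<lambda>x. (\<xi> x ^ (CARD('a) ^ k)) ^ CARD('a))"
    using frob_star.abs_eq[OF M_star_rel_refl[OF assms(1) power_M_chars[OF c assms(2)]]] by simp
  thus ?case by (simp add: Suc mult.commute flip: power_mult)
qed simp

lemma M_chars_frob_periodic:
  fixes \<xi> :: "'a::{finite,field} alg_closure \<Rightarrow> complex"
  assumes "n > 0" "\<xi> \<in> M_chars n"
  shows "(\<lambda>x. \<xi> x ^ (CARD('a) ^ n)) = \<xi>"
proof
  fix x show "\<xi> x ^ (CARD('a) ^ n) = \<xi> x"
  proof (cases "x \<in> M_lev n")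
    case True
    hence "\<xi> (x ^ (CARD('a) ^ n)) = \<xi> x" by (simp add: M_lev_def)
    thus ?thesis using M_chars_power[OF assms(2) True] by simp
  next
    case False
    thus ?thesis using assms(2) by (simp add: M_chars_outside)
  qed
qed

lemma frob_star_periodic:
  assumes "n > 0" "\<xi> \<in> M_chars n"
  shows "(frob_star ^^ n) (star_of n \<xi>) = star_of n \<xi>"
  by (simp add: frob_star_funpow[OF assms] M_chars_frob_periodic[OF assms])

lemma Rep_orbit_star: "Rep_Phi_star (orbit_star x) = range (\<lambda>k. (frob_star ^^ k) x)"
  unfolding orbit_star_def by (rule Abs_Phi_star_inverse) blast

lemma orbit_star_cases: obtains x where "\<phi> = orbit_star x"
proof -
  obtain x where "Rep_Phi_star \<phi> = range (\<lambda>k. (frob_star ^^ k) x)"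
    using Rep_Phi_star[of \<phi>] by blast
  hence "Rep_Phi_star \<phi> = Rep_Phi_star (orbit_star x)" by (simp only: Rep_orbit_star)
  thus ?thesis using that by (simp only: Rep_Phi_star_inject)
qed

lemma orbit_star_props:
  fixes x :: "'a::{finite,field} M_star"
  shows "size_star (orbit_star x) > 0"
    and "finite (Rep_Phi_star (orbit_star x))"
    and "(frob_star ^^ k) x = x \<longleftrightarrow> size_star (orbit_star x) dvd k"
    and "y \<in> Rep_Phi_star (orbit_star x) \<Longrightarrow> orbit_star y = orbit_star x"
proof -
  obtain n \<xi> where n: "n > 0" "\<xi> \<in> M_chars n" "x = star_of n \<xi>" by (rule star_of_cases)
  have per: "(frob_star ^^ n) x = x" using frob_star_periodic[OF n(1,2)] n(3) by simp
  note o = orbit_of_periodic[OF n(1) per]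
  show "size_star (orbit_star x) > 0" using o(2) by (simp add: size_star_def Rep_orbit_star)
  show "finite (Rep_Phi_star (orbit_star x))" using o(1) by (simp add: Rep_orbit_star)
  show "(frob_star ^^ k) x = x \<longleftrightarrow> size_star (orbit_star x) dvd k"
    using o(3) by (simp add: size_star_def Rep_orbit_star)
  show "orbit_star y = orbit_star x" if "y \<in> Rep_Phi_star (orbit_star x)"
    using o(4)[of y] that unfolding Rep_orbit_star by (simp add: orbit_star_def)
qed

lemma size_star_pos: "size_star \<phi> > 0"
  by (rule orbit_star_cases[of \<phi>]) (simp add: orbit_star_props(1))

lemma size_star_dvd:
  assumes "n > 0" "\<xi> \<in> M_chars n"
  shows "size_star (orbit_star (star_of n \<xi>)) dvd n"
  using frob_star_periodic[OF assms] orbit_star_props(3) by blast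

text \<open>Every element of the orbit \<open>\<phi>\<close> is fixed by Frobenius to the power
\<open>size_star \<phi>\<close>, so it descends to that level and inflates to level \<open>n\<close>. Thus the
whole orbit is represented by characters of level \<open>n\<close>, each element by exactly one. This is the
multiplicity \<open>|\<phi>|\<close> in the formula for \<open>p_n(f1)\<close>.\<close>

lemma orbit_star_fibre:
  fixes \<phi> :: "'a::{finite,field} Phi_star"
  assumes n: "n > 0" and dvd: "size_star \<phi> dvd n"
  shows "card {\<xi> \<in> M_chars n. orbit_star (star_of n \<xi>) = \<phi>} = size_star \<phi>"
proof -
  obtain x where x: "\<phi> = orbit_star x" by (rule orbit_star_cases)
  obtain m \<zeta> where m: "m > 0" "\<zeta> \<in> M_chars m" "x = star_of m \<zeta>" by (rule star_of_cases)
  define d where "d = size_star \<phi>"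
  have d0: "d > 0" unfolding d_def by (rule size_star_pos)
  have dm: "d dvd m" unfolding d_def x m(3) by (rule size_star_dvd[OF m(1,2)])
  have fx: "(frob_star ^^ d) x = x" using orbit_star_props(3)[of d x] by (simp add: d_def x)
  have "(\<lambda>y. \<zeta> y ^ (CARD('a) ^ d)) = \<zeta>"
  proof (rule star_of_inj[OF m(1) _ m(2)])
    show "(\<lambda>y. \<zeta> y ^ (CARD('a) ^ d)) \<in> M_chars m" by (rule power_M_chars[OF _ m(2)]) simp
    show "star_of m (\<lambda>y. \<zeta> y ^ (CARD('a) ^ d)) = star_of m \<zeta>"
      using fx frob_star_funpow[OF m(1,2), of d] m(3) by simp
  qed
  then obtain \<eta> where \<eta>: "\<eta> \<in> M_chars d" "inflate d m \<eta> = \<zeta>"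
    using inflate_surj_on_fixed[OF dm d0 m(1,2)] by blast
  have x\<eta>: "x = star_of d \<eta>" using star_of_inflate[OF dm d0 m(1) \<eta>(1)] \<eta>(2) m(3) by simp
  have dn: "d dvd n" using dvd by (simp add: d_def)
  define \<xi>0 where "\<xi>0 = inflate d n \<eta>"
  have \<xi>0: "\<xi>0 \<in> M_chars n" unfolding \<xi>0_def by (rule inflate_in[OF dn d0 n \<eta>(1)])
  have x0: "x = star_of n \<xi>0" unfolding \<xi>0_def x\<eta> by (rule star_of_inflate[OF dn d0 n \<eta>(1), symmetric])
  let ?S = "{\<xi> \<in> M_chars n. orbit_star (star_of n \<xi>) = \<phi>}"
  have self: "y \<in> Rep_Phi_star (orbit_star y)" for y :: "'a M_star"
    unfolding Rep_orbit_star by (rule range_eqI[of _ _ 0]) simp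
  have inj: "inj_on (star_of n) ?S" using star_of_inj[OF n] by (intro inj_onI) blast
  have img: "star_of n ` ?S = Rep_Phi_star \<phi>"
  proof
    show "star_of n ` ?S \<subseteq> Rep_Phi_star \<phi>" using self by auto
    show "Rep_Phi_star \<phi> \<subseteq> star_of n ` ?S"
    proof
      fix y assume y: "y \<in> Rep_Phi_star \<phi>"
      then obtain k where k: "y = (frob_star ^^ k) x" by (auto simp: x Rep_orbit_star)
      define \<xi> where "\<xi> = (\<lambda>z. \<xi>0 z ^ (CARD('a) ^ k))"
      have "\<xi> \<in> M_chars n" unfolding \<xi>_def by (rule power_M_chars[OF _ \<xi>0]) simp
      moreover have "y = star_of n \<xi>"
        unfolding k x0 \<xi>_def by (rule frob_star_funpow[OF n \<xi>0])
      moreover have "orbit_star y = \<phi>" using orbit_star_props(4)[of y x] y x by simp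
      ultimately show "y \<in> star_of n ` ?S" by blast
    qed
  qed
  have "card ?S = card (star_of n ` ?S)" by (rule card_image[OF inj, symmetric])
  thus ?thesis by (simp only: img size_star_def)
qed

lemma finite_size_star_dvd:
  assumes n: "n > 0"
  shows "finite {\<phi> :: 'a::{finite,field} Phi_star. size_star \<phi> dvd n}"
proof (rule finite_subset)
  show "{\<phi> :: 'a Phi_star. size_star \<phi> dvd n} \<subseteq> (\<lambda>\<xi>. orbit_star (star_of n \<xi>)) ` M_chars n"
  proof
    fix \<phi> :: "'a Phi_star" assume "\<phi> \<in> {\<phi>. size_star \<phi> dvd n}"
    hence "card {\<xi> \<in> M_chars n. orbit_star (star_of n \<xi>) = \<phi>} > 0"
      using orbit_star_fibre[OF n, of \<phi>] size_star_pos[of \<phi>] by simp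
    hence "{\<xi> \<in> M_chars n. orbit_star (star_of n \<xi>) = \<phi>} \<noteq> {}" by force
    thus "\<phi> \<in> (\<lambda>\<xi>. orbit_star (star_of n \<xi>)) ` M_chars n" by blast
  qed
  show "finite ((\<lambda>\<xi>. orbit_star (star_of n \<xi>)) ` (M_chars n :: ('a alg_closure \<Rightarrow> complex) set))"
    using card_M_chars(1)[OF n] by blast
qed

section \<open>The polynomial algebra and its derivations\<close>

lemma lookup_FG_scale [simp]: "Poly_Mapping.lookup (FG_scale c F) m = c * Poly_Mapping.lookup F m"
  by (simp add: FG_scale_def flip: mult_map_scale_conv_mult) (simp add: Poly_Mapping.map.rep_eq when_def)

lemma FG_scale_add_right: "FG_scale c (F + G) = FG_scale c F + FG_scale c G"
  by (simp add: FG_scale_def distrib_left)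
lemma FG_scale_add_left: "FG_scale (a + b) F = FG_scale a F + FG_scale b F"
  by (simp add: FG_scale_def distrib_right single_add)
lemma FG_scale_minus_right: "FG_scale c (- F) = - FG_scale c F"
  by (simp add: FG_scale_def)
lemma FG_scale_diff_right: "FG_scale c (F - G) = FG_scale c F - FG_scale c G"
  by (simp add: FG_scale_def right_diff_distrib)
lemma FG_scale_zero_right [simp]: "FG_scale c 0 = 0"
  by (simp add: FG_scale_def)
lemma FG_scale_zero_left [simp]: "FG_scale 0 F = 0"
  by (simp add: FG_scale_def)
lemma FG_scale_one [simp]: "FG_scale 1 F = F"
  by (simp add: FG_scale_def)
lemma FG_scale_scale [simp]: "FG_scale a (FG_scale b F) = FG_scale (a * b) F"
  by (simp add: FG_scale_def mult_single flip: mult.assoc)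
lemma FG_scale_mult_left: "FG_scale c F * G = FG_scale c (F * G)"
  by (simp add: FG_scale_def mult_ac)
lemma FG_scale_mult_right: "F * FG_scale c G = FG_scale c (F * G)"
  by (simp add: FG_scale_def mult_ac)
lemma FG_scale_sum: "FG_scale c (sum f A) = (\<Sum>x\<in>A. FG_scale c (f x))"
  by (simp add: FG_scale_def sum_distrib_left)
lemma FG_scale_sum_left: "FG_scale (sum f A) F = (\<Sum>x\<in>A. FG_scale (f x) F)"
  by (induct A rule: infinite_finite_induct) (auto simp: FG_scale_add_left)
lemma FG_scale_uminus: "FG_scale (- c) F = - FG_scale c F"
  by (metis FG_scale_add_left FG_scale_zero_left add.right_inverse neg_eq_iff_add_eq_0 add_eq_0_iff)
lemma of_nat_mult_FG: "of_nat n * F = FG_scale (of_nat n) F"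
  by (simp add: FG_scale_def)
lemma FG_scale_cancel: "c \<noteq> 0 \<Longrightarrow> FG_scale c F = FG_scale c G \<Longrightarrow> F = G"
  by (metis FG_scale_one FG_scale_scale left_inverse)

lemma p_star_mult_single:
  "p_star k \<phi> * Poly_Mapping.single m c = Poly_Mapping.single (m + Poly_Mapping.single (\<phi>, k - 1) 1) c"
  by (simp add: p_star_def mult_single add.commute)

lemma FG_single_induct:
  assumes "P 0" and "\<And>F G. P F \<Longrightarrow> P G \<Longrightarrow> P (F + G)" and "\<And>m c. P (Poly_Mapping.single m c)"
  shows "P (F :: 'b \<Rightarrow>\<^sub>0 'c::ab_group_add)"
proof (induct F rule: update_induct)
  case const
  show ?case by (rule assms(1))
next
  case (update f a b)
  have "Poly_Mapping.update a b f = f + Poly_Mapping.single a b"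
    using update(1) by (intro poly_mapping_eqI)
      (auto simp: lookup_update lookup_add lookup_single in_keys_iff when_def)
  thus ?case using assms update by simp
qed

text \<open>As an algebra \<open>'a FG\<close> is generated by the \<open>p_star k \<phi>\<close>, so multiplication by a
generator is the only product to consider. This form of induction suits operators whose commutators with generators
are known.\<close>

lemma FG_induct:
  assumes const: "\<And>c. P (FG_scale c 1)"
    and add: "\<And>F G. P F \<Longrightarrow> P G \<Longrightarrow> P (F + G)"
    and mult: "\<And>k \<phi> F. k \<ge> 1 \<Longrightarrow> P F \<Longrightarrow> P (p_star k \<phi> * F)"
  shows "P (F :: 'a::{finite,field} FG)"
proof (rule FG_single_induct)
  show "P 0" using const[of 0] by simp
  show "P (F + G)" if "P F" "P G" for F G using add that .
  fix m :: "'a Phi_star \<times> nat \<Rightarrow>\<^sub>0 nat" and c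
  show "P (Poly_Mapping.single m c)"
  proof (induct m rule: update_induct)
    case const
    show ?case using assms(1)[of c] by (simp add: FG_scale_def)
  next
    case (update f a b)
    obtain \<phi> k where a: "a = (\<phi>, k)" by force
    have "P (Poly_Mapping.single (f + Poly_Mapping.single a v) c)" for v
    proof (induct v)
      case 0 show ?case using update by simp
    next
      case (Suc v)
      have "Poly_Mapping.single (f + Poly_Mapping.single a (Suc v)) c
          = p_star (Suc k) \<phi> * Poly_Mapping.single (f + Poly_Mapping.single a v) c"
        unfolding p_star_mult_single a
        by (simp add: add.assoc flip: single_add)
      thus ?case using mult[of "Suc k"] Suc by simp
    qed
    moreover have "Poly_Mapping.update a b f = f + Poly_Mapping.single a b"
      using update(1) by (intro poly_mapping_eqI)
        (auto simp: lookup_update lookup_add lookup_single in_keys_iff when_def)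
    ultimately show ?case by simp
  qed
qed

definition FG_linear :: "('a::{finite,field} FG \<Rightarrow> 'a FG) \<Rightarrow> bool" where
  "FG_linear T \<longleftrightarrow> (\<forall>F G. T (F + G) = T F + T G) \<and> (\<forall>c F. T (FG_scale c F) = FG_scale c (T F))"

lemma FG_linearI:
  "(\<And>F G. T (F + G) = T F + T G) \<Longrightarrow> (\<And>c F. T (FG_scale c F) = FG_scale c (T F)) \<Longrightarrow> FG_linear T"
  by (simp add: FG_linear_def)

context
  fixes T :: "'a::{finite,field} FG \<Rightarrow> 'a FG"
  assumes T: "FG_linear T"
begin
lemma FG_linear_add: "T (F + G) = T F + T G" using T by (simp add: FG_linear_def)
lemma FG_linear_scale: "T (FG_scale c F) = FG_scale c (T F)" using T by (simp add: FG_linear_def)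
lemma FG_linear_0: "T 0 = 0" using FG_linear_scale[of 0 0] by simp
lemma FG_linear_minus: "T (- F) = - T F"
  using FG_linear_scale[of "-1" F] by (simp add: FG_scale_uminus)
lemma FG_linear_sum: "T (sum f A) = (\<Sum>x\<in>A. T (f x))"
  by (induct A rule: infinite_finite_induct) (auto simp: FG_linear_0 FG_linear_add)
end

text \<open>The derivative with respect to the indeterminate \<open>i\<close>, given by its coefficients: the monomial
\<open>m\<close> of the derivative comes from the monomial of \<open>F\<close> with one more factor
\<open>i\<close>.\<close>

definition FG_pd :: "'a::{finite,field} Phi_star \<times> nat \<Rightarrow> 'a FG \<Rightarrow> 'a FG" where
  "FG_pd i F = Abs_poly_mapping (\<lambda>m. of_nat (Poly_Mapping.lookup m i + 1)
     * Poly_Mapping.lookup F (m + Poly_Mapping.single i 1))"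

lemma lookup_FG_pd: "Poly_Mapping.lookup (FG_pd i F) m
    = of_nat (Poly_Mapping.lookup m i + 1) * Poly_Mapping.lookup F (m + Poly_Mapping.single i 1)"
proof -
  have "{m. of_nat (Poly_Mapping.lookup m i + 1) * Poly_Mapping.lookup F (m + Poly_Mapping.single i 1) \<noteq> 0}
      \<subseteq> (\<lambda>m. m + Poly_Mapping.single i 1) -` Poly_Mapping.keys F"
    by (auto simp: in_keys_iff)
  moreover have "finite \<dots>" by (rule finite_vimageI) (auto intro: injI)
  ultimately have "finite {m. of_nat (Poly_Mapping.lookup m i + 1) * Poly_Mapping.lookup F (m + Poly_Mapping.single i 1) \<noteq> 0}"
    by (rule finite_subset)
  thus ?thesis unfolding FG_pd_def by (subst lookup_Abs_poly_mapping) auto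
qed

lemma FG_pd_linear: "FG_linear (FG_pd i)"
  by (rule FG_linearI; rule poly_mapping_eqI) (simp_all add: lookup_FG_pd lookup_add distrib_left mult_ac)

lemma FG_pd_single: "FG_pd i (Poly_Mapping.single m c)
    = Poly_Mapping.single (m - Poly_Mapping.single i 1) (of_nat (Poly_Mapping.lookup m i) * c)"
proof (rule poly_mapping_eqI)
  fix m'
  show "Poly_Mapping.lookup (FG_pd i (Poly_Mapping.single m c)) m'
      = Poly_Mapping.lookup (Poly_Mapping.single (m - Poly_Mapping.single i 1) (of_nat (Poly_Mapping.lookup m i) * c)) m'"
  proof (cases "Poly_Mapping.lookup m i = 0")
    case True
    hence "m \<noteq> m' + Poly_Mapping.single i 1" by (auto simp: lookup_add)
    thus ?thesis using True by (simp add: lookup_FG_pd lookup_single when_def)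
  next
    case False
    hence m: "m = (m - Poly_Mapping.single i 1) + Poly_Mapping.single i 1"
      by (intro poly_mapping_eqI) (auto simp: lookup_add lookup_minus lookup_single when_def)
    have "m = m' + Poly_Mapping.single i 1 \<longleftrightarrow> m - Poly_Mapping.single i 1 = m'"
      by (subst m) (metis add_right_cancel)
    moreover have "complex_of_nat (Poly_Mapping.lookup m i) = of_nat (Poly_Mapping.lookup m' i + 1)"
      if "m = m' + Poly_Mapping.single i 1" unfolding that by (simp add: lookup_add)
    ultimately show ?thesis unfolding lookup_FG_pd lookup_single when_def by simp
  qed
qed

lemma FG_pd_p_star_mult:
  assumes "k \<ge> 1"
  shows "FG_pd (\<psi>, l) (p_star k \<phi> * F) = p_star k \<phi> * FG_pd (\<psi>, l) F + (if (\<phi>, k - 1) = (\<psi>, l) then F else 0)"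
proof (induct F rule: FG_single_induct)
  case 1 show ?case by (simp add: FG_linear_0[OF FG_pd_linear])
next
  case (2 F G) thus ?case by (simp add: distrib_left FG_linear_add[OF FG_pd_linear])
next
  case (3 m c)
  let ?e = "Poly_Mapping.single (\<phi>, k - 1) 1 :: 'a Phi_star \<times> nat \<Rightarrow>\<^sub>0 nat"
  let ?i = "Poly_Mapping.single (\<psi>, l) 1 :: 'a Phi_star \<times> nat \<Rightarrow>\<^sub>0 nat"
  have "m + ?e - ?i = m - ?i + ?e" if "Poly_Mapping.lookup m (\<psi>, l) \<noteq> 0"
    using that by (intro poly_mapping_eqI) (auto simp: lookup_add lookup_minus lookup_single when_def)
  thus ?case
    by (cases "Poly_Mapping.lookup m (\<psi>, l) = 0")
      (auto simp: p_star_mult_single FG_pd_single lookup_add lookup_single when_def distrib_right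
         add.commute simp flip: single_add)
qed

lemma FG_pd_const: "FG_pd i (FG_scale c 1) = 0"
  using FG_pd_single[of i 0 c] by (simp add: FG_scale_def)

lemma FG_pd_1 [simp]: "FG_pd i 1 = 0"
  using FG_pd_const[of i 1] by simp

lemma FG_pd_p_star: "k \<ge> 1 \<Longrightarrow> FG_pd (\<psi>, l) (p_star k \<phi>) = (if (\<phi>, k - 1) = (\<psi>, l) then 1 else 0)"
  using FG_pd_p_star_mult[of k \<psi> l \<phi> 1] by simp

lemma FG_pd_derivation: "FG_derivation (FG_pd i)"
proof -
  obtain \<psi> l where i: "i = (\<psi>, l)" by force
  have "FG_pd i (F * G) = FG_pd i F * G + F * FG_pd i G" for F G
  proof (induct F rule: FG_induct)
    case (1 c) show ?case
      by (simp add: FG_pd_const FG_scale_mult_left FG_linear_scale[OF FG_pd_linear])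
  next
    case (2 F F') thus ?case by (simp add: distrib_right FG_linear_add[OF FG_pd_linear])
  next
    case (3 k \<phi> F)
    thus ?case unfolding i
      by (simp only: mult.assoc FG_pd_p_star_mult) (simp add: algebra_simps)
  qed
  thus ?thesis using FG_pd_linear[of i] by (simp add: FG_derivation_def FG_linear_def)
qed

lemma FG_derivation_linear: "FG_derivation D \<Longrightarrow> FG_linear D"
  by (simp add: FG_derivation_def FG_linear_def)

lemma FG_derivation_mult: "FG_derivation D \<Longrightarrow> D (F * G) = D F * G + F * D G"
  by (simp add: FG_derivation_def)

lemma FG_derivation_1: "FG_derivation D \<Longrightarrow> D 1 = 0"
  using FG_derivation_mult[of D 1 1] by simp

text \<open>This provides the uniqueness half of the characterisation by which \<open>FG_partial\<close> is defined.\<close>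

lemma FG_derivation_eqI:
  assumes D: "FG_derivation D" and D': "FG_derivation D'"
    and eq: "\<And>k \<phi>. k \<ge> 1 \<Longrightarrow> D (p_star k \<phi>) = D' (p_star k \<phi>)"
  shows "D = D'"
proof
  note l = FG_derivation_linear[OF D] FG_derivation_linear[OF D']
  fix F show "D F = D' F"
  proof (induct F rule: FG_induct)
    case (1 c) show ?case
      by (simp add: FG_linear_scale[OF l(1)] FG_linear_scale[OF l(2)] FG_derivation_1[OF D] FG_derivation_1[OF D'])
  next
    case (2 F G) thus ?case by (simp add: FG_linear_add[OF l(1)] FG_linear_add[OF l(2)])
  next
    case (3 k \<phi> F) thus ?case
      by (simp add: FG_derivation_mult[OF D] FG_derivation_mult[OF D'] eq)
  qed
qed

lemma FG_partial_eqI: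
  assumes "FG_derivation D" "\<And>j. j \<in> I \<Longrightarrow> D (g j) = (if j = i then 1 else 0)"
    and "\<And>D'. FG_derivation D' \<Longrightarrow> (\<And>j. j \<in> I \<Longrightarrow> D' (g j) = (if j = i then 1 else 0)) \<Longrightarrow> D' = D"
  shows "FG_partial g I i = D"
  unfolding FG_partial_def
proof (rule the_equality)
  show "FG_derivation D \<and> (\<forall>j\<in>I. D (g j) = (if j = i then 1 else 0))" using assms(1,2) by blast
  fix D' assume "FG_derivation D' \<and> (\<forall>j\<in>I. D' (g j) = (if j = i then 1 else 0))"
  thus "D' = D" by (intro assms(3)) blast+
qed

lemma d_star_eq_FG_pd:
  assumes "n \<ge> 1"
  shows "d_star n \<phi> = FG_pd (\<phi>, n - 1)"
  unfolding d_star_def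
proof (rule FG_partial_eqI)
  show "FG_derivation (FG_pd (\<phi>, n - 1))" by (rule FG_pd_derivation)
  show eq: "FG_pd (\<phi>, n - 1) (case j of (k, \<psi>) \<Rightarrow> p_star k \<psi>) = (if j = (n, \<phi>) then 1 else 0)"
    if "j \<in> {(k, \<psi>). k \<ge> 1}" for j
    using that assms by (auto simp: FG_pd_p_star split: if_splits)
  show "D' = FG_pd (\<phi>, n - 1)" if D': "FG_derivation D'"
    and v: "\<And>j. j \<in> {(k, \<psi>). k \<ge> 1} \<Longrightarrow> D' (case j of (k, \<psi>) \<Rightarrow> p_star k \<psi>) = (if j = (n, \<phi>) then 1 else 0)" for D'
  proof (rule FG_derivation_eqI[OF D' FG_pd_derivation])
    fix k \<psi> assume "k \<ge> (1::nat)"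
    thus "D' (p_star k \<psi>) = FG_pd (\<phi>, n - 1) (p_star k \<psi>)"
      using v[of "(k, \<psi>)"] eq[of "(k, \<psi>)"] by simp
  qed
qed

lemma FG_pd_commute: "FG_pd i (FG_pd j F) = FG_pd j (FG_pd i F)"
  by (rule poly_mapping_eqI) (auto simp: lookup_FG_pd lookup_add lookup_single when_def add_ac)

section \<open>The inner product\<close>

lemma FG_inner_superset:
  assumes "finite A" "Poly_Mapping.keys F \<subseteq> A"
  shows "FG_inner F G = (\<Sum>m\<in>A. Poly_Mapping.lookup F m * cnj (Poly_Mapping.lookup G m) * of_nat (z_mono m))"
  unfolding FG_inner_def using assms
  by (intro sum.mono_neutral_left) (auto simp: in_keys_iff)

lemma FG_inner_add_left: "FG_inner (F + F') G = FG_inner F G + FG_inner F' G"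
proof -
  let ?A = "Poly_Mapping.keys F \<union> Poly_Mapping.keys F'"
  have "FG_inner H G = (\<Sum>m\<in>?A. Poly_Mapping.lookup H m * cnj (Poly_Mapping.lookup G m) * of_nat (z_mono m))"
    if "H \<in> {F, F', F + F'}" for H
    using that keys_add[of F F'] by (intro FG_inner_superset) auto
  thus ?thesis by (simp add: lookup_add distrib_right sum.distrib)
qed

lemma FG_inner_scale_left: "FG_inner (FG_scale c F) G = c * FG_inner F G"
proof -
  have "Poly_Mapping.keys (FG_scale c F) \<subseteq> Poly_Mapping.keys F" by (auto simp: in_keys_iff)
  thus ?thesis using FG_inner_superset[of "Poly_Mapping.keys F" "FG_scale c F" G]
    by (simp add: FG_inner_def sum_distrib_left mult_ac)
qed

lemma FG_inner_zero_left [simp]: "FG_inner 0 G = 0"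
  by (simp add: FG_inner_def)

lemma FG_inner_sum_left: "FG_inner (sum f A) G = (\<Sum>x\<in>A. FG_inner (f x) G)"
  by (induct A rule: infinite_finite_induct) (auto simp: FG_inner_add_left)

lemma FG_inner_cnj: "FG_inner G F = cnj (FG_inner F G)"
proof -
  let ?A = "Poly_Mapping.keys F \<union> Poly_Mapping.keys G"
  show ?thesis
    using FG_inner_superset[of ?A F G] FG_inner_superset[of ?A G F] by (simp add: mult_ac)
qed

lemma FG_inner_sum_right: "FG_inner F (sum f A) = (\<Sum>x\<in>A. FG_inner F (f x))"
  by (subst FG_inner_cnj) (simp add: FG_inner_sum_left FG_inner_cnj[of F])

lemma FG_inner_scale_right: "FG_inner F (FG_scale c G) = cnj c * FG_inner F G"
  by (subst FG_inner_cnj) (simp add: FG_inner_scale_left FG_inner_cnj[of F])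

lemma z_mono_superset:
  assumes "finite A" "Poly_Mapping.keys m \<subseteq> A"
  shows "z_mono m = (\<Prod>(\<phi>, k)\<in>A. (k + 1) ^ Poly_Mapping.lookup m (\<phi>, k) * fact (Poly_Mapping.lookup m (\<phi>, k)))"
  unfolding z_mono_def using assms
  by (intro prod.mono_neutral_left) (auto simp: in_keys_iff)

text \<open>One more factor \<open>p_(k+1)(\<phi>)\<close> turns \<open>m_i\<close> into \<open>m_i + 1\<close> in
\<open>\<Prod> i^(m_i) m_i!\<close>.\<close>

lemma z_mono_add_single:
  "z_mono (m + Poly_Mapping.single (\<phi>, k) 1) = (k + 1) * (Poly_Mapping.lookup m (\<phi>, k) + 1) * z_mono m"
proof -
  let ?A = "insert (\<phi>, k) (Poly_Mapping.keys m)"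
  let ?f = "\<lambda>m :: ('a Phi_star \<times> nat) \<Rightarrow>\<^sub>0 nat. \<lambda>(\<phi>, k). (k + 1) ^ Poly_Mapping.lookup m (\<phi>, k) * fact (Poly_Mapping.lookup m (\<phi>, k)) :: nat"
  have "z_mono (m + Poly_Mapping.single (\<phi>, k) 1) = prod (?f (m + Poly_Mapping.single (\<phi>, k) 1)) ?A"
    using keys_add[of m "Poly_Mapping.single (\<phi>, k) 1"] by (intro z_mono_superset) (auto split: if_splits)
  also have "\<dots> = ?f (m + Poly_Mapping.single (\<phi>, k) 1) (\<phi>, k) * prod (?f (m + Poly_Mapping.single (\<phi>, k) 1)) (?A - {(\<phi>, k)})"
    by (rule prod.remove) auto
  also have "prod (?f (m + Poly_Mapping.single (\<phi>, k) 1)) (?A - {(\<phi>, k)}) = prod (?f m) (?A - {(\<phi>, k)})"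
    by (intro prod.cong) (auto simp: lookup_add lookup_single when_def split: if_splits)
  also have "?f (m + Poly_Mapping.single (\<phi>, k) 1) (\<phi>, k) = (k + 1) * (Poly_Mapping.lookup m (\<phi>, k) + 1) * ?f m (\<phi>, k)"
    by (simp add: lookup_add algebra_simps)
  also have "\<dots> * prod (?f m) (?A - {(\<phi>, k)}) = (k + 1) * (Poly_Mapping.lookup m (\<phi>, k) + 1) * prod (?f m) ?A"
    by (simp only: prod.remove[of ?A "(\<phi>, k)" "?f m", OF _ insertI1] finite_insert finite_keys mult.assoc)
  also have "prod (?f m) ?A = z_mono m" by (rule z_mono_superset[symmetric]) auto
  finally show ?thesis .
qed

lemma FG_inner_single: "FG_inner (Poly_Mapping.single m c) G = c * cnj (Poly_Mapping.lookup G m) * of_nat (z_mono m)"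
  using FG_inner_superset[of "{m}" "Poly_Mapping.single m c" G] by (simp add: keys_single)

text \<open>On monomials, the growth of \<open>z_mono\<close> under an additional factor accounts for \<open>k\<close> and for
the exponent that the derivative produces.\<close>

lemma FG_inner_p_star_mult:
  assumes "k \<ge> 1"
  shows "FG_inner (p_star k \<phi> * F) G = FG_inner F (FG_scale (of_nat k) (FG_pd (\<phi>, k - 1) G))"
proof (induct F rule: FG_single_induct)
  case (2 F F') thus ?case by (simp add: distrib_left FG_inner_add_left)
next
  case (3 m c)
  have k: "k - 1 + 1 = k" using assms by simp
  show ?case unfolding p_star_mult_single FG_inner_single lookup_FG_scale lookup_FG_pd z_mono_add_single k
    by (simp add: algebra_simps)
qed simp

section \<open>The generators and derivatives attached to \<open>f1\<close>\<close>

text \<open>Both sums range over the colours whose size divides \<open>n\<close>. For \<open>n = 0\<close> their values are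
junk; all exponentials below start at \<open>n = 1\<close>.\<close>

definition f1_deriv :: "nat \<Rightarrow> 'a::{finite,field} FG \<Rightarrow> 'a FG" where
  "f1_deriv n F = (\<Sum>\<phi>\<in>{\<phi>. size_star \<phi> dvd n}. FG_pd (\<phi>, n div size_star \<phi> - 1) F)"

definition f1_sum :: "nat \<Rightarrow> 'a::{finite,field} FG" where
  "f1_sum n = FG_scale (1 / of_nat n)
     (\<Sum>\<phi>\<in>{\<phi>. size_star \<phi> dvd n}. FG_scale (of_nat (size_star \<phi>)) (p_star (n div size_star \<phi>) \<phi>))"

lemma finite_field_power_card:
  fixes a :: "'a::{finite,field}"
  shows "a ^ CARD('a) = a"
proof (cases "a = 0")
  case False
  let ?U = "UNIV - {0} :: 'a set"
  have bij: "bij_betw (\<lambda>y. a * y) ?U ?U"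
    by (rule bij_betwI[where g = "\<lambda>y. y / a"]) (use False in auto)
  have "\<Prod>?U = (\<Prod>y\<in>?U. a * y)" by (rule prod.reindex_bij_betw[OF bij, symmetric])
  also have "\<dots> = a ^ card ?U * \<Prod>?U" by (simp add: prod.distrib)
  finally have one: "a ^ card ?U = 1" by simp
  have "CARD('a) = Suc (card ?U)" by (simp add: card_Diff_singleton card_gt_0_iff)
  hence "a ^ CARD('a) = a * a ^ card ?U" by (simp only: power_Suc)
  thus ?thesis by (simp only: one mult_1_right)
qed (simp add: power_0_left)

lemma degree_prod_linear:
  assumes "finite A"
  shows "degree (\<Prod>a\<in>A. [:- f a, 1:] :: 'b::field poly) = card A"
    and "lead_coeff (\<Prod>a\<in>A. [:- f a, 1:] :: 'b::field poly) = 1"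
proof -
  show l: "lead_coeff (\<Prod>a\<in>A. [:- f a, 1:] :: 'b poly) = 1" for A
    by (simp add: lead_coeff_prod)
  show "degree (\<Prod>a\<in>A. [:- f a, 1:] :: 'b poly) = card A"
    using assms by (subst degree_prod_eq_sum_degree) auto
qed

text \<open>Both sides are monic polynomials in \<open>z\<close> of the same degree that vanish on the base field, so their
difference would, if nonzero, have more roots than its degree.\<close>

lemma power_card_diff_self:
  fixes z :: "'a::{finite,field} alg_closure"
  shows "z ^ CARD('a) - z = (\<Prod>a\<in>(UNIV :: 'a set). z - to_ac a)"
proof -
  let ?q = "CARD('a)"
  let ?R = "(\<Prod>a\<in>(UNIV :: 'a set). [:- to_ac a, 1:])"
  define p where "p = monom 1 ?q - monom 1 1 - ?R"
  have q: "?q > 1" by (rule card_gt_1)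
  note R = degree_prod_linear[OF finite, of to_ac "UNIV :: 'a set"]
  have "p = 0"
  proof (rule ccontr)
    assume p0: "p \<noteq> 0"
    have "coeff p ?q = 0" using q R by (simp add: p_def)
    moreover have "degree p \<le> ?q" unfolding p_def
      using q R by (intro degree_diff_le) (auto simp: degree_monom_eq)
    ultimately have deg: "degree p < ?q"
      using p0 by (metis leading_coeff_0_iff le_neq_implies_less)
    have "range to_ac \<subseteq> {z. poly p z = 0}"
    proof safe
      fix a :: 'a
      have "to_ac a ^ ?q = to_ac a" by (simp add: finite_field_power_card flip: to_ac_power)
      moreover have "poly ?R (to_ac a) = 0" by (simp add: poly_prod)
      ultimately show "poly p (to_ac a) = 0" by (simp add: p_def poly_monom)
    qed
    hence "card (range (to_ac :: 'a \<Rightarrow> _)) \<le> card {z. poly p z = 0}"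
      by (rule card_mono[OF poly_roots_finite[OF p0]])
    also have "\<dots> \<le> degree p" by (rule card_poly_roots_bound[OF p0])
    finally show False using deg by (simp add: card_image inj_to_ac)
  qed
  hence "poly p z = 0" by simp
  thus ?thesis by (simp add: p_def poly_monom poly_prod)
qed

text \<open>The product formula for \<open>z^q - z\<close> is invariant under \<open>z \<mapsto> z - 1\<close>, since the base
field is; hence \<open>(z - 1)^q = z^q - 1\<close>. This is used to see that only the orbit \<open>f1\<close>
contains \<open>1\<close>.\<close>

lemma frobenius_eq_1:
  fixes z :: "'a::{finite,field} alg_closure"
  assumes "z ^ CARD('a) ^ k = 1"
  shows "z = 1"
  using assms
proof (induct k arbitrary: z)
  case (Suc k)
  have step: "z = 1" if "z ^ CARD('a) = 1" for z :: "'a alg_closure"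
  proof -
    have bij: "bij_betw (\<lambda>a. a + 1) (UNIV :: 'a set) UNIV"
      by (rule bij_betwI[where g = "\<lambda>a. a - 1"]) auto
    have "(z - 1) ^ CARD('a) - (z - 1) = (\<Prod>a\<in>(UNIV :: 'a set). z - to_ac (a + 1))"
      unfolding power_card_diff_self by (simp add: algebra_simps)
    also have "\<dots> = (\<Prod>a\<in>(UNIV :: 'a set). z - to_ac a)"
      by (rule prod.reindex_bij_betw[OF bij])
    also have "\<dots> = z ^ CARD('a) - z" by (rule power_card_diff_self[symmetric])
    finally have "(z - 1) ^ CARD('a) = 0" using that by simp
    thus ?thesis by simp
  qed
  have "(z ^ CARD('a)) ^ CARD('a) ^ k = 1" using Suc(2) by (simp flip: power_mult)
  thus ?case using Suc(1) step by blast
qed simp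

lemma size_Phi_f1: "size_Phi f1 = 1"
  by (simp add: size_Phi_def Rep_f1)

lemma Phi_eq_f1:
  assumes "1 \<in> Rep_Phi (f :: 'a::{finite,field} Phi)"
  shows "f = f1"
proof -
  obtain x where x: "Rep_Phi f = range (\<lambda>k. x ^ (CARD('a) ^ k))"
    using Rep_Phi[of f] by blast
  then obtain k where "x ^ (CARD('a) ^ k) = 1" using assms by auto
  hence "x = 1" by (rule frobenius_eq_1)
  hence "Rep_Phi f = {1}" using x by auto
  thus ?thesis using Rep_f1 Rep_Phi_inject by metis
qed

lemma root_in_Rep_Phi: "(SOME x. x \<in> Rep_Phi f) \<in> Rep_Phi (f :: 'a::{finite,field} Phi)"
proof -
  obtain x where "Rep_Phi f = range (\<lambda>k. x ^ (CARD('a) ^ k))" using Rep_Phi[of f] by blast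
  hence "x ^ (CARD('a) ^ 0) \<in> Rep_Phi f" by blast
  thus ?thesis by (rule someI)
qed

text \<open>At \<open>x = 1\<close> all characters take the value \<open>1\<close>, and each orbit \<open>\<phi>\<close> is hit
by \<open>size_star \<phi>\<close> characters.\<close>

lemma p_Phi_f1:
  assumes n: "n \<ge> 1"
  shows "(p_Phi n f1 :: 'a::{finite,field} FG)
    = FG_scale ((-1) ^ (n - 1) * of_nat n / (of_nat CARD('a) ^ n - 1)) (f1_sum n)"
proof -
  let ?o = "\<lambda>\<xi>. orbit_star (star_of n \<xi>) :: 'a Phi_star"
  let ?T = "{\<phi> :: 'a Phi_star. size_star \<phi> dvd n}"
  have n0: "n > 0" using n by simp
  have "(\<Sum>\<xi>\<in>M_chars n. FG_scale (cnj (\<xi> 1)) (p_star (n div size_star (?o \<xi>)) (?o \<xi>)))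
      = (\<Sum>\<xi>\<in>M_chars n. p_star (n div size_star (?o \<xi>)) (?o \<xi>))"
    by (intro sum.cong refl) (simp add: M_chars_one)
  also have "\<dots> = (\<Sum>\<phi>\<in>?T. \<Sum>\<xi>\<in>{\<xi> \<in> M_chars n. ?o \<xi> = \<phi>}. p_star (n div size_star (?o \<xi>)) (?o \<xi>))"
    by (rule sum.group[symmetric])
      (use card_M_chars(1)[OF n0] finite_size_star_dvd[OF n0] size_star_dvd[OF n0] in auto)
  also have "\<dots> = (\<Sum>\<phi>\<in>?T. FG_scale (of_nat (size_star \<phi>)) (p_star (n div size_star \<phi>) \<phi>))"
  proof (intro sum.cong refl)
    fix \<phi> assume "\<phi> \<in> ?T"
    have "(\<Sum>\<xi>\<in>{\<xi> \<in> M_chars n. ?o \<xi> = \<phi>}. p_star (n div size_star (?o \<xi>)) (?o \<xi>))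
        = (\<Sum>\<xi>\<in>{\<xi> \<in> M_chars n. ?o \<xi> = \<phi>}. p_star (n div size_star \<phi>) \<phi>)"
      by (rule sum.cong) auto
    thus "(\<Sum>\<xi>\<in>{\<xi> \<in> M_chars n. ?o \<xi> = \<phi>}. p_star (n div size_star (?o \<xi>)) (?o \<xi>))
        = FG_scale (of_nat (size_star \<phi>)) (p_star (n div size_star \<phi>) \<phi>)"
      using orbit_star_fibre[OF n0, of \<phi>] \<open>\<phi> \<in> ?T\<close> by (simp add: of_nat_mult_FG)
  qed
  also have "\<dots> = FG_scale (of_nat n) (f1_sum n)" using n by (simp add: f1_sum_def)
  finally show ?thesis
    by (simp add: p_Phi_def size_Phi_f1 Rep_f1 Let_def)
qed

lemma f1_deriv_linear: "FG_linear (f1_deriv n)"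
  unfolding f1_deriv_def by (rule FG_linearI)
    (simp_all add: FG_linear_add[OF FG_pd_linear] FG_linear_scale[OF FG_pd_linear] sum.distrib FG_scale_sum)

lemma f1_deriv_derivation: "FG_derivation (\<lambda>F :: 'a::{finite,field} FG. FG_scale c (f1_deriv n F))"
proof -
  have "f1_deriv n (F * G) = f1_deriv n F * G + F * f1_deriv n G" for F G :: "'a FG"
    unfolding f1_deriv_def by (simp add: FG_derivation_mult[OF FG_pd_derivation] sum.distrib sum_distrib_left sum_distrib_right)
  thus ?thesis
    by (simp add: FG_derivation_def FG_linear_add[OF f1_deriv_linear] FG_linear_scale[OF f1_deriv_linear]
        FG_scale_add_right FG_scale_mult_left FG_scale_mult_right mult.commute)
qed

text \<open>The summand indexed by \<open>\<psi>\<close> detects \<open>p_k(\<phi>)\<close> only for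
\<open>\<psi> = \<phi>\<close> and \<open>n = k |\<phi>|\<close>; thus \<open>f1_deriv n\<close> is the derivation
with value \<open>1\<close> on all generators of degree \<open>n\<close> and \<open>0\<close> on the others.\<close>

lemma f1_deriv_p_star_mult:
  fixes \<phi> :: "'a::{finite,field} Phi_star"
  assumes n: "n \<ge> 1" and k: "k \<ge> 1"
  shows "f1_deriv n (p_star k \<phi> * F) = p_star k \<phi> * f1_deriv n F + (if k * size_star \<phi> = n then F else 0)"
proof -
  let ?T = "{\<psi> :: 'a Phi_star. size_star \<psi> dvd n}"
  have fin: "finite ?T" by (rule finite_size_star_dvd) (use n in simp)
  have eq: "(\<phi>, k - 1) = (\<psi>, n div size_star \<psi> - 1) \<longleftrightarrow> \<psi> = \<phi> \<and> k * size_star \<phi> = n" if \<psi>: "\<psi> \<in> ?T" for \<psi>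
  proof -
    obtain j where j: "n = size_star \<psi> * j" using \<psi> by blast
    have "j \<ge> 1" "n div size_star \<psi> = j" using j n size_star_pos[of \<psi>] by (auto simp: Suc_le_eq)
    thus ?thesis using j k size_star_pos[of \<psi>] by (auto simp: mult.commute)
  qed
  have "f1_deriv n (p_star k \<phi> * F) = (\<Sum>\<psi>\<in>?T. p_star k \<phi> * FG_pd (\<psi>, n div size_star \<psi> - 1) F
      + (if \<psi> = \<phi> \<and> k * size_star \<phi> = n then F else 0))"
    unfolding f1_deriv_def by (intro sum.cong refl) (simp only: FG_pd_p_star_mult[OF k] eq)
  also have "\<dots> = p_star k \<phi> * f1_deriv n F + (\<Sum>\<psi>\<in>?T. if \<psi> = \<phi> then (if k * size_star \<phi> = n then F else 0) else 0)"
    unfolding sum.distrib f1_deriv_def sum_distrib_left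
    by (intro arg_cong2[where f = "(+)"] sum.cong refl) auto
  also have "(\<Sum>\<psi>\<in>?T. if \<psi> = \<phi> then (if k * size_star \<phi> = n then F else 0) else 0) = (if k * size_star \<phi> = n then F else 0)"
    using fin by (auto simp: sum.delta)
  finally show ?thesis .
qed

lemma f1_deriv_1: "f1_deriv n 1 = 0"
  by (simp add: f1_deriv_def)

lemma f1_deriv_p_star: "n \<ge> 1 \<Longrightarrow> k \<ge> 1 \<Longrightarrow> f1_deriv n (p_star k \<phi>) = (if k * size_star \<phi> = n then 1 else 0)"
  using f1_deriv_p_star_mult[of n k \<phi> 1] by (simp add: f1_deriv_1)

text \<open>The generator of degree \<open>N\<close> attached to a character \<open>\<xi>\<close> of level \<open>N\<close>;
\<open>char_sum\<close> is the Fourier transform of these generators. The \<open>p_Phi n f\<close> are rescaled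
values of this transform.\<close>

abbreviation p_char :: "nat \<Rightarrow> ('a::{finite,field} alg_closure \<Rightarrow> complex) \<Rightarrow> 'a FG" where
  "p_char N \<xi> \<equiv> p_star (N div size_star (orbit_star (star_of N \<xi>))) (orbit_star (star_of N \<xi>))"

definition char_sum :: "nat \<Rightarrow> 'a::{finite,field} alg_closure \<Rightarrow> 'a FG" where
  "char_sum N x = (\<Sum>\<xi>\<in>M_chars N. FG_scale (cnj (\<xi> x))
     (p_char N \<xi>))"

lemma p_Phi_char_sum:
  "(p_Phi n f :: 'a::{finite,field} FG) = FG_scale ((-1) ^ (n * size_Phi f - 1) / (of_nat CARD('a) ^ (n * size_Phi f) - 1))
     (char_sum (n * size_Phi f) (SOME x. x \<in> Rep_Phi f))"
  by (simp add: p_Phi_def char_sum_def Let_def)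

lemma orbit_star_power:
  fixes \<xi> :: "'a::{finite,field} alg_closure \<Rightarrow> complex"
  assumes "N > 0" "\<xi> \<in> M_chars N"
  shows "orbit_star (star_of N (\<lambda>x. \<xi> x ^ (CARD('a) ^ j))) = orbit_star (star_of N \<xi>)"
  by (rule orbit_star_props(4)) (auto simp: Rep_orbit_star frob_star_funpow[OF assms])

text \<open>The generator \<open>p_char N \<xi>\<close> depends only on the Frobenius orbit of \<open>\<xi>\<close>, so the
Frobenius can be moved from \<open>x\<close> to \<open>\<xi>\<close>. Therefore the choice of the root in
\<open>p_Phi\<close> is immaterial.\<close>

lemma char_sum_frobenius:
  fixes x :: "'a::{finite,field} alg_closure"
  assumes N: "N > 0" and x: "x \<in> M_lev N"
  shows "char_sum N (x ^ (CARD('a) ^ j)) = char_sum N x"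
proof -
  let ?f = "\<lambda>\<xi> :: 'a alg_closure \<Rightarrow> complex. \<lambda>x. \<xi> x ^ (CARD('a) ^ j)"
  have "?f ` M_chars N \<subseteq> M_chars N" using power_M_chars[of "CARD('a) ^ j" _ N] by auto
  \<comment> \<open>The \<open>N\<close>-th power of the Frobenius is trivial at level \<open>N\<close>, so the power with exponent \<open>N j - j\<close> inverts the \<open>j\<close>-th.\<close>
  moreover have inj: "inj_on ?f (M_chars N)"
  proof (rule inj_on_inverseI[where g = "\<lambda>\<xi> x. \<xi> x ^ (CARD('a) ^ (N * j - j))"])
    fix \<xi> :: "'a alg_closure \<Rightarrow> complex" assume \<xi>: "\<xi> \<in> M_chars N"
    have "(\<lambda>x. \<xi> x ^ (CARD('a) ^ (N * m))) = \<xi>" for m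
    proof (induct m)
      case (Suc m)
      have "(\<lambda>x. \<xi> x ^ (CARD('a) ^ (N * Suc m))) = (\<lambda>x. (\<xi> x ^ (CARD('a) ^ (N * m))) ^ (CARD('a) ^ N))"
        by (simp add: power_add mult.commute flip: power_mult)
      also have "\<dots> = (\<lambda>x. \<xi> x ^ (CARD('a) ^ N))" using fun_cong[OF Suc] by simp
      finally show ?case by (simp only: M_chars_frob_periodic[OF N \<xi>])
    qed simp
    moreover have "j \<le> N * j" using N by simp
    ultimately show "(\<lambda>x. (?f \<xi>) x ^ (CARD('a) ^ (N * j - j))) = \<xi>"
      by (simp flip: power_mult power_add)
  qed
  ultimately have bij: "bij_betw ?f (M_chars N) (M_chars N)"
    using card_M_chars(1)[OF N, where 'a='a] by (simp add: bij_betw_def endo_inj_surj)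
  let ?G = "\<lambda>\<xi>. FG_scale (cnj (\<xi> x)) (p_char N \<xi>)"
  have "char_sum N (x ^ (CARD('a) ^ j)) = (\<Sum>\<xi>\<in>M_chars N. ?G (?f \<xi>))"
    unfolding char_sum_def
    by (intro sum.cong refl) (simp add: orbit_star_power[OF N] M_chars_power x)
  also have "\<dots> = char_sum N x"
    unfolding char_sum_def by (rule sum.reindex_bij_betw[OF bij])
  finally show ?thesis .
qed

text \<open>Each value of the Fourier transform is a multiple of some \<open>p_Phi k f\<close>, namely for the orbit
\<open>f\<close> of \<open>x\<close>.\<close>

lemma M_lev_orbit:
  fixes x :: "'a::{finite,field} alg_closure"
  assumes N: "N > 0" and x: "x \<in> M_lev N"
  obtains f k where "k \<ge> 1" "N = k * size_Phi f" "char_sum N (SOME x. x \<in> Rep_Phi f) = char_sum N x"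
proof -
  define f where "f = Abs_Phi (range (\<lambda>k. x ^ (CARD('a) ^ k)))"
  have x0: "x \<noteq> 0" and per: "x ^ (CARD('a) ^ N) = x" using x by (auto simp: M_lev_def)
  have R: "Rep_Phi f = range (\<lambda>k. x ^ (CARD('a) ^ k))"
    unfolding f_def using x0 by (intro Abs_Phi_inverse) blast
  have pow: "((\<lambda>y. y ^ CARD('a)) ^^ k) x = x ^ (CARD('a) ^ k)" for k
    by (induct k) (simp_all add: mult.commute flip: power_mult)
  have "size_Phi f dvd N"
    using orbit_of_periodic(3)[OF N, of "\<lambda>y. y ^ CARD('a)" x N] per
    by (simp add: pow size_Phi_def R)
  then obtain k where k: "N = k * size_Phi f" by (metis dvdE mult.commute)
  have "k \<ge> 1" using k N by (cases k) auto
  moreover obtain j where "(SOME x. x \<in> Rep_Phi f) = x ^ (CARD('a) ^ j)"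
    using root_in_Rep_Phi[of f] R by auto
  ultimately show ?thesis using that[of k f] k char_sum_frobenius[OF N x] by simp
qed

text \<open>Fourier inversion shows that the \<open>p_Phi k f\<close> generate the algebra, which makes the derivative with
respect to them unique.\<close>

lemma char_sum_inversion:
  fixes \<xi> :: "'a::{finite,field} alg_closure \<Rightarrow> complex"
  assumes N: "N > 0" and \<xi>: "\<xi> \<in> M_chars N"
  shows "(\<Sum>x\<in>M_lev N. FG_scale (\<xi> x) (char_sum N x)) = FG_scale (of_nat (CARD('a) ^ N - 1))
     (p_char N \<xi>)"
proof -
  let ?p = "\<lambda>\<eta>. p_char N \<eta> :: 'a FG"
  have "(\<Sum>x\<in>M_lev N. FG_scale (\<xi> x) (char_sum N x))
      = (\<Sum>x\<in>M_lev N. \<Sum>\<eta>\<in>M_chars N. FG_scale (\<xi> x * cnj (\<eta> x)) (?p \<eta>))"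
    by (simp add: char_sum_def FG_scale_sum)
  also have "\<dots> = (\<Sum>\<eta>\<in>M_chars N. FG_scale (\<Sum>x\<in>M_lev N. \<xi> x * cnj (\<eta> x)) (?p \<eta>))"
    unfolding FG_scale_sum_left by (rule sum.swap)
  also have "\<dots> = (\<Sum>\<eta>\<in>M_chars N. if \<eta> = \<xi> then FG_scale (of_nat (CARD('a) ^ N - 1)) (?p \<eta>) else 0)"
    by (intro sum.cong refl) (simp add: sum_M_lev_chars[OF N _ \<xi>])
  also have "\<dots> = FG_scale (of_nat (CARD('a) ^ N - 1)) (?p \<xi>)"
    using card_M_chars(1)[OF N, where 'a='a] \<xi> by simp
  finally show ?thesis .
qed

lemma of_nat_card_power_minus_1:
  "N > 0 \<Longrightarrow> of_nat (CARD('a::{finite,field}) ^ N - 1) = (of_nat CARD('a) ^ N - 1 :: complex)"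
  "N > 0 \<Longrightarrow> (of_nat CARD('a::{finite,field}) ^ N - 1 :: complex) \<noteq> 0"
proof -
  assume N: "N > 0"
  have gt: "CARD('a) ^ N > 1" by (rule card_pow_gt_1[OF N])
  thus *: "of_nat (CARD('a) ^ N - 1) = (of_nat CARD('a) ^ N - 1 :: complex)"
    by (simp add: of_nat_diff)
  show "(of_nat CARD('a::{finite,field}) ^ N - 1 :: complex) \<noteq> 0"
    unfolding *[symmetric] using gt by (simp only: of_nat_eq_0_iff)
qed

text \<open>A derivation taking the value \<open>1\<close> on all \<open>p_char N \<xi>\<close> with \<open>N = n\<close>, and
\<open>0\<close> on those with \<open>N \<noteq> n\<close>, takes on \<open>char_sum n x\<close> the value
\<open>\<Sum>\<xi>. cnj (\<xi> x)\<close>. By orthogonality this vanishes unless \<open>x = 1\<close>, that is,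
unless the orbit is \<open>f1\<close>. Uniqueness follows from Fourier inversion.\<close>

lemma d_Phi_f1:
  assumes n: "n \<ge> 1"
  shows "(d_Phi n f1 :: 'a::{finite,field} FG \<Rightarrow> 'a FG) = (\<lambda>F. FG_scale ((-1) ^ (n - 1)) (f1_deriv n F))"
  unfolding d_Phi_def
proof (rule FG_partial_eqI)
  let ?D = "\<lambda>F. FG_scale ((-1) ^ (n - 1)) (f1_deriv n F) :: 'a FG"
  show der: "FG_derivation ?D" by (rule f1_deriv_derivation)
  note lin = FG_derivation_linear[OF der]
  show val: "?D (case j of (k, g) \<Rightarrow> p_Phi k g) = (if j = (n, f1) then 1 else 0)"
    if jI: "j \<in> {(k, g). k \<ge> 1}" for j :: "nat \<times> 'a Phi"
  proof -
    obtain k g where j: "j = (k, g)" and k: "k \<ge> 1" using jI by auto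
    define N where "N = k * size_Phi g"
    define x where "x = (SOME x. x \<in> Rep_Phi g)"
    have pP: "p_Phi k g = FG_scale ((-1) ^ (N - 1) / (of_nat CARD('a) ^ N - 1)) (char_sum N x)"
      unfolding N_def x_def by (rule p_Phi_char_sum)
    show ?thesis
    proof (cases "N = 0")
      \<comment> \<open>An orbit without a finite size would give \<open>N = 0\<close>; then the denominator \<open>q ^ 0 - 1\<close> makes \<open>p_Phi k g\<close> zero.\<close>
      case True
      hence "g \<noteq> f1" using k by (auto simp: N_def size_Phi_f1)
      thus ?thesis using True by (simp add: j pP FG_linear_0[OF f1_deriv_linear])
    next
      case False
      hence N: "N > 0" by simp
      have D: "f1_deriv n (p_char N \<xi>) = (if N = n then 1 else 0 :: 'a FG)"
        if "\<xi> \<in> M_chars N" for \<xi>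
      proof -
        have d: "size_star (orbit_star (star_of N \<xi>)) dvd N" by (rule size_star_dvd[OF N that])
        hence "N div size_star (orbit_star (star_of N \<xi>)) \<ge> 1"
          using N size_star_pos by (simp add: Suc_le_eq div_greater_zero_iff dvd_imp_le)
        thus ?thesis using d by (simp add: f1_deriv_p_star[OF n])
      qed
      have "f1_deriv n (char_sum N x) = FG_scale (\<Sum>\<xi>\<in>M_chars N. cnj (\<xi> x)) (if N = n then 1 else 0)"
        unfolding char_sum_def FG_linear_sum[OF f1_deriv_linear] FG_linear_scale[OF f1_deriv_linear] FG_scale_sum_left
        by (intro sum.cong refl) (simp only: D)
      also have "(\<Sum>\<xi>\<in>M_chars N. cnj (\<xi> x)) = (if x = 1 then of_nat CARD('a) ^ N - 1 else 0)"
        unfolding sum_cnj_M_chars[OF N] of_nat_card_power_minus_1(1)[OF N] ..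
      finally have Dc: "f1_deriv n (char_sum N x) = FG_scale (if x = 1 then of_nat CARD('a) ^ N - 1 else 0) (if N = n then 1 else 0)" .
      have iff: "j = (n, f1) \<longleftrightarrow> x = 1 \<and> N = n"
      proof
        assume "j = (n, f1)" thus "x = 1 \<and> N = n"
          by (simp add: j N_def x_def size_Phi_f1 Rep_f1)
      next
        assume h: "x = 1 \<and> N = n"
        have "1 \<in> Rep_Phi g" using root_in_Rep_Phi[of g] h x_def by simp
        hence "g = f1" by (rule Phi_eq_f1)
        thus "j = (n, f1)" using h by (simp add: j N_def size_Phi_f1)
      qed
      have sgn: "(-1) ^ (n - 1) * ((-1) ^ (n - 1) * c) = (c :: complex)" for c
        by (simp flip: mult.assoc power_add mult_2)
      show ?thesis
      proof (cases "x = 1 \<and> N = n")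
        case True
        have nz: "(of_nat CARD('a) ^ n - 1 :: complex) \<noteq> 0" using of_nat_card_power_minus_1(2)[of n] n by simp
        have Dc1: "f1_deriv n (char_sum n 1) = FG_scale (of_nat CARD('a) ^ n - 1) (1 :: 'a FG)"
          using Dc True by simp
        have "?D (p_Phi k g) = FG_scale ((-1) ^ (n - 1) * ((-1) ^ (n - 1) / (of_nat CARD('a) ^ n - 1) * (of_nat CARD('a) ^ n - 1))) 1"
          using True by (simp add: pP FG_linear_scale[OF f1_deriv_linear] Dc1)
        also have "\<dots> = 1" using nz sgn[of 1] by simp
        finally show ?thesis using iff True by (simp add: j)
      next
        case False
        thus ?thesis using iff by (auto simp: j pP FG_linear_scale[OF f1_deriv_linear] Dc)
      qed
    qed
  qed
  fix D' :: "'a FG \<Rightarrow> 'a FG"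
  assume D': "FG_derivation D'"
    and v: "\<And>j. j \<in> {(k, g). k \<ge> 1} \<Longrightarrow> D' (case j of (k, g) \<Rightarrow> p_Phi k g) = (if j = (n, f1) then 1 else 0)"
  note lin' = FG_derivation_linear[OF D']
  have eq: "D' (p_Phi k g) = ?D (p_Phi k g)" if "k \<ge> 1" for k g
    using v[of "(k, g)"] val[of "(k, g)"] that by simp
  show "D' = ?D"
  proof (rule FG_derivation_eqI[OF D' der])
    fix m :: nat and \<phi> :: "'a Phi_star"
    assume m: "m \<ge> 1"
    define N where "N = m * size_star \<phi>"
    have N: "N > 0" using m size_star_pos[of \<phi>] by (simp add: N_def)
    have c: "D' (char_sum N x) = ?D (char_sum N x)" if x: "x \<in> M_lev N" for x
    proof -
      obtain f k where fk: "k \<ge> 1" "N = k * size_Phi f" "char_sum N (SOME x. x \<in> Rep_Phi f) = char_sum N x"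
        using M_lev_orbit[OF N x] by blast
      let ?c = "(-1) ^ (N - 1) / (of_nat CARD('a) ^ N - 1) :: complex"
      have pe: "p_Phi k f = FG_scale ?c (char_sum N x)"
        unfolding p_Phi_char_sum fk(2)[symmetric] fk(3) ..
      have "FG_scale ?c (D' (char_sum N x)) = FG_scale ?c (?D (char_sum N x))"
        using eq[OF fk(1), of f] unfolding pe FG_linear_scale[OF lin'] FG_linear_scale[OF lin] .
      thus ?thesis by (rule FG_scale_cancel[rotated]) (use of_nat_card_power_minus_1(2)[OF N, where 'a='a] in simp)
    qed
    have "card {\<xi> \<in> M_chars N. orbit_star (star_of N \<xi>) = \<phi>} > 0"
      using orbit_star_fibre[OF N, of \<phi>] size_star_pos[of \<phi>] by (simp add: N_def)
    hence "{\<xi> \<in> M_chars N. orbit_star (star_of N \<xi>) = \<phi>} \<noteq> {}" by force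
    then obtain \<xi> where \<xi>: "\<xi> \<in> M_chars N" "orbit_star (star_of N \<xi>) = \<phi>" by blast
    let ?Q = "of_nat (CARD('a) ^ N - 1) :: complex"
    have Nm: "N div size_star \<phi> = m" using size_star_pos[of \<phi>] by (simp add: N_def)
    have p: "FG_scale ?Q (p_star m \<phi>) = (\<Sum>x\<in>M_lev N. FG_scale (\<xi> x) (char_sum N x))"
      using char_sum_inversion[OF N \<xi>(1)] \<xi>(2) Nm by simp
    have "FG_scale ?Q (D' (p_star m \<phi>)) = FG_scale ?Q (?D (p_star m \<phi>))"
      unfolding FG_linear_scale[OF lin', symmetric] FG_linear_scale[OF lin, symmetric] p
        FG_linear_sum[OF lin'] FG_linear_sum[OF lin]
      unfolding FG_linear_scale[OF lin'] FG_linear_scale[OF lin]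
      by (intro sum.cong refl) (simp only: c)
    thus "D' (p_star m \<phi>) = ?D (p_star m \<phi>)"
      by (rule FG_scale_cancel[rotated]) (use of_nat_card_power_minus_1[OF N, where 'a='a] in simp)
  qed
qed

section \<open>Exponentials of commuting operators\<close>

text \<open>These compositions index the coefficient of \<open>w^n\<close> in the \<open>r\<close>-th power of
\<open>A 1 w + A 2 w^2 + \<dots>\<close>.\<close>

definition compositions :: "nat \<Rightarrow> nat \<Rightarrow> nat list set" where
  "compositions r n = {js. 0 \<notin> set js \<and> sum_list js = n \<and> length js = r}"

lemma compositions_bound:
  assumes "0 \<notin> set js" shows "length js \<le> sum_list js" and "set js \<subseteq> {..sum_list js}"
proof -
  show "length js \<le> sum_list js" using assms by (induct js) auto
  show "set js \<subseteq> {..sum_list js}" by (auto intro: member_le_sum_list)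
qed

lemma finite_compositions: "finite (compositions r n)"
  by (rule finite_subset[OF _ finite_lists_length_eq[of "{..n}" r]])
    (use compositions_bound(2) in \<open>auto simp: compositions_def\<close>)

lemma compositions_0: "compositions 0 n = (if n = 0 then {[]} else {})"
  by (auto simp: compositions_def)

lemma sum_compositions_Suc:
  "(\<Sum>js\<in>compositions (Suc r) n. f js) = (\<Sum>k=1..n. \<Sum>js\<in>compositions r (n - k). f (k # js))"
proof -
  have "(\<Sum>k=1..n. \<Sum>js\<in>compositions r (n - k). f (k # js))
      = (\<Sum>(k, js)\<in>(SIGMA k:{1..n}. compositions r (n - k)). f (k # js))"
    by (rule sum.Sigma) (auto simp: finite_compositions)
  also have "\<dots> = (\<Sum>js\<in>compositions (Suc r) n. f js)"
    by (rule sum.reindex_bij_witness[where i = "\<lambda>js. (hd js, tl js)" and j = "\<lambda>(k, js). k # js"])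
      (auto simp: compositions_def length_Suc_conv)
  finally show ?thesis by simp
qed

definition pow_coeff :: "(nat \<Rightarrow> 'a::{finite,field} FG \<Rightarrow> 'a FG) \<Rightarrow> nat \<Rightarrow> nat \<Rightarrow> 'a FG \<Rightarrow> 'a FG" where
  "pow_coeff A r n F = (\<Sum>js\<in>compositions r n. foldr A js F)"

lemma exp_coeff_pow:
  assumes "R > n"
  shows "exp_coeff A n F = (\<Sum>r<R. FG_scale (1 / fact r) (pow_coeff A r n F))"
proof -
  let ?S = "{js. 0 \<notin> set js \<and> sum_list js = n}"
  have eq: "{js \<in> ?S. length js = r} = compositions r n" for r by (auto simp: compositions_def)
  have "?S \<subseteq> (\<Union>r\<in>{..<R}. compositions r n)"
    using compositions_bound(1) assms by (force simp: compositions_def)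
  hence fin: "finite ?S" by (rule finite_subset) (auto simp: finite_compositions)
  have "exp_coeff A n F = (\<Sum>r<R. \<Sum>js\<in>{js \<in> ?S. length js = r}. FG_scale (1 / fact (length js)) (foldr A js F))"
    unfolding exp_coeff_def
    by (rule sum.group[symmetric]) (use fin compositions_bound(1) assms in \<open>force+\<close>)
  also have "\<dots> = (\<Sum>r<R. FG_scale (1 / fact r) (pow_coeff A r n F))"
    unfolding eq pow_coeff_def FG_scale_sum
    by (intro sum.cong refl) (simp add: compositions_def)
  finally show ?thesis .
qed

lemma exp_coeff_cong:
  assumes "\<And>k. k \<ge> 1 \<Longrightarrow> A k = B k"
  shows "exp_coeff A n = exp_coeff B n"
proof
  fix F
  have "foldr A js F = foldr B js F" if "0 \<notin> set js" for js
    using that assms by (induct js) (auto simp: Suc_leI)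
  thus "exp_coeff A n F = exp_coeff B n F" by (simp add: exp_coeff_def)
qed

text \<open>The summation range \<open>k, l \<ge> 1\<close>, \<open>k + l \<le> n\<close> is symmetric.\<close>

lemma sum_triangle_swap:
  fixes f :: "nat \<Rightarrow> nat \<Rightarrow> 'b::comm_monoid_add"
  shows "(\<Sum>k=1..n. \<Sum>l=1..n-k. f k l) = (\<Sum>l=1..n. \<Sum>k=1..n-l. f k l)"
proof -
  have "(\<Sum>k=1..n. \<Sum>l=1..n-k. f k l) = (\<Sum>(k, l)\<in>(SIGMA k:{1..n}. {1..n-k}). f k l)"
    by (rule sum.Sigma) auto
  also have "\<dots> = (\<Sum>(l, k)\<in>(SIGMA l:{1..n}. {1..n-l}). f k l)"
    by (rule sum.reindex_bij_witness[where i = "\<lambda>(l, k). (k, l)" and j = "\<lambda>(k, l). (l, k)"]) auto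
  also have "\<dots> = (\<Sum>l=1..n. \<Sum>k=1..n-l. f k l)" by (rule sum.Sigma[symmetric]) auto
  finally show ?thesis .
qed

text \<open>Commuting linear operators, so that the exponential of \<open>A(w) = A 1 w + A 2 w^2 + \<dots>\<close> obeys the
usual rules.\<close>

locale comm_family =
  fixes A :: "nat \<Rightarrow> 'a::{finite,field} FG \<Rightarrow> 'a FG"
  assumes lin: "FG_linear (A k)" and comm: "A k (A l F) = A l (A k F)"
begin

lemma pow_coeff_Suc: "pow_coeff A (Suc r) n F = (\<Sum>k=1..n. A k (pow_coeff A r (n - k) F))"
  unfolding pow_coeff_def sum_compositions_Suc by (simp add: FG_linear_sum[OF lin])

lemma pow_coeff_0: "pow_coeff A 0 n F = (if n = 0 then F else 0)"
  by (simp add: pow_coeff_def compositions_0)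

text \<open>The identity \<open>w (A(w)^(r+1))' = (r + 1) (w A'(w)) A(w)^r\<close>, compared coefficientwise.\<close>

lemma pow_coeff_newton:
  "FG_scale (of_nat n) (pow_coeff A (Suc r) n F)
   = FG_scale (of_nat (Suc r)) (\<Sum>k=1..n. FG_scale (of_nat k) (A k (pow_coeff A r (n - k) F)))"
proof (induct r arbitrary: n)
  case 0
  show ?case unfolding pow_coeff_Suc pow_coeff_0 FG_scale_sum
    by (intro sum.cong refl) (auto simp: FG_linear_0[OF lin])
next
  case (Suc r)
  let ?P = "\<lambda>k. pow_coeff A (Suc r) (n - k) F"
  have "FG_scale (of_nat n) (pow_coeff A (Suc (Suc r)) n F) = (\<Sum>k=1..n. FG_scale (of_nat n) (A k (?P k)))"
    unfolding pow_coeff_Suc[of "Suc r"] FG_scale_sum ..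
  also have "\<dots> = (\<Sum>k=1..n. FG_scale (of_nat k) (A k (?P k)) + A k (FG_scale (of_nat (n - k)) (?P k)))"
    by (intro sum.cong refl)
      (simp add: FG_linear_scale[OF lin] flip: FG_scale_add_left of_nat_add)
  also have "\<dots> = (\<Sum>k=1..n. FG_scale (of_nat k) (A k (?P k)))
     + (\<Sum>k=1..n. \<Sum>l=1..n-k. FG_scale (of_nat (Suc r)) (FG_scale (of_nat l) (A k (A l (pow_coeff A r (n - k - l) F)))))"
    unfolding Suc
    by (simp only: sum.distrib FG_linear_scale[OF lin] FG_linear_sum[OF lin] FG_scale_sum)
  also have "(\<Sum>k=1..n. \<Sum>l=1..n-k. FG_scale (of_nat (Suc r)) (FG_scale (of_nat l) (A k (A l (pow_coeff A r (n - k - l) F)))))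
     = (\<Sum>l=1..n. \<Sum>k=1..n-l. FG_scale (of_nat (Suc r)) (FG_scale (of_nat l) (A k (A l (pow_coeff A r (n - k - l) F)))))"
    by (rule sum_triangle_swap)
  also have "\<dots> = (\<Sum>l=1..n. FG_scale (of_nat (Suc r)) (FG_scale (of_nat l) (A l (?P l))))"
  proof (intro sum.cong refl)
    fix l
    have "n - k - l = n - l - k" for k by simp
    thus "(\<Sum>k=1..n-l. FG_scale (of_nat (Suc r)) (FG_scale (of_nat l) (A k (A l (pow_coeff A r (n - k - l) F)))))
       = FG_scale (of_nat (Suc r)) (FG_scale (of_nat l) (A l (?P l)))"
      by (simp only: pow_coeff_Suc FG_linear_sum[OF lin] FG_scale_sum comm[of l])
  qed
  also have "(\<Sum>k=1..n. FG_scale (of_nat k) (A k (?P k))) + \<dots>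
     = FG_scale (of_nat (Suc (Suc r))) (\<Sum>k=1..n. FG_scale (of_nat k) (A k (?P k)))"
    by (simp only: of_nat_Suc[of "Suc r"] FG_scale_add_left FG_scale_sum FG_scale_one sum.distrib)
  finally show ?case .
qed

text \<open>The differential equation \<open>w E' = (w A') E\<close> of \<open>E = exp A(w)\<close>. As it determines the
coefficients recursively, it replaces the sum over compositions in everything that follows.\<close>

lemma exp_coeff_newton:
  "FG_scale (of_nat n) (exp_coeff A n F) = (\<Sum>k=1..n. FG_scale (of_nat k) (A k (exp_coeff A (n - k) F)))"
proof (cases "n = 0")
  case False
  have "FG_scale (of_nat n) (exp_coeff A n F)
     = (\<Sum>r<Suc n. FG_scale (1 / fact r) (FG_scale (of_nat n) (pow_coeff A r n F)))"
    by (subst exp_coeff_pow[of n "Suc n"]) (auto simp: FG_scale_sum FG_scale_add_right mult.commute)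
  also have "\<dots> = (\<Sum>r<n. FG_scale (1 / fact (Suc r)) (FG_scale (of_nat n) (pow_coeff A (Suc r) n F)))"
    unfolding sum.lessThan_Suc_shift pow_coeff_0 using False by simp
  also have "\<dots> = (\<Sum>r<n. \<Sum>k=1..n. FG_scale (1 / fact r) (FG_scale (of_nat k) (A k (pow_coeff A r (n - k) F))))"
    unfolding pow_coeff_newton FG_scale_sum FG_scale_scale
    by (intro sum.cong refl arg_cong2[where f = FG_scale]) (simp_all add: field_simps del: of_nat_Suc)
  also have "\<dots> = (\<Sum>k=1..n. \<Sum>r<n. FG_scale (1 / fact r) (FG_scale (of_nat k) (A k (pow_coeff A r (n - k) F))))"
    by (rule sum.swap)
  also have "\<dots> = (\<Sum>k=1..n. FG_scale (of_nat k) (A k (exp_coeff A (n - k) F)))"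
  proof (intro sum.cong refl)
    fix k assume "k \<in> {1..n}"
    hence "n - k < n" by auto
    from exp_coeff_pow[OF this, of A F]
    show "(\<Sum>r<n. FG_scale (1 / fact r) (FG_scale (of_nat k) (A k (pow_coeff A r (n - k) F))))
        = FG_scale (of_nat k) (A k (exp_coeff A (n - k) F))"
      by (simp add: FG_linear_sum[OF lin] FG_linear_scale[OF lin] FG_scale_sum mult.commute)
  qed
  finally show ?thesis .
qed simp

lemma exp_coeff_0: "exp_coeff A 0 F = F"
  by (subst exp_coeff_pow[of 0 "Suc 0"]) (simp_all add: pow_coeff_0)

lemma exp_coeff_linear: "FG_linear (exp_coeff A n)"
proof -
  have "foldr A js (F + G) = foldr A js F + foldr A js G" for js F G
    by (induct js) (auto simp: FG_linear_add[OF lin])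
  moreover have "foldr A js (FG_scale c F) = FG_scale c (foldr A js F)" for js c F
    by (induct js) (auto simp: FG_linear_scale[OF lin])
  ultimately show ?thesis unfolding exp_coeff_def
    by (intro FG_linearI) (auto simp: FG_scale_add_right sum.distrib FG_scale_sum mult.commute)
qed

lemma exp_coeff_commute:
  assumes T: "FG_linear T" and c: "\<And>k F. T (A k F) = A k (T F)"
  shows "T (exp_coeff A n F) = exp_coeff A n (T F)"
proof -
  have "T (foldr A js F) = foldr A js (T F)" for js
    by (induct js) (auto simp: c)
  thus ?thesis unfolding exp_coeff_def by (simp add: FG_linear_sum[OF T] FG_linear_scale[OF T])
qed

lemma exp_coeff_commute_self: "A k (exp_coeff A n F) = exp_coeff A n (A k F)"
  by (rule exp_coeff_commute[OF lin comm])

lemma exp_coeff_unique: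
  assumes "Y 0 = F"
    and "\<And>n. n \<ge> 1 \<Longrightarrow> n \<le> N \<Longrightarrow> FG_scale (of_nat n) (Y n) = (\<Sum>k=1..n. FG_scale (of_nat k) (A k (Y (n - k))))"
  shows "N \<ge> n \<Longrightarrow> Y n = exp_coeff A n F"
proof (induct n rule: less_induct)
  case (less n)
  show ?case
  proof (cases "n = 0")
    case True thus ?thesis by (simp add: assms(1) exp_coeff_0)
  next
    case False
    have "FG_scale (of_nat n) (Y n) = FG_scale (of_nat n) (exp_coeff A n F)"
      unfolding exp_coeff_newton using False less by (simp add: assms(2))
    thus ?thesis by (rule FG_scale_cancel[rotated]) (use False in simp)
  qed
qed

lemma exp_coeff_scale_powers:
  "exp_coeff (\<lambda>k F. FG_scale (c ^ k) (A k F)) n F = FG_scale (c ^ n) (exp_coeff A n F)"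
proof -
  have "foldr (\<lambda>k F. FG_scale (c ^ k) (A k F)) js F = FG_scale (c ^ sum_list js) (foldr A js F)" for js
    by (induct js) (auto simp: FG_linear_scale[OF lin] power_add)
  thus ?thesis unfolding exp_coeff_def FG_scale_sum
    by (intro sum.cong refl) (auto simp: mult.commute)
qed

text \<open>If \<open>A(w)\<close> and multiplication by \<open>p\<close> have the scalar commutator \<open>c(w)\<close>, then
\<open>exp(A) p = (p + c) exp(A)\<close>; the right side satisfies the differential equation of the left side.\<close>

lemma exp_coeff_mult_commutator:
  assumes p: "\<And>k F. k \<ge> 1 \<Longrightarrow> A k (p * F) = p * A k F + FG_scale (c k) F"
  shows "exp_coeff A n (p * F) = p * exp_coeff A n F + (\<Sum>k=1..n. FG_scale (c k) (exp_coeff A (n - k) F))"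
proof -
  define Y where "Y n = p * exp_coeff A n F + (\<Sum>k=1..n. FG_scale (c k) (exp_coeff A (n - k) F))" for n
  have "Y n = exp_coeff A n (p * F)"
  proof (rule exp_coeff_unique[OF _ _ order_refl])
    show "Y 0 = p * F" by (simp add: Y_def exp_coeff_0)
    fix n :: nat assume n: "n \<ge> 1"
    let ?E = "\<lambda>n. exp_coeff A n F"
    have "(\<Sum>k=1..n. FG_scale (of_nat k) (A k (Y (n - k))))
        = (\<Sum>k=1..n. p * FG_scale (of_nat k) (A k (?E (n - k))))
        + (\<Sum>k=1..n. FG_scale (of_nat k * c k) (?E (n - k)))
        + (\<Sum>k=1..n. \<Sum>l=1..n-k. FG_scale (c l) (FG_scale (of_nat k) (A k (?E (n - k - l)))))"
    proof -
      have "FG_scale (of_nat k) (A k (Y (n - k))) = p * FG_scale (of_nat k) (A k (?E (n - k)))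
          + FG_scale (of_nat k * c k) (?E (n - k))
          + (\<Sum>l=1..n-k. FG_scale (c l) (FG_scale (of_nat k) (A k (?E (n - k - l)))))" if "k \<ge> 1" for k
        unfolding Y_def FG_linear_add[OF lin] p[OF that] FG_linear_sum[OF lin] FG_linear_scale[OF lin]
          FG_scale_add_right FG_scale_sum
        by (simp add: FG_scale_mult_right mult.commute)
      thus ?thesis by (simp add: sum.distrib)
    qed
    also have "(\<Sum>k=1..n. p * FG_scale (of_nat k) (A k (?E (n - k)))) = FG_scale (of_nat n) (p * ?E n)"
      by (subst sum_distrib_left[symmetric], subst exp_coeff_newton[symmetric]) (rule FG_scale_mult_right)
    also have "(\<Sum>k=1..n. \<Sum>l=1..n-k. FG_scale (c l) (FG_scale (of_nat k) (A k (?E (n - k - l)))))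
        = (\<Sum>l=1..n. \<Sum>k=1..n-l. FG_scale (c l) (FG_scale (of_nat k) (A k (?E (n - l - k)))))"
      by (subst sum_triangle_swap) (simp add: add.commute)
    also have "\<dots> = (\<Sum>l=1..n. FG_scale (c l) (FG_scale (of_nat (n - l)) (?E (n - l))))"
      by (simp only: exp_coeff_newton FG_scale_sum)
    also have "FG_scale (of_nat n) (p * ?E n) + (\<Sum>k=1..n. FG_scale (of_nat k * c k) (?E (n - k))) + \<dots>
        = FG_scale (of_nat n) (p * ?E n) + (\<Sum>k=1..n. FG_scale (of_nat n * c k) (?E (n - k)))"
      unfolding add.assoc sum.distrib[symmetric]
    proof (intro arg_cong2[where f = "(+)"] refl sum.cong)
      fix k assume "k \<in> {1..n}"
      hence "(of_nat n :: complex) = of_nat k + of_nat (n - k)" by (simp flip: of_nat_add)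
      thus "FG_scale (of_nat k * c k) (?E (n - k)) + FG_scale (c k) (FG_scale (of_nat (n - k)) (?E (n - k)))
          = FG_scale (of_nat n * c k) (?E (n - k))"
        by (simp only: FG_scale_scale FG_scale_add_left[symmetric]) (simp add: algebra_simps)
    qed
    also have "\<dots> = FG_scale (of_nat n) (Y n)"
      by (simp add: Y_def FG_scale_add_right FG_scale_sum)
    finally show "FG_scale (of_nat n) (Y n) = (\<Sum>k=1..n. FG_scale (of_nat k) (A k (Y (n - k))))" ..
  qed
  thus ?thesis by (simp add: Y_def)
qed

lemma exp_coeff_one:
  assumes "\<And>k. A k 1 = 0"
  shows "exp_coeff A n 1 = (if n = 0 then 1 else 0)"
proof -
  have "(\<lambda>n. if n = 0 then 1 else 0) n = exp_coeff A n 1"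
    by (rule exp_coeff_unique[OF _ _ order_refl])
      (auto simp: assms FG_linear_0[OF lin] if_distrib[of "A k" for k] intro!: sum.neutral)
  thus ?thesis by simp
qed

text \<open>Lowering operators have locally finite exponentials: by the commutator formula each further factor
\<open>p_k(\<phi>)\<close> shifts the vanishing bound by a finite amount.\<close>

lemma exp_coeff_eventually_0:
  assumes one: "\<And>k. A k 1 = 0"
    and p: "\<And>k \<phi> l F. k \<ge> 1 \<Longrightarrow> l \<ge> 1 \<Longrightarrow> A l (p_star k \<phi> * F) = p_star k \<phi> * A l F + FG_scale (c k \<phi> l) F"
    and c: "\<And>k \<phi>. \<exists>L. \<forall>l\<ge>L. c k \<phi> l = 0"
  shows "\<exists>K. \<forall>n\<ge>K. exp_coeff A n F = 0"
proof (induct F rule: FG_induct)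
  case (1 a)
  have "exp_coeff A n (FG_scale a 1) = 0" if "n \<ge> 1" for n
    using that by (simp add: FG_linear_scale[OF exp_coeff_linear] exp_coeff_one[OF one])
  thus ?case by blast
next
  case (2 F G)
  then obtain K L where "\<forall>n\<ge>K. exp_coeff A n F = 0" "\<forall>n\<ge>L. exp_coeff A n G = 0" by blast
  hence "\<forall>n\<ge>max K L. exp_coeff A n (F + G) = 0" by (simp add: FG_linear_add[OF exp_coeff_linear])
  thus ?case by blast
next
  case (3 k \<phi> F)
  then obtain K where K: "\<And>n. n \<ge> K \<Longrightarrow> exp_coeff A n F = 0" by blast
  obtain L where L: "\<And>l. l \<ge> L \<Longrightarrow> c k \<phi> l = 0" using c by blast
  have comm: "A l (p_star k \<phi> * G) = p_star k \<phi> * A l G + FG_scale (c k \<phi> l) G" if "l \<ge> 1" for l G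
    by (rule p[OF 3(1) that])
  have "exp_coeff A n (p_star k \<phi> * F) = 0" if n: "n \<ge> K + L" for n
  proof -
    have "FG_scale (c k \<phi> l) (exp_coeff A (n - l) F) = 0" for l
      using K[of "n - l"] L[of l] n by (cases "l \<ge> L") auto
    thus ?thesis using n K[of n] exp_coeff_mult_commutator[OF comm, of n F] by simp
  qed
  thus ?case by blast
qed

end

text \<open>By induction along the differential equation; commutativity of \<open>B\<close> brings the factor that has changed
sides to the front again.\<close>

lemma exp_coeff_adjoint:
  assumes A: "comm_family A" and B: "comm_family B"
    and adj: "\<And>k F G. k \<ge> 1 \<Longrightarrow> FG_inner (A k F) G = FG_inner F (B k G)"
  shows "FG_inner (exp_coeff A n F) G = FG_inner F (exp_coeff B n G)"
proof (induct n arbitrary: G rule: less_induct)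
  case (less n)
  interpret A: comm_family A by (rule A)
  interpret B: comm_family B by (rule B)
  show ?case
  proof (cases "n = 0")
    case True thus ?thesis by (simp add: A.exp_coeff_0 B.exp_coeff_0)
  next
    case False
    have "of_nat n * FG_inner (exp_coeff A n F) G = FG_inner (FG_scale (of_nat n) (exp_coeff A n F)) G"
      by (simp add: FG_inner_scale_left)
    also have "\<dots> = (\<Sum>k=1..n. of_nat k * FG_inner F (B k (exp_coeff B (n - k) G)))"
      unfolding A.exp_coeff_newton FG_inner_sum_left FG_inner_scale_left
      by (intro sum.cong refl) (use less in \<open>simp add: adj B.exp_coeff_commute_self\<close>)
    also have "\<dots> = FG_inner F (FG_scale (of_nat n) (exp_coeff B n G))"
      unfolding B.exp_coeff_newton FG_inner_sum_right FG_inner_scale_right by simp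
    also have "\<dots> = of_nat n * FG_inner F (exp_coeff B n G)"
      by (simp add: FG_inner_scale_right)
    finally show ?thesis using False by simp
  qed
qed

section \<open>Exponentials of multiplication operators\<close>

text \<open>The coefficient of \<open>w^n\<close> in the power series \<open>exp(a 1 w + a 2 w^2 + \<dots>)\<close>.\<close>

definition hexp :: "(nat \<Rightarrow> 'a::{finite,field} FG) \<Rightarrow> nat \<Rightarrow> 'a FG" where
  "hexp a n = exp_coeff (\<lambda>k F. a k * F) n 1"

lemma mult_linear: "FG_linear (\<lambda>F. a * F)"
  by (rule FG_linearI) (simp_all add: distrib_left FG_scale_mult_right)

lemma mult_comm_family: "comm_family (\<lambda>k F. a k * F)"
  by unfold_locales (rule mult_linear, simp only: mult.left_commute)

lemma exp_coeff_mult: "exp_coeff (\<lambda>k F. a k * F) n F = hexp a n * F"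
  using comm_family.exp_coeff_commute[OF mult_comm_family mult_linear, of F a n 1]
  by (simp add: hexp_def mult_ac)

text \<open>For \<open>a k = p_k / k\<close> these are Newton's identities between complete and power sum symmetric functions.\<close>

lemma hexp_newton:
  "FG_scale (of_nat n) (hexp a n) = (\<Sum>k=1..n. FG_scale (of_nat k) (a k) * hexp a (n - k))"
  using comm_family.exp_coeff_newton[OF mult_comm_family, of n a 1]
  by (simp add: hexp_def FG_scale_mult_left)

lemma hexp_0: "hexp a 0 = 1"
  unfolding hexp_def by (rule comm_family.exp_coeff_0[OF mult_comm_family])

lemma hexp_unique:
  assumes "Y 0 = 1"
    and "\<And>n. n \<ge> 1 \<Longrightarrow> n \<le> N \<Longrightarrow> FG_scale (of_nat n) (Y n) = (\<Sum>k=1..n. FG_scale (of_nat k) (a k) * Y (n - k))"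
  shows "N \<ge> n \<Longrightarrow> Y n = hexp a n"
  unfolding hexp_def
  by (rule comm_family.exp_coeff_unique[OF mult_comm_family]) (simp_all add: assms FG_scale_mult_left)

text \<open>Extension by \<open>0\<close> to negative indices, here and in \<open>exp_z\<close>, lets all relations below hold
for all integers without case distinctions at the boundary.\<close>

definition hexp_z :: "(nat \<Rightarrow> 'a::{finite,field} FG) \<Rightarrow> int \<Rightarrow> 'a FG" where
  "hexp_z a n = (if n < 0 then 0 else hexp a (nat n))"

definition exp_z :: "(nat \<Rightarrow> 'a::{finite,field} FG \<Rightarrow> 'a FG) \<Rightarrow> int \<Rightarrow> 'a FG \<Rightarrow> 'a FG" where
  "exp_z A n F = (if n < 0 then 0 else exp_coeff A (nat n) F)"

lemma exp_z_linear: "comm_family A \<Longrightarrow> FG_linear (exp_z A n)"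
  using comm_family.exp_coeff_linear[of A "nat n"] unfolding exp_z_def FG_linear_def by auto

lemma hexp_z_newton:
  assumes "z \<le> int n"
  shows "FG_scale (of_int z) (hexp_z a z) = (\<Sum>k=1..n. FG_scale (of_nat k) (a k) * hexp_z a (z - int k))"
proof (cases "z < 0")
  case True thus ?thesis by (simp add: hexp_z_def)
next
  case False
  then obtain m where m: "z = int m" by (metis nonneg_int_cases not_less)
  have "(\<Sum>k=1..n. FG_scale (of_nat k) (a k) * hexp_z a (z - int k)) = (\<Sum>k=1..m. FG_scale (of_nat k) (a k) * hexp_z a (z - int k))"
    by (rule sum.mono_neutral_right) (use assms m in \<open>auto simp: hexp_z_def\<close>)
  also have "\<dots> = (\<Sum>k=1..m. FG_scale (of_nat k) (a k) * hexp a (m - k))"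
    by (intro sum.cong refl) (auto simp: hexp_z_def m nat_diff_distrib')
  finally show ?thesis using hexp_newton[of m a] by (simp add: m hexp_z_def)
qed

text \<open>Let \<open>E(w) = exp A(w)\<close> and \<open>H(u) = exp(\<Sum> a k u^k)\<close>. The hypothesis says that the
commutator of \<open>A(w)\<close> with \<open>\<Sum> a k u^k\<close> is \<open>- \<Sum>i. (w^s u^c)^i / i\<close>,
which is the logarithm of \<open>1 - w^s u^c\<close>; so \<open>E(w) H(u) = (1 - w^s u^c) H(u) E(w)\<close>. The
three pairs \<open>(s, c)\<close> that occur below are \<open>(1, 1)\<close>, \<open>(d, 1)\<close> and
\<open>(1, d)\<close>. In the coefficientwise proof by Newton's recursion for \<open>H\<close>, the geometric
series of commutator terms telescopes against the induction hypothesis.\<close>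

lemma exp_z_hexp_z_commutator:
  fixes a :: "nat \<Rightarrow> 'a::{finite,field} FG"
  assumes A: "comm_family A" and s: "s \<ge> 1" and c: "c \<ge> 1"
    and ac: "\<And>k l F. k \<ge> 1 \<Longrightarrow> l \<ge> 1 \<Longrightarrow> A l (FG_scale (of_nat k) (a k) * F) = FG_scale (of_nat k) (a k) * A l F
        + FG_scale (if k * s = l * c \<and> c dvd k then - of_nat c else 0) F"
  shows "exp_z A j (hexp_z a n * F) = hexp_z a n * exp_z A j F - hexp_z a (n - int c) * exp_z A (j - int s) F"
proof (cases "n < 0")
  case True thus ?thesis by (simp add: hexp_z_def FG_linear_0[OF exp_z_linear[OF A]])
next
  case False
  interpret comm_family A by (rule A)
  let ?P = "\<lambda>k. FG_scale (of_nat k) (a k)"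
  have key: "exp_z A j (?P k * F) = ?P k * exp_z A j F
      - (if c dvd k then FG_scale (of_nat c) (exp_z A (j - int (s * (k div c))) F) else 0)"
    if k: "k \<ge> 1" for k j F
  proof (cases "j < 0")
    case True
    moreover have "j - int (s * (k div c)) < 0"
      using True of_nat_0_le_iff[of "s * (k div c)", where 'a=int] by linarith
    ultimately show ?thesis by (simp add: exp_z_def del: of_nat_mult)
  next
    case False
    then obtain m where m: "j = int m" by (metis nonneg_int_cases not_less)
    let ?w = "\<lambda>l. if k * s = l * c \<and> c dvd k then - complex_of_nat c else 0"
    have "exp_coeff A m (?P k * F) = ?P k * exp_coeff A m F + (\<Sum>l=1..m. FG_scale (?w l) (exp_coeff A (m - l) F))"
      by (rule exp_coeff_mult_commutator) (rule ac[OF k])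
    also have "(\<Sum>l=1..m. FG_scale (?w l) (exp_coeff A (m - l) F))
        = - (if c dvd k then FG_scale (of_nat c) (exp_z A (j - int (s * (k div c))) F) else 0)"
    proof (cases "c dvd k")
      case True
      then obtain i where i: "k = c * i" by blast
      have i1: "i \<ge> 1" using k i by (cases i) auto
      have w: "?w l = (if l = s * i then - complex_of_nat c else 0)" for l
        using c by (auto simp: i mult_ac)
      have "(\<Sum>l=1..m. FG_scale (?w l) (exp_coeff A (m - l) F))
          = (\<Sum>l=1..m. if l = s * i then FG_scale (- of_nat c) (exp_coeff A (m - l) F) else 0)"
        unfolding w by (intro sum.cong) auto
      also have "\<dots> = (if s * i \<le> m then FG_scale (- of_nat c) (exp_coeff A (m - s * i) F) else 0)"
        using s i1 by (subst sum.delta) auto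
      also have "\<dots> = - FG_scale (of_nat c) (exp_z A (j - int (s * i)) F)"
        by (auto simp: exp_z_def m FG_scale_uminus nat_diff_distrib' simp del: of_nat_mult)
      finally show ?thesis using i c by simp
    qed simp
    finally show ?thesis by (simp add: exp_z_def m)
  qed
  have main: "exp_z A j (hexp_z a (int n) * F) = hexp_z a (int n) * exp_z A j F - hexp_z a (int n - int c) * exp_z A (j - int s) F" for n j F
  proof (induct n arbitrary: j F rule: less_induct)
    case (less n)
    show ?case
    proof (cases "n = 0")
      case True thus ?thesis using c by (simp add: hexp_z_def hexp_0)
    next
      case False
      let ?E = "\<lambda>j. exp_z A j F"
      let ?h = "hexp_z a"
      \<comment> \<open>The \<open>i\<close>-th commutator term is, by the induction hypothesis, a difference of consecutive \<open>t i\<close>.\<close>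
      define t where "t i = ?h (int n - int (c * i)) * ?E (j - int (s * i))" for i
      define M where "M = n div c"
      note lz = exp_z_linear[OF A]
      have IH: "exp_z A j' (?h (int n - int k) * F) = ?h (int n - int k) * ?E j' - ?h (int n - int c - int k) * ?E (j' - int s)"
        if "k \<ge> 1" "k \<le> n" for k j'
        using less[of "n - k" j' F] that False by (simp add: of_nat_diff algebra_simps)
      have "FG_scale (of_nat n) (exp_z A j (?h (int n) * F)) = exp_z A j (FG_scale (of_int (int n)) (?h (int n)) * F)"
        by (simp add: FG_linear_scale[OF lz] FG_scale_mult_left)
      also have "\<dots> = (\<Sum>k=1..n. exp_z A j (?P k * (?h (int n - int k) * F)))"
        unfolding hexp_z_newton[OF order_refl] sum_distrib_right FG_linear_sum[OF lz] mult.assoc ..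
      also have "\<dots> = (\<Sum>k=1..n. ?P k * ?h (int n - int k) * ?E j - ?P k * ?h (int n - int c - int k) * ?E (j - int s))
          - (\<Sum>k=1..n. if c dvd k then FG_scale (of_nat c) (exp_z A (j - int (s * (k div c))) (?h (int n - int k) * F)) else 0)"
        unfolding sum_subtractf[symmetric]
        by (intro sum.cong refl) (simp add: key IH right_diff_distrib mult.assoc)
      also have "(\<Sum>k=1..n. ?P k * ?h (int n - int k) * ?E j - ?P k * ?h (int n - int c - int k) * ?E (j - int s))
          = FG_scale (of_int (int n)) (?h (int n)) * ?E j - FG_scale (of_int (int n - int c)) (?h (int n - int c)) * ?E (j - int s)"
        by (subst (1 2) hexp_z_newton[of _ n]) (simp_all add: sum_subtractf sum_distrib_right)
      also have "(\<Sum>k=1..n. if c dvd k then FG_scale (of_nat c) (exp_z A (j - int (s * (k div c))) (?h (int n - int k) * F)) else 0)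
          = (\<Sum>i=1..M. FG_scale (of_nat c) (exp_z A (j - int (s * i)) (?h (int n - int (c * i)) * F)))"
      proof -
        have "(\<Sum>k=1..n. if c dvd k then FG_scale (of_nat c) (exp_z A (j - int (s * (k div c))) (?h (int n - int k) * F)) else 0)
          = (\<Sum>k | k \<in> {1..n} \<and> c dvd k. FG_scale (of_nat c) (exp_z A (j - int (s * (k div c))) (?h (int n - int k) * F)))"
          by (rule sum.inter_filter[symmetric]) simp
        also have "\<dots> = (\<Sum>i=1..M. FG_scale (of_nat c) (exp_z A (j - int (s * i)) (?h (int n - int (c * i)) * F)))"
        proof (rule sum.reindex_bij_witness[where i = "\<lambda>i. c * i" and j = "\<lambda>k. k div c"])
          fix k assume "k \<in> {k. k \<in> {1..n} \<and> c dvd k}"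
          thus "k div c \<in> {1..M}" using c by (auto simp: M_def div_le_mono dvd_imp_le Suc_leI div_greater_zero_iff)
        next
          fix i assume i: "i \<in> {1..M}"
          hence "c * i \<le> c * (n div c)" unfolding M_def by simp
          also have "\<dots> \<le> n" by simp
          finally show "c * i \<in> {k. k \<in> {1..n} \<and> c dvd k}" using i c by auto
        qed (use c in auto)
        finally show ?thesis .
      qed
      also have "\<dots> = FG_scale (of_nat c) (\<Sum>i=1..M. t i - t (Suc i))"
        unfolding FG_scale_sum
      proof (intro sum.cong refl arg_cong[where f = "FG_scale (of_nat c)"])
        fix i assume i: "i \<in> {1..M}"
        hence "c * i \<le> c * (n div c)" unfolding M_def by simp
        also have "\<dots> \<le> n" by simp
        finally have "c * i \<le> n" .
        thus "exp_z A (j - int (s * i)) (?h (int n - int (c * i)) * F) = t i - t (Suc i)"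
          using IH[of "c * i" "j - int (s * i)"] i c by (simp add: t_def algebra_simps)
      qed
      also have "(\<Sum>i=1..M. t i - t (Suc i)) = t 1 - t (Suc M)"
        by (induct M) auto
      also have "t (Suc M) = 0"
      proof -
        have "n < c * Suc M" unfolding M_def using c by (metis dividend_less_times_div less_le_trans zero_less_one mult_Suc_right add.commute)
        hence "int n - int (c * Suc M) < 0" by linarith
        thus ?thesis by (simp only: t_def hexp_z_def if_True mult_zero_left)
      qed
      also have "FG_scale (of_int (int n)) (?h (int n)) * ?E j - FG_scale (of_int (int n - int c)) (?h (int n - int c)) * ?E (j - int s)
            - FG_scale (of_nat c) (t 1 - 0)
          = FG_scale (of_nat n) (?h (int n) * ?E j - ?h (int n - int c) * ?E (j - int s))"
      proof -
        have "FG_scale (of_int (int n - int c)) H = FG_scale (of_nat n) H - FG_scale (of_nat c) H" for H :: "'a FG"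
          using FG_scale_add_left[of "of_nat n" "- of_nat c" H] by (simp add: FG_scale_uminus)
        thus ?thesis by (simp add: t_def FG_scale_mult_left FG_scale_diff_right left_diff_distrib)
      qed
      finally show ?thesis by (rule FG_scale_cancel[rotated]) (use False in simp)
    qed
  qed
  from False obtain m where "n = int m" by (metis nonneg_int_cases not_less)
  thus ?thesis using main by simp
qed

section \<open>Finitely supported sums over the integers\<close>

lemma Sum_any_linear:
  assumes "FG_linear T" "finite {j. f j \<noteq> 0}"
  shows "T (Sum_any f) = Sum_any (\<lambda>j. T (f j))"
proof -
  have "{j. T (f j) \<noteq> 0} \<subseteq> {j. f j \<noteq> 0}" by (auto simp: FG_linear_0[OF assms(1)])
  thus ?thesis
    using Sum_any.expand_superset[OF assms(2), of f] Sum_any.expand_superset[OF assms(2), of "\<lambda>j. T (f j)"]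
    by (simp add: FG_linear_sum[OF assms(1)])
qed

lemma Sum_any_shift:
  fixes f :: "int \<Rightarrow> 'b::comm_monoid_add"
  shows "Sum_any (\<lambda>j. f (j + c)) = Sum_any f"
proof (rule Sum_any.reindex_cong[symmetric])
  show "bij (\<lambda>j. j + c)" by (rule o_bij[of "\<lambda>j. j - c"]) (auto simp: comp_def)
qed (simp add: comp_def)

lemma Sum_any_diff:
  fixes f g :: "'c \<Rightarrow> 'b::ab_group_add"
  assumes "finite {j. f j \<noteq> 0}" "finite {j. g j \<noteq> 0}"
  shows "Sum_any (\<lambda>j. f j - g j) = Sum_any f - Sum_any g"
proof -
  have "{j. - g j \<noteq> 0} = {j. g j \<noteq> 0}" by simp
  hence "Sum_any (\<lambda>j. f j + - g j) = Sum_any f + Sum_any (\<lambda>j. - g j)"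
    using assms by (intro Sum_any.distrib) auto
  moreover have "Sum_any (\<lambda>j. - g j) = - Sum_any g"
    by (simp add: Sum_any.expand_set sum_negf)
  ultimately show ?thesis by simp
qed

lemma Sum_any_nat_int:
  fixes f :: "int \<Rightarrow> 'b::comm_monoid_add"
  assumes "\<And>j. j < 0 \<Longrightarrow> f j = 0"
  shows "Sum_any (\<lambda>j::nat. f (int j)) = Sum_any f"
proof -
  have "{j. f j \<noteq> 0} = int ` {j. f (int j) \<noteq> 0}"
    using assms by (auto simp: image_iff) (metis nonneg_int_cases not_less)
  thus ?thesis
    by (simp add: Sum_any.expand_set sum.reindex)
qed

lemma finite_int_support:
  fixes f :: "int \<Rightarrow> 'b::zero"
  assumes "\<And>j. j < a \<Longrightarrow> f j = 0" "\<And>j. j \<ge> b \<Longrightarrow> f j = 0"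
  shows "finite {j. f j \<noteq> 0}"
proof (rule finite_subset)
  show "{j. f j \<noteq> 0} \<subseteq> {a..b}"
  proof
    fix j assume "j \<in> {j. f j \<noteq> 0}"
    hence "\<not> j < a" "\<not> j \<ge> b" using assms by blast+
    thus "j \<in> {a..b}" by simp
  qed
qed simp

lemma vertex_coeff_int:
  assumes lin: "\<And>n. FG_linear (exp_coeff A n)"
  shows "vertex_coeff A B n F = Sum_any (\<lambda>j :: int. exp_z A (n + j) (exp_z B j F))"
proof -
  let ?f = "\<lambda>j :: int. exp_z A (n + j) (exp_z B j F)"
  have "vertex_coeff A B n F = Sum_any (\<lambda>j :: nat. ?f (int j))"
    unfolding vertex_coeff_def by (rule Sum_any.cong) (simp add: exp_z_def)
  also have "\<dots> = Sum_any ?f"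
    by (rule Sum_any_nat_int) (simp add: exp_z_def FG_linear_0[OF lin])
  finally show ?thesis .
qed

section \<open>Commutation relations\<close>

lemma comm_family_uminus_FG_pd: "comm_family (\<lambda>k F. - FG_pd (\<phi>, k - 1) F)"
  by unfold_locales
    (simp_all add: FG_linear_def FG_linear_add[OF FG_pd_linear] FG_linear_scale[OF FG_pd_linear]
       FG_linear_minus[OF FG_pd_linear] FG_scale_minus_right FG_pd_commute)

lemma FG_pd_f1_deriv_commute: "FG_pd i (f1_deriv n F) = f1_deriv n (FG_pd i F)"
  unfolding f1_deriv_def FG_linear_sum[OF FG_pd_linear] by (intro sum.cong refl FG_pd_commute)

lemma f1_deriv_commute: "f1_deriv m (f1_deriv n F) = f1_deriv n (f1_deriv m F)"
  unfolding f1_deriv_def[of m] FG_linear_sum[OF f1_deriv_linear] by (intro sum.cong refl FG_pd_f1_deriv_commute)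

lemma comm_family_f1_deriv: "comm_family f1_deriv"
  by unfold_locales (rule f1_deriv_linear, rule f1_deriv_commute)

lemma comm_family_uminus_f1_deriv: "comm_family (\<lambda>k F. - f1_deriv k F)"
  by unfold_locales
    (simp_all add: FG_linear_def FG_linear_add[OF f1_deriv_linear] FG_linear_scale[OF f1_deriv_linear]
       FG_linear_minus[OF f1_deriv_linear] FG_scale_minus_right f1_deriv_commute)

text \<open>The complete symmetric functions of the colour \<open>\<phi>\<close> and, in \<open>h_all\<close>, those of all
colours together, graded by total degree. The exponentials \<open>lower\<close> and \<open>lower_all\<close> of the
negative derivatives belong to them in the same way.\<close>

definition h_sym :: "'a::{finite,field} Phi_star \<Rightarrow> int \<Rightarrow> 'a FG" where
  "h_sym \<phi> = hexp_z (\<lambda>k. FG_scale (1 / of_nat k) (p_star k \<phi>))"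

definition h_all :: "int \<Rightarrow> 'a::{finite,field} FG" where
  "h_all = hexp_z f1_sum"

definition lower :: "'a::{finite,field} Phi_star \<Rightarrow> int \<Rightarrow> 'a FG \<Rightarrow> 'a FG" where
  "lower \<phi> = exp_z (\<lambda>k F. - FG_pd (\<phi>, k - 1) F)"

definition lower_all :: "int \<Rightarrow> 'a::{finite,field} FG \<Rightarrow> 'a FG" where
  "lower_all = exp_z (\<lambda>k F. - f1_deriv k F)"

lemma lower_linear: "FG_linear (lower \<phi> j)"
  unfolding lower_def by (rule exp_z_linear[OF comm_family_uminus_FG_pd])

lemma lower_all_linear: "FG_linear (lower_all j)"
  unfolding lower_all_def by (rule exp_z_linear[OF comm_family_uminus_f1_deriv])

lemma exp_z_commute:
  assumes "comm_family A" "FG_linear T" "\<And>k F. T (A k F) = A k (T F)"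
  shows "T (exp_z A j F) = exp_z A j (T F)"
  using comm_family.exp_coeff_commute[OF assms(1,2,3)] by (simp add: exp_z_def FG_linear_0[OF assms(2)])

lemma FG_pd_lower_commute: "FG_pd i (lower \<phi> j F) = lower \<phi> j (FG_pd i F)"
  unfolding lower_def
  by (rule exp_z_commute[OF comm_family_uminus_FG_pd FG_pd_linear])
    (simp add: FG_linear_minus[OF FG_pd_linear] FG_pd_commute)

lemma FG_pd_lower_all_commute: "FG_pd i (lower_all j F) = lower_all j (FG_pd i F)"
  unfolding lower_all_def
  by (rule exp_z_commute[OF comm_family_uminus_f1_deriv FG_pd_linear])
    (simp add: FG_linear_minus[OF FG_pd_linear] FG_pd_f1_deriv_commute)

lemma lower_commute: "lower \<psi> i (lower \<phi> j F) = lower \<phi> j (lower \<psi> i F)"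
  unfolding lower_def[of \<psi>]
  by (rule exp_z_commute[OF comm_family_uminus_FG_pd lower_linear, symmetric])
    (simp add: FG_linear_minus[OF lower_linear] FG_pd_lower_commute)

lemma lower_lower_all_commute: "lower \<psi> i (lower_all j F) = lower_all j (lower \<psi> i F)"
  unfolding lower_def[of \<psi>]
  by (rule exp_z_commute[OF comm_family_uminus_FG_pd lower_all_linear, symmetric])
    (simp add: FG_linear_minus[OF lower_all_linear] FG_pd_lower_all_commute)

lemma FG_pd_p_star_mult': "k \<ge> 1 \<Longrightarrow> l \<ge> 1 \<Longrightarrow> FG_pd (\<psi>, l - 1) (p_star k \<phi> * F)
    = p_star k \<phi> * FG_pd (\<psi>, l - 1) F + (if \<phi> = \<psi> \<and> k = l then F else 0)"
  by (auto simp: FG_pd_p_star_mult)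

lemma lower_h_sym_same: "lower \<phi> j (h_sym \<phi> n * F) = h_sym \<phi> n * lower \<phi> j F - h_sym \<phi> (n - 1) * lower \<phi> (j - 1) F"
proof -
  have "exp_z (\<lambda>k F. - FG_pd (\<phi>, k - 1) F) j (h_sym \<phi> n * F) = h_sym \<phi> n * exp_z (\<lambda>k F. - FG_pd (\<phi>, k - 1) F) j F
      - h_sym \<phi> (n - int 1) * exp_z (\<lambda>k F. - FG_pd (\<phi>, k - 1) F) (j - int 1) F"
    unfolding h_sym_def
    by (rule exp_z_hexp_z_commutator[OF comm_family_uminus_FG_pd order_refl order_refl])
      (auto simp: FG_pd_p_star_mult' FG_scale_uminus simp del: One_nat_def)
  thus ?thesis by (simp add: lower_def)
qed

lemma lower_all_h_sym: "lower_all j (h_sym \<phi> n * F) = h_sym \<phi> n * lower_all j F - h_sym \<phi> (n - 1) * lower_all (j - int (size_star \<phi>)) F"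
proof -
  have "exp_z (\<lambda>k F. - f1_deriv k F) j (h_sym \<phi> n * F) = h_sym \<phi> n * exp_z (\<lambda>k F. - f1_deriv k F) j F
      - h_sym \<phi> (n - int 1) * exp_z (\<lambda>k F. - f1_deriv k F) (j - int (size_star \<phi>)) F"
    unfolding h_sym_def
    by (rule exp_z_hexp_z_commutator[OF comm_family_uminus_f1_deriv _ order_refl])
      (use size_star_pos[of \<phi>] in \<open>simp_all add: f1_deriv_p_star_mult FG_scale_uminus Suc_le_eq\<close>)
  thus ?thesis by (simp add: lower_all_def)
qed

lemma f1_sum_scale: "k \<ge> 1 \<Longrightarrow> FG_scale (of_nat k) (f1_sum k)
    = (\<Sum>\<psi>\<in>{\<psi>. size_star \<psi> dvd k}. FG_scale (of_nat (size_star \<psi>)) (p_star (k div size_star \<psi>) \<psi>))"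
  by (simp add: f1_sum_def)

lemma dvd_quot_ge_1: "n \<ge> 1 \<Longrightarrow> size_star \<psi> dvd n \<Longrightarrow> n div size_star \<psi> \<ge> 1"
  using size_star_pos[of \<psi>] by (auto simp: Suc_le_eq)

text \<open>Among the summands of \<open>k f1_sum k\<close> only the one of colour \<open>\<phi>\<close> contributes, with its
coefficient \<open>|\<phi>|\<close>.\<close>

lemma FG_pd_f1_sum_mult:
  fixes \<phi> :: "'a::{finite,field} Phi_star"
  assumes k: "k \<ge> 1" and l: "l \<ge> 1"
  shows "FG_pd (\<phi>, l - 1) (FG_scale (of_nat k) (f1_sum k) * F) = FG_scale (of_nat k) (f1_sum k) * FG_pd (\<phi>, l - 1) F
    + FG_scale (if k = l * size_star \<phi> then of_nat (size_star \<phi>) else 0) F"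
proof -
  let ?T = "{\<psi> :: 'a Phi_star. size_star \<psi> dvd k}"
  have fin: "finite ?T" by (rule finite_size_star_dvd) (use k in simp)
  have eq: "\<psi> = \<phi> \<and> k div size_star \<psi> = l \<longleftrightarrow> \<psi> = \<phi> \<and> k = l * size_star \<phi>" if "\<psi> \<in> ?T" for \<psi>
    using that size_star_pos[of \<psi>] by auto
  have "FG_pd (\<phi>, l - 1) (FG_scale (of_nat k) (f1_sum k) * F)
      = (\<Sum>\<psi>\<in>?T. FG_scale (of_nat (size_star \<psi>)) (FG_pd (\<phi>, l - 1) (p_star (k div size_star \<psi>) \<psi> * F)))"
    unfolding f1_sum_scale[OF k] sum_distrib_right FG_linear_sum[OF FG_pd_linear]
    by (simp add: FG_scale_mult_left FG_linear_scale[OF FG_pd_linear])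
  also have "\<dots> = (\<Sum>\<psi>\<in>?T. FG_scale (of_nat (size_star \<psi>)) (p_star (k div size_star \<psi>) \<psi>) * FG_pd (\<phi>, l - 1) F
      + (if \<psi> = \<phi> then FG_scale (if k = l * size_star \<phi> then of_nat (size_star \<phi>) else 0) F else 0))"
  proof (intro sum.cong refl)
    fix \<psi> assume \<psi>: "\<psi> \<in> ?T"
    hence k1: "k div size_star \<psi> \<ge> 1" using dvd_quot_ge_1[OF k] by simp
    show "FG_scale (of_nat (size_star \<psi>)) (FG_pd (\<phi>, l - 1) (p_star (k div size_star \<psi>) \<psi> * F))
       = FG_scale (of_nat (size_star \<psi>)) (p_star (k div size_star \<psi>) \<psi>) * FG_pd (\<phi>, l - 1) F
      + (if \<psi> = \<phi> then FG_scale (if k = l * size_star \<phi> then of_nat (size_star \<phi>) else 0) F else 0)"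
      unfolding FG_pd_p_star_mult'[OF k1 l] eq[OF \<psi>]
      by (auto simp: FG_scale_add_right FG_scale_mult_left)
  qed
  also have "\<dots> = FG_scale (of_nat k) (f1_sum k) * FG_pd (\<phi>, l - 1) F
      + (if \<phi> \<in> ?T then FG_scale (if k = l * size_star \<phi> then of_nat (size_star \<phi>) else 0) F else 0)"
    unfolding sum.distrib f1_sum_scale[OF k] sum_distrib_right using fin by (simp add: sum.delta')
  finally show ?thesis by (auto simp del: One_nat_def)
qed

lemma lower_h_all: "lower \<phi> j (h_all n * F) = h_all n * lower \<phi> j F - h_all (n - int (size_star \<phi>)) * lower \<phi> (j - 1) F"
proof -
  have "exp_z (\<lambda>k F. - FG_pd (\<phi>, k - 1) F) j (h_all n * F) = h_all n * exp_z (\<lambda>k F. - FG_pd (\<phi>, k - 1) F) j F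
      - h_all (n - int (size_star \<phi>)) * exp_z (\<lambda>k F. - FG_pd (\<phi>, k - 1) F) (j - int 1) F"
    unfolding h_all_def
  proof (rule exp_z_hexp_z_commutator[OF comm_family_uminus_FG_pd order_refl])
    show "size_star \<phi> \<ge> 1" using size_star_pos[of \<phi>] by simp
    fix k l :: nat and F :: "'a FG"
    assume kl: "k \<ge> 1" "l \<ge> 1"
    show "- FG_pd (\<phi>, l - 1) (FG_scale (of_nat k) (f1_sum k) * F) = FG_scale (of_nat k) (f1_sum k) * - FG_pd (\<phi>, l - 1) F
        + FG_scale (if k * 1 = l * size_star \<phi> \<and> size_star \<phi> dvd k then - of_nat (size_star \<phi>) else 0) F"
      unfolding FG_pd_f1_sum_mult[OF kl] by (auto simp: FG_scale_uminus)
  qed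
  thus ?thesis by (simp add: lower_def)
qed

lemma lower_p_star_diff: "\<psi> \<noteq> \<phi> \<Longrightarrow> k \<ge> 1 \<Longrightarrow> lower \<phi> j (p_star k \<psi> * F) = p_star k \<psi> * lower \<phi> j F"
proof -
  assume h: "\<psi> \<noteq> \<phi>" "k \<ge> 1"
  have "p_star k \<psi> * - FG_pd (\<phi>, l - 1) F = - FG_pd (\<phi>, l - 1) (p_star k \<psi> * F)" for l F
    using FG_pd_p_star_mult[OF h(2), of \<phi> "l - 1" \<psi> F] h(1) by simp
  thus ?thesis unfolding lower_def by (rule exp_z_commute[OF comm_family_uminus_FG_pd mult_linear, symmetric])
qed

lemma lower_h_sym_diff:
  assumes "\<psi> \<noteq> \<phi>"
  shows "lower \<phi> j (h_sym \<psi> n * F) = h_sym \<psi> n * lower \<phi> j F"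
proof -
  have "lower \<phi> j (FG_scale (1 / of_nat k) (p_star k \<psi>) * F) = FG_scale (1 / of_nat k) (p_star k \<psi>) * lower \<phi> j F" for k F
  proof (cases "k = 0")
    case False thus ?thesis
      by (simp add: FG_scale_mult_left FG_linear_scale[OF lower_linear] lower_p_star_diff[OF assms])
  qed (simp add: FG_linear_0[OF lower_linear])
  note comm_family.exp_coeff_commute[OF mult_comm_family lower_linear[of \<phi> j], of "\<lambda>k. FG_scale (1 / of_nat k) (p_star k \<psi>)", OF this]
  thus ?thesis by (simp add: h_sym_def hexp_z_def exp_coeff_mult FG_linear_0[OF lower_linear])
qed

lemma lower_1: "lower \<phi> j 1 = (if j = 0 then 1 else 0)"
  using comm_family.exp_coeff_one[OF comm_family_uminus_FG_pd, of \<phi> "nat j"] by (auto simp: lower_def exp_z_def)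

lemma lower_all_1: "lower_all j 1 = (if j = 0 then 1 else 0)"
  using comm_family.exp_coeff_one[OF comm_family_uminus_f1_deriv, of "nat j"] by (auto simp: lower_all_def exp_z_def f1_deriv_1)

lemma exp_z_eventually_0:
  assumes "\<exists>K. \<forall>n\<ge>K. exp_coeff A n F = 0"
  shows "\<exists>K. \<forall>j\<ge>K. exp_z A j F = 0"
proof -
  obtain K where K: "\<And>n. n \<ge> K \<Longrightarrow> exp_coeff A n F = 0" using assms by blast
  have "\<forall>j\<ge>int K. exp_z A j F = 0" by (auto simp: exp_z_def intro!: K)
  thus ?thesis by blast
qed

lemma lower_eventually_0: "\<exists>K. \<forall>j\<ge>K. lower \<phi> j F = 0"
  unfolding lower_def
proof (rule exp_z_eventually_0, rule comm_family.exp_coeff_eventually_0[OF comm_family_uminus_FG_pd])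
  show "- FG_pd (\<phi>, l - 1) (p_star k \<psi> * F) = p_star k \<psi> * - FG_pd (\<phi>, l - 1) F + FG_scale (if \<psi> = \<phi> \<and> k = l then - 1 else 0) F"
    if "k \<ge> 1" "l \<ge> 1" for k l \<psi> F
    using that by (auto simp: FG_pd_p_star_mult' FG_scale_uminus simp del: One_nat_def)
  show "\<exists>L. \<forall>l\<ge>L. (if \<psi> = \<phi> \<and> k = l then - 1 else 0 :: complex) = 0" for \<psi> and k :: nat
    by (rule exI[of _ "Suc k"]) auto
qed simp

lemma f1_deriv_exp_eventually_0: "\<exists>K. \<forall>n\<ge>K. exp_coeff f1_deriv n F = 0"
proof (rule comm_family.exp_coeff_eventually_0[OF comm_family_f1_deriv])
  show "f1_deriv l (p_star k \<psi> * F) = p_star k \<psi> * f1_deriv l F + FG_scale (if k * size_star \<psi> = l then 1 else 0) F"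
    if "k \<ge> 1" "l \<ge> 1" for k l \<psi> F
    using that by (auto simp: f1_deriv_p_star_mult simp del: One_nat_def)
  show "\<exists>L. \<forall>l\<ge>L. (if k * size_star \<psi> = l then 1 else 0 :: complex) = 0" for \<psi> k
    by (rule exI[of _ "Suc (k * size_star \<psi>)"]) auto
qed (rule f1_deriv_1)

lemma lower_all_eventually_0: "\<exists>K. \<forall>j\<ge>K. lower_all j F = 0"
  unfolding lower_all_def
proof (rule exp_z_eventually_0, rule comm_family.exp_coeff_eventually_0[OF comm_family_uminus_f1_deriv])
  show "- f1_deriv l (p_star k \<psi> * F) = p_star k \<psi> * - f1_deriv l F + FG_scale (if k * size_star \<psi> = l then - 1 else 0) F"
    if "k \<ge> 1" "l \<ge> 1" for k l \<psi> F
    using that by (auto simp: f1_deriv_p_star_mult FG_scale_uminus simp del: One_nat_def)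
  show "\<exists>L. \<forall>l\<ge>L. (if k * size_star \<psi> = l then - 1 else 0 :: complex) = 0" for \<psi> k
    by (rule exI[of _ "Suc (k * size_star \<psi>)"]) auto
qed (simp add: f1_deriv_1)

lemma lower_neg: "j < 0 \<Longrightarrow> lower \<phi> j F = 0" by (simp add: lower_def exp_z_def)
lemma h_sym_neg: "n < 0 \<Longrightarrow> h_sym \<phi> n = 0" by (simp add: h_sym_def hexp_z_def)
lemma h_all_neg: "n < 0 \<Longrightarrow> h_all n = 0" by (simp add: h_all_def hexp_z_def)

section \<open>The operators \<open>S\<close>\<close>

lemma S_op_Sum_any: "S_op \<phi> n F = Sum_any (\<lambda>j. h_sym \<phi> (n + j) * lower \<phi> j F)"
proof -
  let ?A = "\<lambda>k F. FG_scale (1 / of_nat k) (p_star k \<phi>) * F"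
  let ?B = "\<lambda>k F. - d_star k \<phi> F" and ?B' = "\<lambda>k F. - FG_pd (\<phi>, k - 1) F"
  have B: "exp_coeff ?B = exp_coeff ?B'"
    by (rule ext, rule exp_coeff_cong) (simp add: d_star_eq_FG_pd)
  have "S_op \<phi> n F = Sum_any (\<lambda>j. exp_z ?A (n + j) (exp_z ?B j F))"
    unfolding S_op_def by (rule vertex_coeff_int; rule comm_family.exp_coeff_linear[OF mult_comm_family])
  also have "\<dots> = Sum_any (\<lambda>j. h_sym \<phi> (n + j) * lower \<phi> j F)"
    by (rule Sum_any.cong) (simp add: exp_z_def B exp_coeff_mult h_sym_def hexp_z_def lower_def)
  finally show ?thesis .
qed

lemma S_op_finite: "finite {j. h_sym \<phi> (n + j) * lower \<phi> j F \<noteq> 0}"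
proof -
  obtain K where "\<And>j. j \<ge> K \<Longrightarrow> lower \<phi> j F = 0" using lower_eventually_0 by blast
  thus ?thesis by (intro finite_int_support[of 0 _ K]) (simp_all add: lower_neg)
qed

lemma S_op_linear: "FG_linear (S_op \<phi> n)"
proof (rule FG_linearI)
  fix F G c
  show "S_op \<phi> n (F + G) = S_op \<phi> n F + S_op \<phi> n G"
    unfolding S_op_Sum_any FG_linear_add[OF lower_linear] distrib_left
    by (rule Sum_any.distrib) (rule S_op_finite)+
  show "S_op \<phi> n (FG_scale c F) = FG_scale c (S_op \<phi> n F)"
    unfolding S_op_Sum_any FG_linear_scale[OF lower_linear] FG_scale_mult_right
    by (rule Sum_any_linear[symmetric, OF _ S_op_finite]) (simp add: FG_linear_def FG_scale_add_right mult.commute)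
qed

text \<open>In the sum that defines \<open>S_op\<close> only the factors \<open>h_sym\<close> fail to commute with
\<open>T\<close>, and they contribute one correction term each. The lemma serves both \<open>lower\<close> and
\<open>lower_all\<close>.\<close>

lemma S_op_commutator:
  assumes lin: "FG_linear T" "FG_linear T'"
    and T: "\<And>n F. T (h_sym \<phi> n * F) = h_sym \<phi> n * T F - h_sym \<phi> (n - 1) * T' F"
    and c: "\<And>j F. T (lower \<phi> j F) = lower \<phi> j (T F)" "\<And>j F. T' (lower \<phi> j F) = lower \<phi> j (T' F)"
  shows "T (S_op \<phi> a F) = S_op \<phi> a (T F) - S_op \<phi> (a - 1) (T' F)"
proof -
  have e: "a + j - 1 = a - 1 + j" for j by simp
  show ?thesis
    unfolding S_op_Sum_any Sum_any_linear[OF lin(1) S_op_finite] T c e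
    by (rule Sum_any_diff) (rule S_op_finite)+
qed

lemma S_op_commute_linear:
  assumes lin: "FG_linear T"
    and T: "\<And>n F. T (h_sym \<phi> n * F) = h_sym \<phi> n * T F"
    and c: "\<And>j F. T (lower \<phi> j F) = lower \<phi> j (T F)"
  shows "T (S_op \<phi> a F) = S_op \<phi> a (T F)"
  unfolding S_op_Sum_any Sum_any_linear[OF lin S_op_finite] T c ..

lemma lower_S_op: "lower \<phi> i (S_op \<phi> a F) = S_op \<phi> a (lower \<phi> i F) - S_op \<phi> (a - 1) (lower \<phi> (i - 1) F)"
  by (rule S_op_commutator[OF lower_linear lower_linear lower_h_sym_same lower_commute lower_commute])

lemma lower_S_op_diff: "\<phi> \<noteq> \<psi> \<Longrightarrow> lower \<psi> i (S_op \<phi> a F) = S_op \<phi> a (lower \<psi> i F)"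
  by (rule S_op_commute_linear[OF lower_linear lower_h_sym_diff lower_commute]) simp

lemma lower_all_S_op: "lower_all i (S_op \<phi> a F) = S_op \<phi> a (lower_all i F) - S_op \<phi> (a - 1) (lower_all (i - int (size_star \<phi>)) F)"
  by (rule S_op_commutator[OF lower_all_linear lower_all_linear lower_all_h_sym]) (rule lower_lower_all_commute[symmetric])+

lemma S_op_commute:
  assumes "\<phi> \<noteq> \<psi>"
  shows "S_op \<phi> a (S_op \<psi> b F) = S_op \<psi> b (S_op \<phi> a F)"
proof -
  have "h_sym \<psi> n * S_op \<phi> a F = S_op \<phi> a (h_sym \<psi> n * F)" for n F
    using assms lower_h_sym_diff[of \<psi> \<phi>]
    by (intro S_op_commute_linear[OF mult_linear]) (auto simp: mult_ac)
  thus ?thesis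
    by (intro S_op_commute_linear[OF S_op_linear]) (simp_all add: lower_S_op_diff[OF assms])
qed

text \<open>Moving \<open>h_all\<close> through the lowering half of \<open>S\<close> produces, for generating functions, the
factor in \<open>S(u) H(v) = (1 - v^d / u) H(v) S(u)\<close>.\<close>

lemma S_op_h_all: "S_op \<phi> a (h_all n * F) = h_all n * S_op \<phi> a F - h_all (n - int (size_star \<phi>)) * S_op \<phi> (a + 1) F"
proof -
  let ?d = "int (size_star \<phi>)"
  have "S_op \<phi> a (h_all n * F) = Sum_any (\<lambda>j. h_all n * (h_sym \<phi> (a + j) * lower \<phi> j F)
      - h_all (n - ?d) * (h_sym \<phi> (a + j) * lower \<phi> (j - 1) F))"
    unfolding S_op_Sum_any by (rule Sum_any.cong)
      (simp only: lower_h_all right_diff_distrib mult.left_commute[of "h_sym \<phi> _" "h_all _"])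
  also have "\<dots> = Sum_any (\<lambda>j. h_all n * (h_sym \<phi> (a + j) * lower \<phi> j F)) - Sum_any (\<lambda>j. h_all (n - ?d) * (h_sym \<phi> (a + j) * lower \<phi> (j - 1) F))"
  proof (rule Sum_any_diff)
    show "finite {j. h_all n * (h_sym \<phi> (a + j) * lower \<phi> j F) \<noteq> 0}"
      by (rule finite_subset[OF _ S_op_finite[of \<phi> a F]]) auto
    obtain K where "\<And>j. j \<ge> K \<Longrightarrow> lower \<phi> j F = 0" using lower_eventually_0 by blast
    thus "finite {j. h_all (n - ?d) * (h_sym \<phi> (a + j) * lower \<phi> (j - 1) F) \<noteq> 0}"
      by (intro finite_int_support[of 0 _ "K + 1"]) (simp_all add: lower_neg)
  qed
  also have "Sum_any (\<lambda>j. h_all (n - ?d) * (h_sym \<phi> (a + j) * lower \<phi> (j - 1) F))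
      = Sum_any (\<lambda>j. h_all (n - ?d) * (h_sym \<phi> (a + 1 + j) * lower \<phi> j F))"
    using Sum_any_shift[of "\<lambda>j. h_all (n - ?d) * (h_sym \<phi> (a + j) * lower \<phi> (j - 1) F)" 1]
    by (simp add: algebra_simps)
  finally show ?thesis
    by (simp only: S_op_Sum_any Sum_any_linear[OF mult_linear S_op_finite])
qed

section \<open>The adjoint of \<open>Q\<close> and its passage through \<open>S\<close>\<close>

text \<open>The generating function of \<open>lower \<phi>\<close> applied to \<open>F\<close> is a polynomial of degree at
most \<open>k\<close>. Since \<open>p_k(\<phi>)\<close> has high degree in this sense but
\<open>h_sym \<phi> n\<close> has degree \<open>1\<close>, this counts the number of factors
\<open>S_op \<phi>\<close>, whatever their indices are.\<close>

definition lower_le :: "'a::{finite,field} Phi_star \<Rightarrow> nat \<Rightarrow> 'a FG \<Rightarrow> bool" where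
  "lower_le \<phi> k F \<longleftrightarrow> (\<forall>j>int k. lower \<phi> j F = 0)"

lemma lower_le_1: "lower_le \<phi> 0 1"
  by (simp add: lower_le_def lower_1)

lemma lower_le_S_op: "lower_le \<phi> k F \<Longrightarrow> lower_le \<phi> (Suc k) (S_op \<phi> a F)"
  by (simp add: lower_le_def lower_S_op FG_linear_0[OF S_op_linear])

lemma lower_le_S_op_diff: "\<phi> \<noteq> \<psi> \<Longrightarrow> lower_le \<psi> k F \<Longrightarrow> lower_le \<psi> k (S_op \<phi> a F)"
  by (simp add: lower_le_def lower_S_op_diff FG_linear_0[OF S_op_linear])

lemma lower_le_lower_all: "lower_le \<phi> k F \<Longrightarrow> lower_le \<phi> k (lower_all n F)"
  by (simp add: lower_le_def lower_lower_all_commute FG_linear_0[OF lower_all_linear])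

text \<open>In \<open>h_sym \<phi> (b + j)\<close> times \<open>lower \<phi> j F\<close> either the first index is negative or
the second exceeds \<open>k\<close>. This sharp bound is responsible for the bound on \<open>\<tau>\<close> in the
theorem.\<close>

lemma S_op_eq_0:
  assumes "lower_le \<phi> k F" "b < - int k"
  shows "S_op \<phi> b F = 0"
proof -
  have "h_sym \<phi> (b + j) * lower \<phi> j F = 0" for j
    using assms by (cases "j > int k") (auto simp: lower_le_def h_sym_neg)
  thus ?thesis by (simp add: S_op_Sum_any)
qed

text \<open>The coefficient of \<open>w^m\<close> in \<open>V(w)\<close>. In \<open>Q_adj_mid\<close> an \<open>S_op\<close> is
placed between the two factors of \<open>V\<close>: commuting \<open>S_op\<close> through the two factors
separately relates it to \<open>Q_adj\<close> on either side.\<close>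

definition Q_adj :: "int \<Rightarrow> 'a::{finite,field} FG \<Rightarrow> 'a FG" where
  "Q_adj m F = Sum_any (\<lambda>j. FG_scale (of_nat CARD('a) powi (- j)) (h_all j * lower_all (m + j) F))"

definition Q_adj_mid :: "'a::{finite,field} Phi_star \<Rightarrow> int \<Rightarrow> int \<Rightarrow> 'a FG \<Rightarrow> 'a FG" where
  "Q_adj_mid \<phi> a m F = Sum_any (\<lambda>j. FG_scale (of_nat CARD('a) powi (- j)) (h_all j * S_op \<phi> a (lower_all (m + j) F)))"

lemma lower_all_finite:
  assumes "FG_linear T"
  shows "finite {j. FG_scale (c j) (h_all (j - e) * T (lower_all (m + j) F)) \<noteq> 0}"
proof -
  obtain K where "\<And>j. j \<ge> K \<Longrightarrow> lower_all j F = 0" using lower_all_eventually_0 by blast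
  thus ?thesis
    by (intro finite_int_support[of e _ "K - m"]) (simp_all add: h_all_neg FG_linear_0[OF assms])
qed

lemma id_linear: "FG_linear (\<lambda>F. F)" by (simp add: FG_linear_def)

lemma Q_adj_finite: "finite {j. FG_scale (c j) (h_all j * lower_all (m + j) F) \<noteq> 0}"
  using lower_all_finite[OF id_linear, of c 0] by simp

lemma Q_adj_mid_finite: "finite {j. FG_scale (c j) (h_all j * S_op \<phi> a (lower_all (m + j) F)) \<noteq> 0}"
  using lower_all_finite[OF S_op_linear, of c 0] by simp

text \<open>Moving the lowering half of \<open>V\<close> through \<open>S\<close> costs the factor \<open>1 - x\<close>.\<close>

lemma Q_adj_S_op_mid: "Q_adj m (S_op \<phi> a F) = Q_adj_mid \<phi> a m F - Q_adj_mid \<phi> (a - 1) (m - int (size_star \<phi>)) F"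
proof -
  have e: "m + j - int (size_star \<phi>) = m - int (size_star \<phi>) + j" for j by simp
  show ?thesis unfolding Q_adj_def Q_adj_mid_def lower_all_S_op right_diff_distrib FG_scale_diff_right e
    by (rule Sum_any_diff) (rule Q_adj_mid_finite)+
qed

text \<open>The raising half of \<open>V\<close> passes \<open>S\<close> with the factor \<open>1 - 1/(q^d x)\<close> on the
wrong side; shifting the summation index by \<open>d\<close> turns the second term into another instance of the
middle operator.\<close>

lemma Q_adj_mid_step:
  fixes F :: "'a::{finite,field} FG"
  shows "Q_adj_mid \<phi> a m F = S_op \<phi> a (Q_adj m F)
    + FG_scale (of_nat CARD('a) powi (- int (size_star \<phi>))) (Q_adj_mid \<phi> (a + 1) (m + int (size_star \<phi>)) F)"
proof -
  let ?d = "int (size_star \<phi>)"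
  let ?q = "of_nat CARD('a) :: complex"
  have q: "?q \<noteq> 0" by simp
  have t: "h_all j * S_op \<phi> a G = S_op \<phi> a (h_all j * G) + h_all (j - ?d) * S_op \<phi> (a + 1) G" for j G
    by (simp add: S_op_h_all)
  have "Q_adj_mid \<phi> a m F = Sum_any (\<lambda>j. FG_scale (?q powi - j) (S_op \<phi> a (h_all j * lower_all (m + j) F))
      + FG_scale (?q powi - j) (h_all (j - ?d) * S_op \<phi> (a + 1) (lower_all (m + j) F)))"
    unfolding Q_adj_mid_def by (rule Sum_any.cong) (simp only: t FG_scale_add_right)
  also have "\<dots> = Sum_any (\<lambda>j. S_op \<phi> a (FG_scale (?q powi - j) (h_all j * lower_all (m + j) F)))
      + Sum_any (\<lambda>j. FG_scale (?q powi - j) (h_all (j - ?d) * S_op \<phi> (a + 1) (lower_all (m + j) F)))"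
    unfolding FG_linear_scale[OF S_op_linear, symmetric]
  proof (rule Sum_any.distrib)
    show "finite {j. S_op \<phi> a (FG_scale (?q powi - j) (h_all j * lower_all (m + j) F)) \<noteq> 0}"
      by (rule finite_subset[OF _ Q_adj_finite[of "\<lambda>j. ?q powi - j" m F]]) (auto simp: FG_linear_0[OF S_op_linear])
    show "finite {j. FG_scale (?q powi - j) (h_all (j - ?d) * S_op \<phi> (a + 1) (lower_all (m + j) F)) \<noteq> 0}"
      by (rule lower_all_finite[OF S_op_linear])
  qed
  also have "Sum_any (\<lambda>j. S_op \<phi> a (FG_scale (?q powi - j) (h_all j * lower_all (m + j) F))) = S_op \<phi> a (Q_adj m F)"
    unfolding Q_adj_def by (rule Sum_any_linear[OF S_op_linear Q_adj_finite, symmetric])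
  also have "Sum_any (\<lambda>j. FG_scale (?q powi - j) (h_all (j - ?d) * S_op \<phi> (a + 1) (lower_all (m + j) F)))
      = Sum_any (\<lambda>j. FG_scale (?q powi - (j + ?d)) (h_all j * S_op \<phi> (a + 1) (lower_all (m + ?d + j) F)))"
    using Sum_any_shift[of "\<lambda>j. FG_scale (?q powi - j) (h_all (j - ?d) * S_op \<phi> (a + 1) (lower_all (m + j) F))" ?d]
    by (simp add: algebra_simps)
  also have "\<dots> = Sum_any (\<lambda>j. FG_scale (?q powi - ?d) (FG_scale (?q powi - j) (h_all j * S_op \<phi> (a + 1) (lower_all (m + ?d + j) F))))"
    by (rule Sum_any.cong) (simp add: power_int_add[OF disjI1[OF q], symmetric] algebra_simps)
  also have "\<dots> = FG_scale (?q powi - ?d) (Q_adj_mid \<phi> (a + 1) (m + ?d) F)"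
    unfolding Q_adj_mid_def
    by (rule Sum_any_linear[OF _ Q_adj_mid_finite, symmetric]) (simp add: FG_linear_def FG_scale_add_right mult.commute)
  finally show ?thesis .
qed

text \<open>Solved for the instance with the larger index, the relation lowers \<open>a\<close>. Iterating it in this direction
is the expansion in positive powers of \<open>x\<close>.\<close>

lemma Q_adj_mid_step':
  fixes F :: "'a::{finite,field} FG"
  shows "Q_adj_mid \<phi> a m F = FG_scale (of_nat CARD('a) ^ size_star \<phi>)
     (Q_adj_mid \<phi> (a - 1) (m - int (size_star \<phi>)) F - S_op \<phi> (a - 1) (Q_adj (m - int (size_star \<phi>)) F))"
  using Q_adj_mid_step[of \<phi> "a - 1" "m - int (size_star \<phi>)" F] by (simp add: power_int_minus)

lemma Q_adj_mid_eq_0: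
  assumes "lower_le \<phi> k F" "a < - int k"
  shows "Q_adj_mid \<phi> a m F = 0"
  by (simp add: Q_adj_mid_def S_op_eq_0[OF lower_le_lower_all[OF assms(1)] assms(2)])

lemma sum_from_1_Suc: "(\<Sum>i=1..Suc J. g i) = g 1 + (\<Sum>i=1..J. g (Suc i))"
  by (induct J) (simp_all add: add.assoc)

text \<open>The iteration stops because the middle operator vanishes as soon as \<open>a < -k\<close>.\<close>

lemma Q_adj_mid_sum:
  fixes F :: "'a::{finite,field} FG"
  assumes "lower_le \<phi> k F"
  shows "a - int J < - int k \<Longrightarrow> Q_adj_mid \<phi> a m F = - (\<Sum>i=1..J. FG_scale (of_nat CARD('a) ^ (size_star \<phi> * i))
      (S_op \<phi> (a - int i) (Q_adj (m - int (size_star \<phi> * i)) F)))"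
proof (induct J arbitrary: a m)
  case 0
  thus ?case using Q_adj_mid_eq_0[OF assms] by simp
next
  case (Suc J)
  let ?d = "size_star \<phi>"
  let ?q = "of_nat CARD('a) :: complex"
  let ?g = "\<lambda>i. FG_scale (?q ^ (?d * i)) (S_op \<phi> (a - int i) (Q_adj (m - int (?d * i)) F))"
  have "Q_adj_mid \<phi> (a - 1) (m - int ?d) F = - (\<Sum>i=1..J. FG_scale (?q ^ (?d * i))
      (S_op \<phi> (a - 1 - int i) (Q_adj (m - int ?d - int (?d * i)) F)))"
    using Suc(2) by (intro Suc(1)) simp
  hence "Q_adj_mid \<phi> a m F = - (\<Sum>i=1..J. FG_scale (?q ^ ?d) (FG_scale (?q ^ (?d * i))
      (S_op \<phi> (a - 1 - int i) (Q_adj (m - int ?d - int (?d * i)) F)))) - ?g 1"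
    by (subst Q_adj_mid_step') (simp add: FG_scale_diff_right FG_scale_minus_right FG_scale_sum)
  also have "(\<Sum>i=1..J. FG_scale (?q ^ ?d) (FG_scale (?q ^ (?d * i))
      (S_op \<phi> (a - 1 - int i) (Q_adj (m - int ?d - int (?d * i)) F)))) = (\<Sum>i=1..J. ?g (Suc i))"
    by (intro sum.cong refl) (simp add: power_add algebra_simps)
  also have "- (\<Sum>i=1..J. ?g (Suc i)) - ?g 1 = - (\<Sum>i=1..Suc J. ?g i)"
    unfolding sum_from_1_Suc by simp
  finally show ?case .
qed

text \<open>The factor is \<open>(1 - x) (- \<Sum>i\<ge>1. q^(d i) x^i)\<close>: its first coefficient is \<open>-q^d\<close>,
and the coefficient of \<open>x^i\<close> for \<open>i > 1\<close> is
\<open>q^(d (i - 1)) - q^(d i) = q^(d i) (q^(-d) - 1)\<close>. These are the values of \<open>B_coeff\<close>.\<close>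

lemma Q_adj_S_op:
  fixes F :: "'a::{finite,field} FG"
  assumes L: "lower_le \<phi> k F"
  shows "Q_adj m (S_op \<phi> (int a) F) = (\<Sum>i=1..a + Suc k.
     FG_scale ((of_nat CARD('a) ^ size_star \<phi>) ^ i * B_coeff (of_nat CARD('a) ^ size_star \<phi>) i)
       (S_op \<phi> (int a - int i) (Q_adj (m - int (size_star \<phi> * i)) F)))"
proof -
  let ?d = "size_star \<phi>"
  let ?q = "of_nat CARD('a) :: complex"
  let ?g = "\<lambda>i. S_op \<phi> (int a - int i) (Q_adj (m - int (?d * i)) F)"
  have q: "?q \<noteq> 0" by simp
  \<comment> \<open>The iteration from \<open>a - 1\<close> stops after \<open>a + k\<close> steps, at the index \<open>- k - 1\<close>.\<close>
  have W: "Q_adj_mid \<phi> (int a - 1) (m - int ?d) F = - (\<Sum>i=1..a + k. FG_scale ((?q ^ ?d) ^ i) (?g (Suc i)))"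
    unfolding power_mult[symmetric]
    by (subst Q_adj_mid_sum[OF L, of _ "a + k"]) (simp_all add: algebra_simps)
  have "Q_adj m (S_op \<phi> (int a) F) = FG_scale (?q ^ ?d) (Q_adj_mid \<phi> (int a - 1) (m - int ?d) F - ?g 1) - Q_adj_mid \<phi> (int a - 1) (m - int ?d) F"
    unfolding Q_adj_S_op_mid by (subst Q_adj_mid_step') simp
  also have "\<dots> = FG_scale (- (?q ^ ?d)) (?g 1) + FG_scale (?q ^ ?d - 1) (Q_adj_mid \<phi> (int a - 1) (m - int ?d) F)"
    using FG_scale_add_left[of "?q ^ ?d" "-1" "Q_adj_mid \<phi> (int a - 1) (m - int ?d) F"]
    by (simp add: FG_scale_diff_right FG_scale_uminus)
  also have "FG_scale (?q ^ ?d - 1) (Q_adj_mid \<phi> (int a - 1) (m - int ?d) F)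
      = (\<Sum>i=1..a + k. FG_scale ((?q ^ ?d) ^ Suc i * B_coeff (?q ^ ?d) (Suc i)) (?g (Suc i)))"
    unfolding W FG_scale_uminus[symmetric] FG_scale_minus_right FG_scale_sum sum_negf[symmetric] FG_scale_scale
    by (intro sum.cong refl arg_cong2[where f = FG_scale])
      (use q in \<open>auto simp: B_coeff_def field_simps\<close>)
  also have "FG_scale (- (?q ^ ?d)) (?g 1) = FG_scale ((?q ^ ?d) ^ 1 * B_coeff (?q ^ ?d) 1) (?g 1)"
    by (simp add: B_coeff_def)
  also have "\<dots> + (\<Sum>i=1..a + k. FG_scale ((?q ^ ?d) ^ Suc i * B_coeff (?q ^ ?d) (Suc i)) (?g (Suc i)))
      = (\<Sum>i=1..a + Suc k. FG_scale ((?q ^ ?d) ^ i * B_coeff (?q ^ ?d) i) (?g i))"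
    unfolding add_Suc_right by (rule sum_from_1_Suc[symmetric])
  finally show ?thesis .
qed

section \<open>Iteration over the rows of one colour\<close>

text \<open>The entries of \<open>\<tau>\<close> in one colour. The bound on an entry depends only on its row and the number of
rows below it, so these sets have the product structure used in the induction on the rows.\<close>

definition sub_comp_lists :: "nat list \<Rightarrow> nat list set" where
  "sub_comp_lists \<alpha> = {\<tau>. length \<tau> = length \<alpha> \<and> (\<forall>i<length \<alpha>. 0 < \<tau> ! i \<and> \<tau> ! i \<le> add_staircase \<alpha> ! i)}"

lemma sub_comp_lists_Nil: "sub_comp_lists [] = {[]}"
  by (auto simp: sub_comp_lists_def)

lemma add_staircase_Cons: "add_staircase (a # \<alpha>) = (a + Suc (length \<alpha>)) # add_staircase \<alpha>"
  by (simp add: add_staircase_def upt_conv_Cons map_Suc_upt[symmetric] del: upt_Suc)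

lemma sub_comp_lists_Cons:
  "i # \<tau> \<in> sub_comp_lists (a # \<alpha>) \<longleftrightarrow> i \<in> {1..a + Suc (length \<alpha>)} \<and> \<tau> \<in> sub_comp_lists \<alpha>"
  unfolding sub_comp_lists_def add_staircase_Cons by (auto simp: All_less_Suc2 Suc_le_eq)

lemma sum_sub_comp_lists_Cons:
  "(\<Sum>\<tau>\<in>sub_comp_lists (a # \<alpha>). f \<tau>) = (\<Sum>i=1..a + Suc (length \<alpha>). \<Sum>\<tau>\<in>sub_comp_lists \<alpha>. f (i # \<tau>))"
proof -
  have "(\<Sum>i=1..a + Suc (length \<alpha>). \<Sum>\<tau>\<in>sub_comp_lists \<alpha>. f (i # \<tau>))
      = (\<Sum>(i, \<tau>)\<in>{1..a + Suc (length \<alpha>)} \<times> sub_comp_lists \<alpha>. f (i # \<tau>))"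
    by (rule sum.cartesian_product)
  also have "\<dots> = (\<Sum>\<tau>\<in>sub_comp_lists (a # \<alpha>). f \<tau>)"
  proof (rule sum.reindex_bij_witness[where i = "\<lambda>\<tau>. (hd \<tau>, tl \<tau>)" and j = "\<lambda>(i, \<tau>). i # \<tau>"])
    fix \<tau> assume \<tau>: "\<tau> \<in> sub_comp_lists (a # \<alpha>)"
    hence "length \<tau> = Suc (length \<alpha>)" by (simp add: sub_comp_lists_def)
    then obtain i \<tau>' where "\<tau> = i # \<tau>'" by (auto simp: length_Suc_conv)
    thus "(hd \<tau>, tl \<tau>) \<in> {1..a + Suc (length \<alpha>)} \<times> sub_comp_lists \<alpha>"
      "(case (hd \<tau>, tl \<tau>) of (i, \<tau>) \<Rightarrow> i # \<tau>) = \<tau>"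
      using \<tau> sub_comp_lists_Cons by auto
  qed (auto simp: sub_comp_lists_Cons)
  finally show ?thesis by simp
qed

lemma S_seq_Nil [simp]: "S_seq \<phi> [] F = F" and S_seq_Cons: "S_seq \<phi> (x # xs) F = S_op \<phi> x (S_seq \<phi> xs F)"
  and S_seq_append: "S_seq \<phi> (xs @ ys) F = S_seq \<phi> xs (S_seq \<phi> ys F)"
  by (simp_all add: S_seq_def)

lemma S_seq_linear: "FG_linear (S_seq \<phi> xs)"
proof (induct xs)
  case (Cons x xs)
  thus ?case using S_op_linear[of \<phi> x] by (simp add: FG_linear_def S_seq_Cons)
qed (simp add: FG_linear_def)

lemma S_seq_commute_op: "\<phi> \<noteq> \<psi> \<Longrightarrow> S_op \<phi> a (S_seq \<psi> ys F) = S_seq \<psi> ys (S_op \<phi> a F)"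
  by (induct ys) (simp_all add: S_seq_Cons S_op_commute[of \<phi> \<psi>])

lemma S_seq_commute: "\<phi> \<noteq> \<psi> \<Longrightarrow> S_seq \<phi> xs (S_seq \<psi> ys F) = S_seq \<psi> ys (S_seq \<phi> xs F)"
  by (induct xs) (simp_all add: S_seq_Cons S_seq_commute_op)

lemma lower_le_S_seq: "lower_le \<phi> 0 F \<Longrightarrow> lower_le \<phi> (length xs) (S_seq \<phi> xs F)"
  by (induct xs) (auto simp: S_seq_Cons lower_le_S_op)

lemma lower_le_S_seq_diff: "\<phi> \<noteq> \<psi> \<Longrightarrow> lower_le \<psi> k F \<Longrightarrow> lower_le \<psi> k (S_seq \<phi> xs F)"
  by (induct xs) (auto simp: S_seq_Cons lower_le_S_op_diff)

text \<open>The part of \<open>B_colored\<close> belonging to one colour, together with the power of \<open>q\<close> that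
accompanies it.\<close>

definition row_coeff :: "complex \<Rightarrow> nat list \<Rightarrow> complex" where
  "row_coeff Q \<tau> = (\<Prod>t\<leftarrow>\<tau>. Q ^ t * B_coeff Q t)"

text \<open>The innermost rows are created first, so the vector below a row with \<open>k\<close> rows after it satisfies
\<open>lower_le \<phi> k\<close>; this gives the staircase in the bounds.\<close>

lemma Q_adj_S_seq:
  fixes G :: "'a::{finite,field} FG"
  assumes L: "lower_le \<phi> 0 G"
  shows "Q_adj m (S_seq \<phi> (map int \<alpha>) G) = (\<Sum>\<tau>\<in>sub_comp_lists \<alpha>.
     FG_scale (row_coeff (of_nat CARD('a) ^ size_star \<phi>) \<tau>)
       (S_seq \<phi> (map2 (\<lambda>a b. int a - int b) \<alpha> \<tau>) (Q_adj (m - int (size_star \<phi> * sum_list \<tau>)) G)))"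
proof (induct \<alpha> arbitrary: m)
  case Nil
  show ?case by (simp add: sub_comp_lists_Nil row_coeff_def)
next
  case (Cons a \<alpha>)
  let ?Q = "of_nat CARD('a) ^ size_star \<phi> :: complex"
  let ?d = "size_star \<phi>"
  have "Q_adj m (S_seq \<phi> (map int (a # \<alpha>)) G) = (\<Sum>i=1..a + Suc (length \<alpha>). FG_scale (?Q ^ i * B_coeff ?Q i)
      (S_op \<phi> (int a - int i) (Q_adj (m - int (?d * i)) (S_seq \<phi> (map int \<alpha>) G))))"
    using Q_adj_S_op[OF lower_le_S_seq[OF L, of "map int \<alpha>"], of m a] by (simp add: S_seq_Cons)
  also have "\<dots> = (\<Sum>i=1..a + Suc (length \<alpha>). \<Sum>\<tau>\<in>sub_comp_lists \<alpha>. FG_scale (row_coeff ?Q (i # \<tau>))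
       (S_seq \<phi> (map2 (\<lambda>a b. int a - int b) (a # \<alpha>) (i # \<tau>)) (Q_adj (m - int (?d * sum_list (i # \<tau>))) G)))"
    unfolding Cons FG_linear_sum[OF S_op_linear] FG_linear_scale[OF S_op_linear] FG_scale_sum FG_scale_scale
    by (intro sum.cong refl) (simp add: row_coeff_def S_seq_Cons algebra_simps)
  also have "\<dots> = (\<Sum>\<tau>\<in>sub_comp_lists (a # \<alpha>). FG_scale (row_coeff ?Q \<tau>)
       (S_seq \<phi> (map2 (\<lambda>a b. int a - int b) (a # \<alpha>) \<tau>) (Q_adj (m - int (?d * sum_list \<tau>)) G)))"
    by (rule sum_sub_comp_lists_Cons[symmetric])
  finally show ?case .
qed

section \<open>Identification of the adjoint\<close>

text \<open>The factor \<open>|\<phi>| / n\<close> in \<open>f1_sum\<close> is the inverse of the factor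
\<open>n / |\<phi>|\<close> in the adjunction for \<open>p_(n/|\<phi>|)(\<phi>)\<close>.\<close>

lemma FG_inner_f1_sum_mult:
  fixes F G :: "'a::{finite,field} FG"
  assumes k: "k \<ge> 1"
  shows "FG_inner (f1_sum k * F) G = FG_inner F (f1_deriv k G)"
proof -
  let ?T = "{\<psi> :: 'a Phi_star. size_star \<psi> dvd k}"
  have "FG_inner (f1_sum k * F) G = 1 / of_nat k * (\<Sum>\<psi>\<in>?T. of_nat (size_star \<psi>) * FG_inner (p_star (k div size_star \<psi>) \<psi> * F) G)"
    by (simp add: f1_sum_def FG_scale_mult_left FG_inner_scale_left sum_distrib_right FG_inner_sum_left)
  also have "\<dots> = (\<Sum>\<psi>\<in>?T. FG_inner F (FG_pd (\<psi>, k div size_star \<psi> - 1) G))"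
    unfolding sum_distrib_left
  proof (intro sum.cong refl)
    fix \<psi> assume "\<psi> \<in> ?T"
    hence d: "size_star \<psi> dvd k" by simp
    have "(of_nat (size_star \<psi>) * of_nat (k div size_star \<psi>) :: complex) = of_nat k"
      using d by (simp flip: of_nat_mult)
    moreover have "(of_nat k :: complex) \<noteq> 0" using k by simp
    ultimately show "1 / of_nat k * (of_nat (size_star \<psi>) * FG_inner (p_star (k div size_star \<psi>) \<psi> * F) G)
        = FG_inner F (FG_pd (\<psi>, k div size_star \<psi> - 1) G)"
      unfolding FG_inner_p_star_mult[OF dvd_quot_ge_1[OF k d]] FG_inner_scale_right
      by (simp add: field_simps flip: mult.assoc)
  qed
  also have "\<dots> = FG_inner F (f1_deriv k G)" by (simp add: f1_deriv_def FG_inner_sum_right)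
  finally show ?thesis .
qed

lemma FG_inner_uminus_left: "FG_inner (- F) G = - FG_inner F G"
  using FG_inner_scale_left[of "-1" F G] by (simp add: FG_scale_uminus)

lemma FG_inner_uminus_right: "FG_inner F (- G) = - FG_inner F G"
  using FG_inner_scale_right[of F "-1" G] by (simp add: FG_scale_uminus)

text \<open>The exponents of \<open>Q\<close> are \<open>- (-1)^k f1_sum k z^k\<close> and
\<open>(-1/q)^k f1_deriv k z^(-k)\<close>, so that the adjunction exchanges them with the exponents of
\<open>V\<close>. The two families of signs leave \<open>(-1)^(m+j) (-1)^j = (-1)^m\<close>.\<close>

lemma FG_inner_Q_op:
  fixes F G :: "'a::{finite,field} FG"
  shows "FG_inner G (Q_op (int m) F) = (-1) ^ m * FG_inner (Q_adj (int m) G) F"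
proof -
  let ?q = "of_nat CARD('a) :: complex"
  let ?A = "\<lambda>k F. FG_scale ((?q ^ k - 1) / of_nat k) (p_Phi k f1) * F :: 'a FG"
  let ?B = "\<lambda>k F. - FG_scale (1 / ?q ^ k) (d_Phi k f1 F) :: 'a FG"
  let ?A' = "\<lambda>k F. - f1_sum k * F :: 'a FG"
  have q: "?q \<noteq> 0" by simp
  have sg: "- ((-1) ^ (k - 1)) = ((-1) ^ k :: complex)" if "k \<ge> 1" for k
    using that by (cases k) auto
  have A: "exp_coeff ?A i H = FG_scale ((-1) ^ i) (exp_coeff ?A' i H)" for i H
  proof -
    have "exp_coeff ?A i = exp_coeff (\<lambda>k F. FG_scale ((-1) ^ k) (?A' k F)) i"
    proof (rule exp_coeff_cong, rule ext)
      fix k :: nat and F :: "'a FG" assume k: "k \<ge> 1"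
      have "(?q ^ k - 1) \<noteq> 0" using of_nat_card_power_minus_1(2)[of k, where 'a='a] k by simp
      hence "(?q ^ k - 1) / of_nat k * ((-1) ^ (k - 1) * of_nat k / (?q ^ k - 1)) = (-1) ^ (k - 1)"
        using k by (simp add: field_simps)
      hence "?A k F = FG_scale ((-1) ^ (k - 1)) (f1_sum k) * F"
        by (simp only: p_Phi_f1[OF k] FG_scale_scale)
      thus "?A k F = FG_scale ((-1) ^ k) (?A' k F)"
        unfolding sg[OF k, symmetric] by (simp add: FG_scale_uminus FG_scale_minus_right FG_scale_mult_left)
    qed
    thus ?thesis by (simp only: comm_family.exp_coeff_scale_powers[OF mult_comm_family])
  qed
  have B: "exp_coeff ?B i H = FG_scale ((- 1 / ?q) ^ i) (exp_coeff f1_deriv i H)" for i H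
  proof -
    have "exp_coeff ?B i = exp_coeff (\<lambda>k F. FG_scale ((- 1 / ?q) ^ k) (f1_deriv k F)) i"
    proof (rule exp_coeff_cong, rule ext)
      fix k :: nat and F :: "'a FG" assume k: "k \<ge> 1"
      have "(- 1 / ?q) ^ k = - (1 / ?q ^ k * (-1) ^ (k - 1))"
        unfolding power_divide sg[OF k, symmetric] by simp
      thus "?B k F = FG_scale ((- 1 / ?q) ^ k) (f1_deriv k F)"
        by (simp only: d_Phi_f1[OF k] FG_scale_scale FG_scale_uminus)
    qed
    thus ?thesis by (simp only: comm_family.exp_coeff_scale_powers[OF comm_family_f1_deriv])
  qed
  have adjA: "FG_inner G (exp_coeff ?A' i H) = FG_inner (lower_all (int i) G) H" for i H
  proof -
    have "FG_inner (exp_coeff ?A' i H) G = FG_inner H (exp_coeff (\<lambda>k F. - f1_deriv k F) i G)"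
      by (rule exp_coeff_adjoint[OF mult_comm_family comm_family_uminus_f1_deriv])
        (simp add: FG_inner_uminus_left FG_inner_uminus_right FG_inner_f1_sum_mult)
    hence "cnj (FG_inner (exp_coeff ?A' i H) G) = cnj (FG_inner H (exp_coeff (\<lambda>k F. - f1_deriv k F) i G))"
      by (rule arg_cong)
    hence "FG_inner G (exp_coeff ?A' i H) = FG_inner (exp_coeff (\<lambda>k F. - f1_deriv k F) i G) H"
      unfolding FG_inner_cnj[symmetric] .
    thus ?thesis by (simp only: lower_all_def exp_z_def) simp
  qed
  have adjB: "FG_inner H (exp_coeff f1_deriv i F) = FG_inner (h_all (int i) * H) F" for i H
  proof -
    have "FG_inner (exp_coeff (\<lambda>k F. f1_sum k * F) i H) F = FG_inner H (exp_coeff f1_deriv i F)"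
      by (rule exp_coeff_adjoint[OF mult_comm_family comm_family_f1_deriv FG_inner_f1_sum_mult])
    thus ?thesis by (simp add: exp_coeff_mult h_all_def hexp_z_def)
  qed
  let ?f = "\<lambda>j. exp_z ?A (int m + j) (exp_z ?B j F)"
  let ?g = "\<lambda>j. FG_scale (?q powi (- j)) (h_all j * lower_all (int m + j) G)"
  have Alin: "FG_linear (exp_coeff ?A i)" for i
    by (rule comm_family.exp_coeff_linear[OF mult_comm_family])
  obtain K where K: "\<And>j. j \<ge> K \<Longrightarrow> exp_coeff f1_deriv j F = 0" using f1_deriv_exp_eventually_0 by blast
  obtain L where L: "\<And>j. j \<ge> L \<Longrightarrow> lower_all j G = 0" using lower_all_eventually_0 by blast
  let ?I = "{0..max (int K) L}"
  have f0: "?f j = 0" if "j \<notin> ?I" for j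
  proof (cases "j < 0")
    case True thus ?thesis by (simp add: exp_z_def FG_linear_0[OF Alin])
  next
    case False
    hence "nat j \<ge> K" using that by auto
    thus ?thesis using False by (simp add: exp_z_def B K FG_linear_0[OF Alin])
  qed
  have g0: "?g j = 0" if "j \<notin> ?I" for j
    using that L by (cases "j < 0") (auto simp: h_all_neg)
  have "Q_op (int m) F = Sum_any ?f"
    unfolding Q_op_def by (rule vertex_coeff_int) (rule Alin)+
  also have "\<dots> = (\<Sum>j\<in>?I. ?f j)"
    by (rule Sum_any.expand_superset) (use f0 in blast)+
  finally have "FG_inner G (Q_op (int m) F) = (\<Sum>j\<in>?I. FG_inner G (?f j))"
    by (simp add: FG_inner_sum_right)
  also have "\<dots> = (\<Sum>j\<in>?I. (-1) ^ m * FG_inner (?g j) F)"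
  proof (intro sum.cong refl)
    fix j assume "j \<in> ?I"
    then obtain i where i: "j = int i" by (metis atLeastAtMost_iff nonneg_int_cases)
    have "(-1) ^ (m + i) * (- 1 / ?q) ^ i = (-1) ^ m * (?q powi (- j))"
      by (simp add: i power_int_minus power_add power_divide field_simps flip: power_mult_distrib)
    hence s: "cnj ((-1) ^ (m + i) * (- 1 / ?q) ^ i) = (-1) ^ m * (?q powi (- j))"
      by simp
    have "?f j = FG_scale ((-1) ^ (m + i) * (- 1 / ?q) ^ i) (exp_coeff ?A' (m + i) (exp_coeff f1_deriv i F))"
    proof -
      have "?f j = exp_coeff ?A (m + i) (exp_coeff ?B i F)" by (simp add: i exp_z_def nat_add_distrib)
      thus ?thesis
        by (simp only: A B FG_linear_scale[OF comm_family.exp_coeff_linear[OF mult_comm_family]] FG_scale_scale)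
    qed
    hence "FG_inner G (?f j) = (-1) ^ m * (?q powi (- j)) * FG_inner (h_all (int i) * lower_all (int (m + i)) G) F"
      by (simp only: FG_inner_scale_right s adjA adjB)
    thus "FG_inner G (?f j) = (-1) ^ m * FG_inner (?g j) F"
      by (simp add: FG_inner_scale_left i)
  qed
  also have "\<dots> = (-1) ^ m * FG_inner (\<Sum>j\<in>?I. ?g j) F"
    by (simp add: FG_inner_sum_left sum_distrib_left)
  also have "(\<Sum>j\<in>?I. ?g j) = Q_adj (int m) G"
    unfolding Q_adj_def by (rule Sum_any.expand_superset[symmetric]) (use g0 in blast)+
  finally show ?thesis .
qed

lemma Q_adj_1: "Q_adj m (1 :: 'a::{finite,field} FG) = FG_scale (of_nat CARD('a) powi m) (h_all (- m))"
proof -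
  have "Q_adj m (1 :: 'a FG) = Sum_any (\<lambda>j. if j = - m then FG_scale (of_nat CARD('a) powi m) (h_all (- m)) else 0)"
    unfolding Q_adj_def by (rule Sum_any.cong) (auto simp: lower_all_1)
  thus ?thesis by simp
qed

section \<open>Iteration over the colours\<close>

text \<open>The product over an arbitrary finite set of colours, with an arbitrary vector in place of \<open>1\<close>, so that
induction on the set and splitting off of factors are possible.\<close>

definition S_prod :: "('a::{finite,field} Phi_star \<Rightarrow> int list) \<Rightarrow> 'a Phi_star set \<Rightarrow> 'a FG \<Rightarrow> 'a FG" where
  "S_prod \<alpha> C G = Finite_Set.fold (\<lambda>\<phi>. S_seq \<phi> (\<alpha> \<phi>)) G C"

lemma comp_fun_commute_S_seq: "comp_fun_commute_on UNIV (\<lambda>\<phi>. S_seq \<phi> (\<alpha> \<phi>))"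
proof
  fix \<phi> \<psi>
  show "S_seq \<psi> (\<alpha> \<psi>) \<circ> S_seq \<phi> (\<alpha> \<phi>) = S_seq \<phi> (\<alpha> \<phi>) \<circ> S_seq \<psi> (\<alpha> \<psi>)"
    by (cases "\<phi> = \<psi>") (auto simp: fun_eq_iff S_seq_commute[of \<psi> \<phi>])
qed

lemma S_prod_empty [simp]: "S_prod \<alpha> {} G = G"
  by (simp add: S_prod_def)

lemma S_prod_insert: "finite C \<Longrightarrow> \<phi> \<notin> C \<Longrightarrow> S_prod \<alpha> (insert \<phi> C) G = S_seq \<phi> (\<alpha> \<phi>) (S_prod \<alpha> C G)"
  unfolding S_prod_def by (rule comp_fun_commute_on.fold_insert[OF comp_fun_commute_S_seq subset_UNIV])

lemma S_prod_cong: "finite C \<Longrightarrow> (\<And>\<phi>. \<phi> \<in> C \<Longrightarrow> \<alpha> \<phi> = \<beta> \<phi>) \<Longrightarrow> S_prod \<alpha> C G = S_prod \<beta> C G"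
  by (induct C rule: finite_induct) (simp_all add: S_prod_insert)

lemma S_prod_linear: "finite C \<Longrightarrow> FG_linear (S_prod \<alpha> C)"
proof (induct C rule: finite_induct)
  case (insert \<phi> C)
  thus ?case using S_seq_linear[of \<phi> "\<alpha> \<phi>"] by (simp add: FG_linear_def S_prod_insert)
qed (simp add: FG_linear_def)

lemma S_prod_restrict:
  assumes "finite D" "C \<subseteq> D" "\<And>\<phi>. \<phi> \<in> D - C \<Longrightarrow> \<alpha> \<phi> = []"
  shows "S_prod \<alpha> D G = S_prod \<alpha> C G"
proof -
  have fC: "finite C" using assms(1,2) finite_subset by blast
  have "finite E \<Longrightarrow> E \<inter> C = {} \<Longrightarrow> (\<And>\<phi>. \<phi> \<in> E \<Longrightarrow> \<alpha> \<phi> = []) \<Longrightarrow> S_prod \<alpha> (E \<union> C) G = S_prod \<alpha> C G" for E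
    by (induct E rule: finite_induct) (use fC in \<open>simp_all add: S_prod_insert\<close>)
  moreover have "D - C \<union> C = D" "(D - C) \<inter> C = {}" using assms(2) by blast+
  ultimately show ?thesis using assms(1,3) by (metis finite_Diff)
qed

lemma S_colored_eq_S_prod:
  assumes "finite C" "{\<phi>. \<alpha> \<phi> \<noteq> []} \<subseteq> C"
  shows "S_colored \<alpha> = S_prod \<alpha> C 1"
proof -
  have "S_prod \<alpha> C 1 = S_prod \<alpha> {\<phi>. \<alpha> \<phi> \<noteq> []} 1" by (rule S_prod_restrict[OF assms]) auto
  thus ?thesis by (simp add: S_colored_def S_prod_def)
qed

lemma S_seq_S_prod_commute: "finite C \<Longrightarrow> \<phi> \<notin> C \<Longrightarrow> S_seq \<phi> xs (S_prod \<alpha> C G) = S_prod \<alpha> C (S_seq \<phi> xs G)"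
  by (induct C rule: finite_induct) (auto simp: S_prod_insert S_seq_commute[of \<phi>])

lemma S_prod_append: "finite C \<Longrightarrow> S_prod (\<lambda>\<phi>. \<alpha> \<phi> @ \<beta> \<phi>) C G = S_prod \<alpha> C (S_prod \<beta> C G)"
  by (induct C rule: finite_induct) (simp_all add: S_prod_insert S_seq_append S_seq_S_prod_commute)

lemma lower_le_S_prod: "finite C \<Longrightarrow> \<phi> \<notin> C \<Longrightarrow> lower_le \<phi> k G \<Longrightarrow> lower_le \<phi> k (S_prod \<alpha> C G)"
  by (induct C rule: finite_induct) (auto simp: S_prod_insert lower_le_S_seq_diff)

definition sub_compositions_on :: "('a::{finite,field} Phi_star \<Rightarrow> nat list) \<Rightarrow> 'a Phi_star set \<Rightarrow> ('a Phi_star \<Rightarrow> nat list) set" where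
  "sub_compositions_on l C = {\<tau>. (\<forall>\<phi>\<in>C. \<tau> \<phi> \<in> sub_comp_lists (l \<phi>)) \<and> (\<forall>\<phi>. \<phi> \<notin> C \<longrightarrow> \<tau> \<phi> = [])}"

lemma sum_sub_compositions_on_insert:
  assumes "\<phi> \<notin> C"
  shows "(\<Sum>\<tau>\<in>sub_compositions_on l (insert \<phi> C). f \<tau>) = (\<Sum>t\<in>sub_comp_lists (l \<phi>). \<Sum>\<tau>\<in>sub_compositions_on l C. f (\<tau>(\<phi> := t)))"
proof -
  have "(\<Sum>t\<in>sub_comp_lists (l \<phi>). \<Sum>\<tau>\<in>sub_compositions_on l C. f (\<tau>(\<phi> := t)))
      = (\<Sum>(t, \<tau>)\<in>sub_comp_lists (l \<phi>) \<times> sub_compositions_on l C. f (\<tau>(\<phi> := t)))"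
    by (rule sum.cartesian_product)
  also have "\<dots> = (\<Sum>\<tau>\<in>sub_compositions_on l (insert \<phi> C). f \<tau>)"
    by (rule sum.reindex_bij_witness[where i = "\<lambda>\<tau>. (\<tau> \<phi>, \<tau>(\<phi> := []))" and j = "\<lambda>(t, \<tau>). \<tau>(\<phi> := t)"])
      (use assms in \<open>auto simp: sub_compositions_on_def\<close>)
  finally show ?thesis by simp
qed

text \<open>The operators of the other colours do not affect \<open>lower \<phi>\<close>, so the vector on which the rows of
\<open>\<phi>\<close> act always satisfies \<open>lower_le \<phi> 0\<close>.\<close>

lemma Q_adj_S_prod:
  fixes l :: "'a::{finite,field} Phi_star \<Rightarrow> nat list"
  assumes "finite C"
  shows "Q_adj m (S_prod (\<lambda>\<phi>. map int (l \<phi>)) C 1) = (\<Sum>\<tau>\<in>sub_compositions_on l C.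
     FG_scale (\<Prod>\<phi>\<in>C. row_coeff (of_nat CARD('a) ^ size_star \<phi>) (\<tau> \<phi>))
       (S_prod (\<lambda>\<phi>. map2 (\<lambda>a b. int a - int b) (l \<phi>) (\<tau> \<phi>)) C (Q_adj (m - int (\<Sum>\<phi>\<in>C. size_star \<phi> * sum_list (\<tau> \<phi>))) 1)))"
  using assms
proof (induct C arbitrary: m rule: finite_induct)
  case empty
  have "sub_compositions_on l {} = {\<lambda>_. []}" by (auto simp: sub_compositions_on_def)
  thus ?case by simp
next
  case (insert \<phi> C)
  let ?t = "\<lambda>\<phi>. row_coeff (of_nat CARD('a) ^ size_star \<phi>)"
  let ?S = "\<lambda>\<tau> \<phi>. map2 (\<lambda>a b. int a - int b) (l \<phi>) (\<tau> \<phi>)"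
  let ?w = "\<lambda>C \<tau>. \<Sum>\<phi>\<in>C. size_star \<phi> * sum_list (\<tau> \<phi>)"
  have "Q_adj m (S_prod (\<lambda>\<phi>. map int (l \<phi>)) (insert \<phi> C) 1) = (\<Sum>t\<in>sub_comp_lists (l \<phi>). FG_scale (?t \<phi> t)
       (S_seq \<phi> (map2 (\<lambda>a b. int a - int b) (l \<phi>) t)
         (Q_adj (m - int (size_star \<phi> * sum_list t)) (S_prod (\<lambda>\<phi>. map int (l \<phi>)) C 1))))"
    unfolding S_prod_insert[OF insert(1,2)] by (rule Q_adj_S_seq[OF lower_le_S_prod[OF insert(1,2) lower_le_1]])
  also have "\<dots> = (\<Sum>t\<in>sub_comp_lists (l \<phi>). \<Sum>\<tau>\<in>sub_compositions_on l C. FG_scale (\<Prod>\<psi>\<in>insert \<phi> C. ?t \<psi> ((\<tau>(\<phi> := t)) \<psi>))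
       (S_prod (?S (\<tau>(\<phi> := t))) (insert \<phi> C) (Q_adj (m - int (?w (insert \<phi> C) (\<tau>(\<phi> := t)))) 1)))"
  proof (intro sum.cong refl)
    fix t
    have c: "(\<Prod>\<psi>\<in>C. ?t \<psi> ((\<tau>(\<phi> := t)) \<psi>)) = (\<Prod>\<psi>\<in>C. ?t \<psi> (\<tau> \<psi>))" for \<tau>
      by (rule prod.cong) (use insert(2) in auto)
    have w: "?w C (\<tau>(\<phi> := t)) = ?w C \<tau>" for \<tau>
      by (rule sum.cong) (use insert(2) in auto)
    have s: "S_prod (?S (\<tau>(\<phi> := t))) C G = S_prod (?S \<tau>) C G" for \<tau> G
      by (rule S_prod_cong[OF insert(1)]) (use insert(2) in auto)
    show "FG_scale (?t \<phi> t) (S_seq \<phi> (map2 (\<lambda>a b. int a - int b) (l \<phi>) t)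
         (Q_adj (m - int (size_star \<phi> * sum_list t)) (S_prod (\<lambda>\<phi>. map int (l \<phi>)) C 1)))
       = (\<Sum>\<tau>\<in>sub_compositions_on l C. FG_scale (\<Prod>\<psi>\<in>insert \<phi> C. ?t \<psi> ((\<tau>(\<phi> := t)) \<psi>))
       (S_prod (?S (\<tau>(\<phi> := t))) (insert \<phi> C) (Q_adj (m - int (?w (insert \<phi> C) (\<tau>(\<phi> := t)))) 1)))"
      unfolding insert(3) FG_linear_sum[OF S_seq_linear] FG_linear_scale[OF S_seq_linear] FG_scale_sum
        FG_scale_scale S_prod_insert[OF insert(1,2)] prod.insert[OF insert(1,2)] sum.insert[OF insert(1,2)] c w s
      by (simp add: algebra_simps)
  qed
  also have "\<dots> = (\<Sum>\<tau>\<in>sub_compositions_on l (insert \<phi> C). FG_scale (\<Prod>\<psi>\<in>insert \<phi> C. ?t \<psi> (\<tau> \<psi>))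
       (S_prod (?S \<tau>) (insert \<phi> C) (Q_adj (m - int (?w (insert \<phi> C) \<tau>)) 1)))"
    by (rule sum_sub_compositions_on_insert[OF insert(2), symmetric])
  finally show ?case .
qed

section \<open>One-row coloured partitions\<close>

lemma finite_size_star_le: "finite {\<phi> :: 'a::{finite,field} Phi_star. size_star \<phi> \<le> N}"
proof (rule finite_subset)
  show "{\<phi> :: 'a Phi_star. size_star \<phi> \<le> N} \<subseteq> (\<Union>n\<in>{1..N}. {\<phi>. size_star \<phi> dvd n})"
    using size_star_pos by (fastforce simp: Suc_le_eq)
qed (auto intro!: finite_size_star_dvd)

text \<open>The series \<open>\<Sum>m. h_m(\<phi>) z^(d m)\<close>; its logarithmic derivative, up to a factor
\<open>z\<close>, is \<open>p_series \<phi>\<close>.\<close>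

definition h_series :: "'a::{finite,field} Phi_star \<Rightarrow> 'a FG fps" where
  "h_series \<phi> = Abs_fps (\<lambda>n. if size_star \<phi> dvd n then h_sym \<phi> (int (n div size_star \<phi>)) else 0)"

definition p_series :: "'a::{finite,field} Phi_star \<Rightarrow> 'a FG fps" where
  "p_series \<phi> = Abs_fps (\<lambda>n. if n \<ge> 1 \<and> size_star \<phi> dvd n
     then FG_scale (of_nat (size_star \<phi>)) (p_star (n div size_star \<phi>) \<phi>) else 0)"

lemma fps_X_deriv_nth: "fps_nth (fps_X * fps_deriv f) n = of_nat n * fps_nth f n"
  by (cases n) simp_all

lemma h_sym_newton: "FG_scale (of_nat n) (h_sym \<phi> (int n)) = (\<Sum>k=1..n. p_star k \<phi> * h_sym \<phi> (int n - int k))"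
  using hexp_z_newton[of "int n" n "\<lambda>k. FG_scale (1 / of_nat k) (p_star k \<phi>)"]
  by (simp add: h_sym_def)

lemma h_series_deriv:
  fixes \<phi> :: "'a::{finite,field} Phi_star"
  shows "fps_X * fps_deriv (h_series \<phi>) = p_series \<phi> * h_series \<phi>"
proof (rule fps_ext)
  fix n
  let ?d = "size_star \<phi>"
  have d: "?d > 0" by (rule size_star_pos)
  show "fps_nth (fps_X * fps_deriv (h_series \<phi>)) n = fps_nth (p_series \<phi> * h_series \<phi>) n"
  proof (cases "?d dvd n")
    case False
    have "fps_nth (p_series \<phi>) i * fps_nth (h_series \<phi>) (n - i) = 0" if "i \<le> n" for i
      using False that by (auto simp: p_series_def h_series_def dvd_diff_nat) (metis dvd_add_right_iff le_add_diff_inverse)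
    hence "fps_nth (p_series \<phi> * h_series \<phi>) n = 0"
      by (subst fps_mult_nth) (intro sum.neutral ballI, simp)
    thus ?thesis using False by (subst fps_X_deriv_nth) (simp add: h_series_def)
  next
    case True
    then obtain m where m: "n = ?d * m" by blast
    have "fps_nth (p_series \<phi> * h_series \<phi>) n = (\<Sum>i=0..n. fps_nth (p_series \<phi>) i * fps_nth (h_series \<phi>) (n - i))"
      by (rule fps_mult_nth)
    also have "\<dots> = (\<Sum>i\<in>(\<lambda>k. ?d * k) ` {1..m}. fps_nth (p_series \<phi>) i * fps_nth (h_series \<phi>) (n - i))"
    proof (rule sum.mono_neutral_right)
      show "(\<lambda>k. ?d * k) ` {1..m} \<subseteq> {0..n}" using m by auto
      show "\<forall>i\<in>{0..n} - (\<lambda>k. ?d * k) ` {1..m}. fps_nth (p_series \<phi>) i * fps_nth (h_series \<phi>) (n - i) = 0"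
      proof
        fix i assume i: "i \<in> {0..n} - (\<lambda>k. ?d * k) ` {1..m}"
        have "\<not> (i \<ge> 1 \<and> ?d dvd i)"
        proof
          assume h: "i \<ge> 1 \<and> ?d dvd i"
          then obtain k where k: "i = ?d * k" by blast
          have "?d * k \<le> ?d * m" using i k m by simp
          hence "k \<le> m" using d by simp
          moreover have "k \<ge> 1" using h k by (cases k) auto
          ultimately have "k \<in> {1..m}" by simp
          thus False using i k by blast
        qed
        thus "fps_nth (p_series \<phi>) i * fps_nth (h_series \<phi>) (n - i) = 0" by (auto simp: p_series_def)
      qed
    qed simp
    also have "\<dots> = (\<Sum>k=1..m. fps_nth (p_series \<phi>) (?d * k) * fps_nth (h_series \<phi>) (n - ?d * k))"
      using d by (subst sum.reindex) (auto intro: inj_onI)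
    also have "\<dots> = (\<Sum>k=1..m. FG_scale (of_nat ?d) (p_star k \<phi> * h_sym \<phi> (int m - int k)))"
    proof (intro sum.cong refl)
      fix k assume k: "k \<in> {1..m}"
      have "n - ?d * k = ?d * (m - k)" by (simp add: m right_diff_distrib')
      thus "fps_nth (p_series \<phi>) (?d * k) * fps_nth (h_series \<phi>) (n - ?d * k) = FG_scale (of_nat ?d) (p_star k \<phi> * h_sym \<phi> (int m - int k))"
        using k d by (simp add: p_series_def h_series_def FG_scale_mult_left of_nat_diff Suc_le_eq)
    qed
    also have "\<dots> = FG_scale (of_nat ?d) (FG_scale (of_nat m) (h_sym \<phi> (int m)))"
      by (simp only: h_sym_newton FG_scale_sum)
    also have "\<dots> = fps_nth (fps_X * fps_deriv (h_series \<phi>)) n"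
      using d by (subst fps_X_deriv_nth) (simp add: h_series_def m of_nat_mult_FG flip: of_nat_mult)
    finally show ?thesis ..
  qed
qed

lemma prod_h_series_deriv:
  "finite C \<Longrightarrow> fps_X * fps_deriv (\<Prod>\<phi>\<in>C. h_series \<phi>) = (\<Sum>\<phi>\<in>C. p_series \<phi>) * (\<Prod>\<phi>\<in>C. h_series \<phi>)"
proof (induct C rule: finite_induct)
  case (insert \<phi> C)
  let ?P = "\<Prod>\<phi>\<in>C. h_series \<phi>"
  have "fps_X * fps_deriv (h_series \<phi> * ?P) = h_series \<phi> * (fps_X * fps_deriv ?P) + (fps_X * fps_deriv (h_series \<phi>)) * ?P"
    by (simp add: algebra_simps)
  also have "\<dots> = (p_series \<phi> + (\<Sum>\<phi>\<in>C. p_series \<phi>)) * (h_series \<phi> * ?P)"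
    unfolding insert(3) h_series_deriv by (simp add: algebra_simps)
  finally show ?case using insert by simp
qed simp

text \<open>Both sides satisfy Newton's recursion up to degree \<open>N\<close>, because the logarithmic derivative of the
product is the sum over the colours, and colours of size greater than \<open>N\<close> do not contribute.\<close>

lemma h_all_eq_prod_h_series:
  fixes C :: "'a::{finite,field} Phi_star set"
  assumes fin: "finite C" and C: "{\<phi>. size_star \<phi> \<le> N} \<subseteq> C"
  shows "h_all (int N) = fps_nth (\<Prod>\<phi>\<in>C. h_series \<phi>) N"
proof -
  let ?Y = "fps_nth (\<Prod>\<phi>\<in>C. h_series \<phi>)"
  have "?Y N = hexp f1_sum N"
  proof (rule hexp_unique[OF _ _ order_refl])
    show "?Y 0 = 1"
      using fin by (induct C rule: finite_induct) (simp_all add: h_series_def h_sym_def hexp_z_def hexp_0)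
    fix n assume n: "n \<ge> (1::nat)" "n \<le> N"
    have "FG_scale (of_nat n) (?Y n) = fps_nth (fps_X * fps_deriv (\<Prod>\<phi>\<in>C. h_series \<phi>)) n"
      by (subst fps_X_deriv_nth) (simp add: of_nat_mult_FG)
    also have "\<dots> = (\<Sum>i=0..n. fps_nth (\<Sum>\<phi>\<in>C. p_series \<phi>) i * ?Y (n - i))"
      unfolding prod_h_series_deriv[OF fin] by (rule fps_mult_nth)
    also have "\<dots> = (\<Sum>i=1..n. fps_nth (\<Sum>\<phi>\<in>C. p_series \<phi>) i * ?Y (n - i))"
      by (rule sum.mono_neutral_right) (auto simp: p_series_def fps_sum_nth)
    also have "\<dots> = (\<Sum>i=1..n. FG_scale (of_nat i) (f1_sum i) * ?Y (n - i))"
    proof (intro sum.cong refl arg_cong2[where f = "(*)"])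
      fix i assume i: "i \<in> {1..n}"
      have sub: "{\<phi>. size_star \<phi> dvd i} \<subseteq> C" using i n C by (auto dest!: dvd_imp_le)
      have "fps_nth (\<Sum>\<phi>\<in>C. p_series \<phi>) i = (\<Sum>\<phi>\<in>C. if size_star \<phi> dvd i
         then FG_scale (of_nat (size_star \<phi>)) (p_star (i div size_star \<phi>) \<phi>) else 0)"
        unfolding fps_sum_nth using i by (intro sum.cong) (auto simp: p_series_def)
      also have "\<dots> = (\<Sum>\<phi>\<in>{\<phi>. size_star \<phi> dvd i}. FG_scale (of_nat (size_star \<phi>)) (p_star (i div size_star \<phi>) \<phi>))"
        by (rule sum.mono_neutral_cong_right[OF fin sub]) auto
      finally show "fps_nth (\<Sum>\<phi>\<in>C. p_series \<phi>) i = FG_scale (of_nat i) (f1_sum i)"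
        using i by (simp add: f1_sum_scale)
    qed
    finally show "FG_scale (of_nat n) (?Y n) = (\<Sum>i=1..n. FG_scale (of_nat i) (f1_sum i) * ?Y (n - i))" .
  qed
  thus ?thesis by (simp add: h_all_def hexp_z_def)
qed

definition one_row :: "nat \<Rightarrow> ('a::{finite,field} Phi_star \<Rightarrow> nat list) set" where
  "one_row N = {\<rho> \<in> colored_partitions N. \<forall>\<phi>. length (\<rho> \<phi>) \<le> 1}"

lemma colored_weight_superset:
  assumes "finite C" "{\<phi>. l \<phi> \<noteq> []} \<subseteq> C"
  shows "colored_weight l = (\<Sum>\<phi>\<in>C. size_star \<phi> * sum_list (l \<phi>))"
  unfolding colored_weight_def using assms by (intro sum.mono_neutral_left) auto

text \<open>Only \<open>j = 0\<close> contributes to the sum defining \<open>S_op\<close>.\<close>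

lemma S_op_free:
  assumes "lower_le \<phi> 0 F"
  shows "S_op \<phi> n F = h_sym \<phi> n * F"
proof -
  have "lower \<phi> 0 F = F"
    using comm_family.exp_coeff_0[OF comm_family_uminus_FG_pd, of \<phi> F] by (simp add: lower_def exp_z_def)
  hence "h_sym \<phi> (n + j) * lower \<phi> j F = (if j = 0 then h_sym \<phi> n * F else 0)" for j
    using assms by (cases j "0 :: int" rule: linorder_cases) (auto simp: lower_neg lower_le_def)
  thus ?thesis by (simp add: S_op_Sum_any)
qed

lemma S_prod_one_row:
  assumes "finite C" "\<And>\<phi>. length (\<rho> \<phi>) \<le> 1"
  shows "S_prod (\<lambda>\<phi>. map int (\<rho> \<phi>)) C 1 = (\<Prod>\<phi>\<in>C. h_sym \<phi> (int (sum_list (\<rho> \<phi>))))"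
  using assms(1)
proof (induct C rule: finite_induct)
  case (insert \<phi> C)
  have L: "lower_le \<phi> 0 (S_prod (\<lambda>\<phi>. map int (\<rho> \<phi>)) C 1)" by (rule lower_le_S_prod[OF insert(1,2) lower_le_1])
  show ?case
  proof (cases "\<rho> \<phi>")
    case Nil
    thus ?thesis using insert by (simp add: S_prod_insert h_sym_def hexp_z_def hexp_0)
  next
    case (Cons a xs)
    hence "\<rho> \<phi> = [a]" using assms(2)[of \<phi>] by simp
    thus ?thesis using insert S_op_free[OF L] by (simp add: S_prod_insert S_seq_Cons)
  qed
qed simp

text \<open>The coefficients of a finite product of power series are sums over multisets of colours. The nonzero terms belong
to multisets in which each \<open>\<phi>\<close> has multiplicity divisible by \<open>d\<close>, and these are the
coloured partitions with at most one row in each colour.\<close>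

lemma h_all_one_row:
  "h_all (int N) = (\<Sum>\<rho>\<in>one_row N. S_colored (\<lambda>\<phi>. map int (\<rho> \<phi>)) :: 'a::{finite,field} FG)"
proof -
  define C where "C = {\<phi> :: 'a Phi_star. size_star \<phi> \<le> N}"
  have fin: "finite C" unfolding C_def by (rule finite_size_star_le)
  let ?d = "size_star :: 'a Phi_star \<Rightarrow> nat"
  let ?M = "multisets_of_size C N"
  let ?M' = "{\<Xi> \<in> ?M. \<forall>\<phi>\<in>C. ?d \<phi> dvd count \<Xi> \<phi>}"
  define row where "row \<Xi> \<phi> = (if count \<Xi> \<phi> = 0 then [] else [count \<Xi> \<phi> div ?d \<phi>])" for \<Xi> \<phi>
  have finM: "finite ?M" using fin by (rule finite_multisets_of_size)
  have supp: "{\<phi>. \<rho> \<phi> \<noteq> []} \<subseteq> C" if "\<rho> \<in> one_row N" for \<rho>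
  proof
    fix \<phi> assume \<phi>: "\<phi> \<in> {\<phi>. \<rho> \<phi> \<noteq> []}"
    have r: "finite {\<phi>. \<rho> \<phi> \<noteq> []}" "is_partition (\<rho> \<phi>)" "colored_weight \<rho> = N"
      using that by (auto simp: one_row_def colored_partitions_def)
    obtain a xs where a: "\<rho> \<phi> = a # xs" using \<phi> by (cases "\<rho> \<phi>") auto
    hence "a \<noteq> 0" using r(2) by (auto simp: is_partition_def)
    hence "?d \<phi> \<le> ?d \<phi> * sum_list (\<rho> \<phi>)" using a by simp
    also have "\<dots> \<le> N" unfolding r(3)[symmetric] colored_weight_def
      by (rule member_le_sum[OF \<phi>]) (use r(1) in auto)
    finally show "\<phi> \<in> C" by (simp add: C_def)
  qed
  have "h_all (int N) = (\<Sum>\<Xi>\<in>?M. \<Prod>\<phi>\<in>C. fps_nth (h_series \<phi>) (count \<Xi> \<phi>))"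
  proof -
    have "{\<phi>. size_star \<phi> \<le> N} \<subseteq> C" by (simp add: C_def)
    from h_all_eq_prod_h_series[OF fin this] show ?thesis by (simp only: fps_prod_nth'[OF fin])
  qed
  also have "\<dots> = (\<Sum>\<Xi>\<in>?M'. \<Prod>\<phi>\<in>C. fps_nth (h_series \<phi>) (count \<Xi> \<phi>))"
  proof (rule sum.mono_neutral_right[OF finM])
    show "\<forall>\<Xi>\<in>?M - ?M'. (\<Prod>\<phi>\<in>C. fps_nth (h_series \<phi>) (count \<Xi> \<phi>)) = 0"
    proof
      fix \<Xi> assume "\<Xi> \<in> ?M - ?M'"
      then obtain \<phi> where "\<phi> \<in> C" "\<not> ?d \<phi> dvd count \<Xi> \<phi>" by blast
      thus "(\<Prod>\<phi>\<in>C. fps_nth (h_series \<phi>) (count \<Xi> \<phi>)) = 0"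
        using fin prod.remove[OF fin, of \<phi> "\<lambda>\<phi>. fps_nth (h_series \<phi>) (count \<Xi> \<phi>)"] by (simp add: h_series_def)
    qed
  qed blast
  also have "\<dots> = (\<Sum>\<rho>\<in>one_row N. S_colored (\<lambda>\<phi>. map int (\<rho> \<phi>)))"
  proof (rule sum.reindex_bij_witness[where j = row and i = "\<lambda>\<rho>. Abs_multiset (\<lambda>\<phi>. ?d \<phi> * sum_list (\<rho> \<phi>))"])
    fix \<Xi> assume \<Xi>: "\<Xi> \<in> ?M'"
    have sub: "set_mset \<Xi> \<subseteq> C" and size: "size \<Xi> = N" using \<Xi> by (auto simp: multisets_of_size_def)
    have cnt: "?d \<phi> * sum_list (row \<Xi> \<phi>) = count \<Xi> \<phi>" for \<phi>
    proof (cases "\<phi> \<in> C")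
      case True thus ?thesis using \<Xi> by (simp add: row_def)
    next
      case False
      hence "count \<Xi> \<phi> = 0" using sub by (metis count_eq_zero_iff subsetD)
      thus ?thesis by (simp add: row_def)
    qed
    thus "Abs_multiset (\<lambda>\<phi>. ?d \<phi> * sum_list (row \<Xi> \<phi>)) = \<Xi>" by (simp add: count_inverse)
    have s: "{\<phi>. row \<Xi> \<phi> \<noteq> []} \<subseteq> C" using sub by (auto simp: row_def count_eq_zero_iff split: if_splits)
    have "colored_weight (row \<Xi>) = (\<Sum>\<phi>\<in>C. count \<Xi> \<phi>)"
      unfolding colored_weight_superset[OF fin s] cnt ..
    also have "\<dots> = (\<Sum>\<phi>\<in>set_mset \<Xi>. count \<Xi> \<phi>)"
      using sub fin by (intro sum.mono_neutral_right) (auto simp: count_eq_zero_iff)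
    also have "\<dots> = N" using size by (simp add: size_multiset_overloaded_eq)
    finally have wt: "colored_weight (row \<Xi>) = N" .
    have "is_partition (row \<Xi> \<phi>)" for \<phi>
    proof (cases "count \<Xi> \<phi> = 0")
      case False
      hence "row \<Xi> \<phi> = [count \<Xi> \<phi> div ?d \<phi>]" by (simp add: row_def)
      moreover have "count \<Xi> \<phi> div ?d \<phi> \<noteq> 0"
      proof
        assume "count \<Xi> \<phi> div ?d \<phi> = 0"
        with cnt[of \<phi>] False show False by (simp only: row_def if_False) simp
      qed
      ultimately show ?thesis by (simp add: is_partition_def)
    qed (simp add: row_def is_partition_def)
    thus "row \<Xi> \<in> one_row N"
      using wt finite_subset[OF s fin] by (simp add: one_row_def colored_partitions_def) (simp add: row_def)
    have "S_colored (\<lambda>\<phi>. map int (row \<Xi> \<phi>)) = (\<Prod>\<phi>\<in>C. h_sym \<phi> (int (sum_list (row \<Xi> \<phi>))))"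
      using s by (subst S_colored_eq_S_prod[OF fin]) (auto intro!: S_prod_one_row[OF fin] simp: row_def)
    also have "\<dots> = (\<Prod>\<phi>\<in>C. fps_nth (h_series \<phi>) (count \<Xi> \<phi>))"
      by (rule prod.cong) (use \<Xi> in \<open>auto simp: h_series_def row_def\<close>)
    finally show "S_colored (\<lambda>\<phi>. map int (row \<Xi> \<phi>)) = (\<Prod>\<phi>\<in>C. fps_nth (h_series \<phi>) (count \<Xi> \<phi>))" .
  next
    fix \<rho> :: "'a Phi_star \<Rightarrow> nat list" assume \<rho>: "\<rho> \<in> one_row N"
    let ?f = "\<lambda>\<phi>. ?d \<phi> * sum_list (\<rho> \<phi>)"
    have r: "\<And>\<phi>. is_partition (\<rho> \<phi>)" "colored_weight \<rho> = N" "\<And>\<phi>. length (\<rho> \<phi>) \<le> 1"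
      using \<rho> by (auto simp: one_row_def colored_partitions_def)
    have "finite {\<phi>. 0 < ?f \<phi>}"
      by (rule finite_subset[OF _ fin]) (use supp[OF \<rho>] in \<open>force\<close>)
    hence cnt: "count (Abs_multiset ?f) = ?f" by (simp add: count_Abs_multiset)
    have set: "set_mset (Abs_multiset ?f) \<subseteq> C"
      using supp[OF \<rho>] by (auto simp: set_mset_def cnt)
    have "size (Abs_multiset ?f) = (\<Sum>\<phi>\<in>set_mset (Abs_multiset ?f). count (Abs_multiset ?f) \<phi>)"
      by (rule size_multiset_overloaded_eq)
    also have "\<dots> = (\<Sum>\<phi>\<in>C. count (Abs_multiset ?f) \<phi>)"
      by (rule sum.mono_neutral_left[OF fin set]) (simp only: Diff_iff not_in_iff ball_simps Ball_def; blast)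
    also have "\<dots> = (\<Sum>\<phi>\<in>C. ?f \<phi>)" by (simp only: cnt)
    also have "\<dots> = N" using colored_weight_superset[OF fin supp[OF \<rho>]] r(2) by simp
    finally show "Abs_multiset ?f \<in> ?M'" using set by (simp add: multisets_of_size_def cnt)
    show "row (Abs_multiset ?f) = \<rho>"
    proof
      fix \<phi>
      show "row (Abs_multiset ?f) \<phi> = \<rho> \<phi>"
      proof (cases "\<rho> \<phi>")
        case (Cons a xs)
        hence "\<rho> \<phi> = [a]" "a \<noteq> 0" using r(1,3)[of \<phi>] by (auto simp: is_partition_def)
        thus ?thesis using size_star_pos[of \<phi>] by (simp add: row_def cnt)
      qed (simp add: row_def cnt)
    qed
  qed
  finally show ?thesis .
qed

section \<open>The recursion for character values\<close>

lemma row_coeff_eq: "row_coeff Q \<tau> = Q ^ sum_list \<tau> * (\<Prod>i<length \<tau>. B_coeff Q (\<tau> ! i))"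
proof (induct \<tau>)
  case (Cons t \<tau>)
  thus ?case by (simp add: row_coeff_def power_add prod.lessThan_Suc_shift del: prod.lessThan_Suc)
qed (simp add: row_coeff_def)

lemma sub_compositions_eq: "sub_compositions l = sub_compositions_on l {\<phi>. l \<phi> \<noteq> []}"
proof (rule Set.set_eqI)
  fix \<tau>
  define P where "P \<phi> \<longleftrightarrow> length (\<tau> \<phi>) = length (l \<phi>)
    \<and> (\<forall>i<length (l \<phi>). 0 < \<tau> \<phi> ! i \<and> \<tau> \<phi> ! i \<le> add_staircase (l \<phi>) ! i)" for \<phi>
  have "P \<phi> \<longleftrightarrow> \<tau> \<phi> = []" if "l \<phi> = []" for \<phi> using that by (simp add: P_def)
  moreover have "\<tau> \<in> sub_compositions l \<longleftrightarrow> (\<forall>\<phi>. P \<phi>)" by (simp add: sub_compositions_def P_def)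
  moreover have "\<tau> \<in> sub_compositions_on l {\<phi>. l \<phi> \<noteq> []} \<longleftrightarrow> (\<forall>\<phi>. l \<phi> \<noteq> [] \<longrightarrow> P \<phi>) \<and> (\<forall>\<phi>. l \<phi> = [] \<longrightarrow> \<tau> \<phi> = [])"
    by (simp add: sub_compositions_on_def sub_comp_lists_def P_def)
  ultimately show "\<tau> \<in> sub_compositions l \<longleftrightarrow> \<tau> \<in> sub_compositions_on l {\<phi>. l \<phi> \<noteq> []}" by blast
qed

text \<open>Operators of different colours commute, so all the one-row factors can be applied first.\<close>

lemma S_colored_rho_prime:
  assumes fin: "finite {\<phi>. l \<phi> \<noteq> []}" "finite {\<phi>. \<rho> \<phi> \<noteq> []}" and \<tau>: "\<And>\<phi>. length (\<tau> \<phi>) = length (l \<phi>)"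
  shows "S_colored (rho_prime l \<tau> \<rho>) = S_prod (\<lambda>\<phi>. map2 (\<lambda>a b. int a - int b) (l \<phi>) (\<tau> \<phi>)) {\<phi>. l \<phi> \<noteq> []} (S_colored (\<lambda>\<phi>. map int (\<rho> \<phi>)))"
proof -
  let ?C = "{\<phi>. l \<phi> \<noteq> []}" and ?S = "\<lambda>\<phi>. map2 (\<lambda>a b. int a - int b) (l \<phi>) (\<tau> \<phi>)"
  let ?D = "?C \<union> {\<phi>. \<rho> \<phi> \<noteq> []}"
  have D: "finite ?D" using fin by simp
  have "S_colored (rho_prime l \<tau> \<rho>) = S_prod (rho_prime l \<tau> \<rho>) ?D 1"
    by (rule S_colored_eq_S_prod[OF D]) (auto simp: rho_prime_def)
  also have "\<dots> = S_prod ?S ?D (S_prod (\<lambda>\<phi>. map int (\<rho> \<phi>)) ?D 1)"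
    unfolding rho_prime_def by (rule S_prod_append[OF D])
  also have "S_prod (\<lambda>\<phi>. map int (\<rho> \<phi>)) ?D 1 = S_colored (\<lambda>\<phi>. map int (\<rho> \<phi>))"
    by (rule S_colored_eq_S_prod[OF D, symmetric]) auto
  also have "S_prod ?S ?D (S_colored (\<lambda>\<phi>. map int (\<rho> \<phi>))) = S_prod ?S ?C (S_colored (\<lambda>\<phi>. map int (\<rho> \<phi>)))"
    by (rule S_prod_restrict[OF D]) auto
  finally show ?thesis .
qed

text \<open>The powers \<open>q^w\<close> from the coefficients and \<open>q^(m - w)\<close> from \<open>Q_adj_1\<close>, where
\<open>w\<close> is the weight of \<open>\<tau>\<close>, combine to \<open>q^m\<close>.\<close>

lemma Q_adj_S_colored:
  fixes l :: "'a::{finite,field} Phi_star \<Rightarrow> nat list"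
  assumes fin: "finite {\<phi>. l \<phi> \<noteq> []}"
  shows "Q_adj (int m) (S_colored (\<lambda>\<phi>. map int (l \<phi>))) = FG_scale (of_nat CARD('a) ^ m)
    (\<Sum>\<tau>\<in>sub_compositions l. FG_scale (B_colored CARD('a) \<tau>)
      (\<Sum>\<rho>\<in>{\<rho>. m \<le> colored_weight \<tau> \<and> \<rho> \<in> colored_partitions (colored_weight \<tau> - m) \<and> (\<forall>\<phi>. length (\<rho> \<phi>) \<le> 1)}.
        S_colored (rho_prime l \<tau> \<rho>)))"
proof -
  let ?q = "of_nat CARD('a) :: complex"
  let ?C = "{\<phi>. l \<phi> \<noteq> []}"
  let ?S = "\<lambda>\<tau> \<phi>. map2 (\<lambda>a b. int a - int b) (l \<phi>) (\<tau> \<phi>)"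
  let ?R = "\<lambda>\<tau>. {\<rho>. m \<le> colored_weight \<tau> \<and> \<rho> \<in> colored_partitions (colored_weight \<tau> - m) \<and> (\<forall>\<phi>. length (\<rho> \<phi>) \<le> 1)}"
  have q: "?q \<noteq> 0" by simp
  have "Q_adj (int m) (S_colored (\<lambda>\<phi>. map int (l \<phi>))) = Q_adj (int m) (S_prod (\<lambda>\<phi>. map int (l \<phi>)) ?C 1)"
    by (subst S_colored_eq_S_prod[OF fin]) auto
  also have "\<dots> = (\<Sum>\<tau>\<in>sub_compositions l.
     FG_scale (\<Prod>\<phi>\<in>?C. row_coeff (?q ^ size_star \<phi>) (\<tau> \<phi>))
       (S_prod (?S \<tau>) ?C (Q_adj (int m - int (\<Sum>\<phi>\<in>?C. size_star \<phi> * sum_list (\<tau> \<phi>))) 1)))"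
    unfolding sub_compositions_eq by (rule Q_adj_S_prod[OF fin])
  also have "\<dots> = (\<Sum>\<tau>\<in>sub_compositions l. FG_scale (?q ^ m) (FG_scale (B_colored CARD('a) \<tau>)
      (\<Sum>\<rho>\<in>?R \<tau>. S_colored (rho_prime l \<tau> \<rho>))))"
  proof (intro sum.cong refl)
    fix \<tau> assume \<tau>: "\<tau> \<in> sub_compositions l"
    have len: "length (\<tau> \<phi>) = length (l \<phi>)" for \<phi> using \<tau> by (simp add: sub_compositions_def)
    have supp: "{\<phi>. \<tau> \<phi> \<noteq> []} = ?C" using len by (metis length_0_conv)
    define w where "w = colored_weight \<tau>"
    have w: "(\<Sum>\<phi>\<in>?C. size_star \<phi> * sum_list (\<tau> \<phi>)) = w"
      unfolding w_def colored_weight_def supp ..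
    have c: "(\<Prod>\<phi>\<in>?C. row_coeff (?q ^ size_star \<phi>) (\<tau> \<phi>)) = ?q ^ w * B_colored CARD('a) \<tau>"
      unfolding row_coeff_eq prod.distrib B_colored_def supp w[symmetric]
      by (simp add: power_sum power_mult)
    have H: "S_prod (?S \<tau>) ?C (h_all (int w - int m)) = (\<Sum>\<rho>\<in>?R \<tau>. S_colored (rho_prime l \<tau> \<rho>))"
    proof (cases "m \<le> w")
      case False
      thus ?thesis by (simp add: h_all_neg FG_linear_0[OF S_prod_linear[OF fin]] w_def)
    next
      case True
      have R: "?R \<tau> = one_row (w - m)" using True by (auto simp: one_row_def w_def)
      have "S_prod (?S \<tau>) ?C (h_all (int (w - m))) = (\<Sum>\<rho>\<in>one_row (w - m). S_prod (?S \<tau>) ?C (S_colored (\<lambda>\<phi>. map int (\<rho> \<phi>))))"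
        unfolding h_all_one_row by (rule FG_linear_sum[OF S_prod_linear[OF fin]])
      also have "\<dots> = (\<Sum>\<rho>\<in>one_row (w - m). S_colored (rho_prime l \<tau> \<rho>))"
        by (intro sum.cong refl S_colored_rho_prime[OF fin _ len, symmetric])
          (auto simp: one_row_def colored_partitions_def)
      finally have "S_prod (?S \<tau>) ?C (h_all (int w - int m)) = (\<Sum>\<rho>\<in>one_row (w - m). S_colored (rho_prime l \<tau> \<rho>))"
        using True by (simp add: of_nat_diff)
      thus ?thesis by (simp only: R)
    qed
    have "?q ^ w * (?q powi (int m - int w)) = ?q ^ m"
      using q by (simp add: power_int_diff)
    hence e: "?q ^ w * B_colored CARD('a) \<tau> * (?q powi (int m - int w)) = ?q ^ m * B_colored CARD('a) \<tau>"
      by (metis mult.assoc mult.commute)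
    show "FG_scale (\<Prod>\<phi>\<in>?C. row_coeff (?q ^ size_star \<phi>) (\<tau> \<phi>))
       (S_prod (?S \<tau>) ?C (Q_adj (int m - int (\<Sum>\<phi>\<in>?C. size_star \<phi> * sum_list (\<tau> \<phi>))) 1))
       = FG_scale (?q ^ m) (FG_scale (B_colored CARD('a) \<tau>) (\<Sum>\<rho>\<in>?R \<tau>. S_colored (rho_prime l \<tau> \<rho>)))"
      unfolding c w Q_adj_1 FG_linear_scale[OF S_prod_linear[OF fin]] FG_scale_scale minus_diff_eq H e ..
  qed
  finally show ?thesis by (simp only: FG_scale_sum)
qed

text \<open>Removing the first part lowers the index of each other part by one.\<close>

lemma n_stat_Cons: "n_stat (m # \<mu>) = n_stat \<mu> + sum_list \<mu>"
proof -
  have "n_stat (m # \<mu>) = (\<Sum>i<length \<mu>. Suc i * \<mu> ! i)"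
    by (simp add: n_stat_def sum.lessThan_Suc_shift del: sum.lessThan_Suc)
  also have "\<dots> = n_stat \<mu> + (\<Sum>i<length \<mu>. \<mu> ! i)"
    by (simp add: n_stat_def sum.distrib)
  also have "(\<Sum>i<length \<mu>. \<mu> ! i) = sum_list \<mu>"
    by (simp add: sum_list_sum_nth atLeast0LessThan)
  finally show ?thesis .
qed

lemma colored_weight_0:
  assumes "l \<in> colored_partitions 0"
  shows "l = (\<lambda>_. [])"
proof
  fix \<phi>
  show "l \<phi> = []"
  proof (cases "l \<phi>")
    case (Cons a xs)
    have fin: "finite {\<phi>. l \<phi> \<noteq> []}" and wt: "(\<Sum>\<phi>\<in>{\<phi>. l \<phi> \<noteq> []}. size_star \<phi> * sum_list (l \<phi>)) = 0"
      using assms by (auto simp: colored_partitions_def colored_weight_def)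
    have "\<forall>\<phi>\<in>{\<phi>. l \<phi> \<noteq> []}. size_star \<phi> * sum_list (l \<phi>) = 0"
      using wt unfolding sum_eq_0_iff[OF fin] .
    moreover have "\<phi> \<in> {\<phi>. l \<phi> \<noteq> []}" using Cons by simp
    ultimately have "size_star \<phi> * sum_list (l \<phi>) = 0" by blast
    hence "a = 0" using Cons size_star_pos[of \<phi>] by simp
    moreover have "0 \<notin> set (l \<phi>)" using assms by (simp add: colored_partitions_def is_partition_def)
    ultimately show ?thesis using Cons by simp
  qed
qed

theorem theorem3p9:
  fixes q n :: nat
    and l :: "'a::{finite,field} Phi_star \<Rightarrow> nat list"
    and \<mu> :: "nat list"
  assumes "q = CARD('a)"
    and "l \<in> colored_partitions n"
    and "is_partition \<mu>" and "sum_list \<mu> = n"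
  shows "unip_char (\<lambda>\<phi>. map int (l \<phi>)) \<mu> =
    (-1) ^ first_part \<mu> * of_nat q ^ sum_list \<mu> *
    (\<Sum>\<tau>\<in>sub_compositions l. B_colored q \<tau> *
      (\<Sum>\<rho>\<in>{\<rho>. first_part \<mu> \<le> colored_weight \<tau> \<and>
                 \<rho> \<in> colored_partitions (colored_weight \<tau> - first_part \<mu>) \<and>
                 (\<forall>\<phi>. length (\<rho> \<phi>) \<le> 1)}.
        unip_char (rho_prime l \<tau> \<rho>) (tl \<mu>)))"
proof (cases \<mu>)
  case Nil
  let ?e = "(\<lambda>_. []) :: 'a Phi_star \<Rightarrow> nat list"
  have l: "l = ?e" using assms(2,4) Nil colored_weight_0 by simp
  have s: "sub_compositions l = {?e}" by (auto simp: sub_compositions_def l)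
  have w: "colored_weight ?e = 0" by (simp add: colored_weight_def)
  have r: "{\<rho>. 0 \<le> colored_weight ?e \<and> \<rho> \<in> colored_partitions (colored_weight ?e - 0) \<and> (\<forall>\<phi>. length (\<rho> \<phi>) \<le> 1)} = {?e}"
    using colored_weight_0 by (auto simp: w) (auto simp: colored_partitions_def w is_partition_def)
  have "rho_prime l ?e ?e = (\<lambda>_. [])" by (simp add: rho_prime_def l)
  thus ?thesis unfolding Nil s using r by (simp add: first_part_def B_colored_def l)
next
  case (Cons m \<mu>')
  let ?q = "of_nat CARD('a) :: complex"
  let ?F = "foldr Q_op (map int \<mu>') 1 :: 'a FG"
  let ?R = "\<lambda>\<tau>. {\<rho>. m \<le> colored_weight \<tau> \<and> \<rho> \<in> colored_partitions (colored_weight \<tau> - m) \<and> (\<forall>\<phi>. length (\<rho> \<phi>) \<le> 1)}"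
  have fin: "finite {\<phi>. l \<phi> \<noteq> []}" using assms(2) by (simp add: colored_partitions_def)
  have "FG_inner (S_colored (\<lambda>\<phi>. map int (l \<phi>))) (Q_op (int m) ?F)
      = (-1) ^ m * ?q ^ m * (\<Sum>\<tau>\<in>sub_compositions l. B_colored CARD('a) \<tau> *
          (\<Sum>\<rho>\<in>?R \<tau>. FG_inner (S_colored (rho_prime l \<tau> \<rho>)) ?F))"
    unfolding FG_inner_Q_op Q_adj_S_colored[OF fin] FG_inner_scale_left FG_inner_sum_left by simp
  moreover have "?q ^ n_stat \<mu> * ?q ^ m = ?q ^ sum_list \<mu> * ?q ^ n_stat \<mu>'"
    unfolding Cons n_stat_Cons by (simp add: power_add)
  ultimately have "?q ^ n_stat \<mu> * FG_inner (S_colored (\<lambda>\<phi>. map int (l \<phi>))) (Q_op (int m) ?F)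
      = (-1) ^ m * ?q ^ sum_list \<mu> * (?q ^ n_stat \<mu>' * (\<Sum>\<tau>\<in>sub_compositions l. B_colored CARD('a) \<tau> *
          (\<Sum>\<rho>\<in>?R \<tau>. FG_inner (S_colored (rho_prime l \<tau> \<rho>)) ?F)))"
    by (simp add: mult_ac)
  thus ?thesis
    unfolding unip_char_def assms(1) Cons first_part_def
    by (simp add: sum_distrib_left mult_ac)
qed

end
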